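(* Let $\Lambda$ be a subset of the unit disk $\mathbb{D}$. The following properties are equivalent: (a) $\Lambda$ is a sampling set for $\mathcal{N}^+$. (b) $\Lambda$ is a determination set for $\mathcal{N}^+$. (c) $\Lambda$ is a strongly sampling set for $\mathcal{N}^+$. (d) $|NT(\Lambda)|=2\pi$.
   Context: $\mathbb{D}$ is the open unit disk, $\mathbb{T}=\partial\mathbb{D}$, and $|\cdot|$ applied to subsets of $\mathbb{T}$ is arc-length (Lebesgue) measure. The Nevanlinna class is $$\mathcal{N}=\Bigl\{f\in \mathrm{Hol}(\mathbb{D}):\lim_{r\to1}\frac1{2\pi}\int_0^{2\pi}\log^+|f(re^{i\theta})|\,d\theta<\infty\Bigr\},$$ and the Smirnov class is $$\mathcal{N}^+=\Bigl\{f\in\mathcal{N}:\lim_{r\to1}\frac1{2\pi}\int_0^{2\pi}\log^+|f(re^{i\theta})|\,d\theta=\frac1{2\pi}\int_0^{2\pi}\log^+|f^*(e^{i\theta})|\,d\theta<\infty\Bigr\},$$ where $f^*(e^{i\theta})$ is the non-tangential limit of $f$ at $e^{i\theta}$ (it exists a.e.). $\mathrm{Har}_+(\mathbb{D})$ is the set of non-negative harmonic functions on $\mathbb{D}$. For $f\in\mathcal{N}$ put $N(f)=\inf\{h(0): h\in\mathrm{Har}_+(\mathbb{D}),\ \log(1+|f|)\le h \text{ on } \mathbb{D}\}$ and $N(f|\Lambda)=\inf\{h(0): h\in\mathrm{Har}_+(\mathbb{D}),\ \log(1+|f(\lambda)|)\le h(\lambda)\ \forall\lambda\in\Lambda\}$.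 $\Lambda$ is sampling for $\mathcal{N}^+$ if there exists $C>0$ such that $N(f)\le N(f|\Lambda)+C$ for all $f\in\mathcal{N}^+$. $\Lambda$ is a determination set for $\mathcal{N}^+$ if every $f\in\mathcal{N}^+$ with $\sup_\Lambda|f|<\infty$ is bounded on $\mathbb{D}$. $\Lambda$ is strongly sampling for $\mathcal{N}^+$ if whenever $f\in\mathcal{N}^+$ and $h\in\mathrm{Har}_+(\mathbb{D})$ satisfy $\log^+|f(\lambda)|\le h(\lambda)$ for all $\lambda\in\Lambda$, then $\log^+|f|\le h$ on $\mathbb{D}$. $NT(\Lambda)$ is the set of $\zeta\in\mathbb{T}$ that are a non-tangential limit of points of $\Lambda$, i.e. for which there is a sequence in $\Lambda$ converging to $\zeta$ inside some Stolz angle $\{z\in\mathbb{D}:|z-\zeta|\le A(1-|z|)\}$, $A>1$. *)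

theory Defs
  imports "HOL-Analysis.Analysis"
begin

abbreviation unit_disk :: "complex set" where
  "unit_disk \<equiv> ball 0 1"

abbreviation unit_circle :: "complex set" where
  "unit_circle \<equiv> sphere 0 1"

text \<open>Written as the logarithm of a maximum so that the value at \<open>0\<close> is \<open>0\<close>
  without appealing to the convention for \<open>ln 0\<close>.\<close>

definition log_plus :: "real \<Rightarrow> real" where
  "log_plus x = ln (max 1 x)"

text \<open>Harmonicity on an open set \<open>U\<close>: twice continuously (Frechet) differentiable with vanishing
  Laplacian. The functions \<open>hx\<close>, \<open>hy\<close>, \<open>hxx\<close>, ... are the partial derivatives in the
  coordinates \<open>z = x + \<i> y\<close>.\<close>

definition harmonic_on :: "(complex \<Rightarrow> real) \<Rightarrow> complex set \<Rightarrow> bool" where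
  "harmonic_on h U \<longleftrightarrow>
     (\<exists>hx hy hxx hxy hyx hyy :: complex \<Rightarrow> real.
        continuous_on U hxx \<and> continuous_on U hxy \<and>
        continuous_on U hyx \<and> continuous_on U hyy \<and>
        (\<forall>z\<in>U.
           (h has_derivative (\<lambda>w. hx z * Re w + hy z * Im w)) (at z) \<and>
           (hx has_derivative (\<lambda>w. hxx z * Re w + hxy z * Im w)) (at z) \<and>
           (hy has_derivative (\<lambda>w. hyx z * Re w + hyy z * Im w)) (at z) \<and>
           hxx z + hyy z = 0))"

definition Har_plus :: "(complex \<Rightarrow> real) set" where
  "Har_plus = {h. harmonic_on h unit_disk \<and> (\<forall>z\<in>unit_disk. 0 \<le> h z)}"

definition Stolz :: "real \<Rightarrow> complex \<Rightarrow> complex set" where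
  "Stolz A \<zeta> = {z \<in> unit_disk. cmod (z - \<zeta>) \<le> A * (1 - cmod z)}"

definition has_nontangential_limit :: "(complex \<Rightarrow> complex) \<Rightarrow> complex \<Rightarrow> complex \<Rightarrow> bool" where
  "has_nontangential_limit f \<zeta> l \<longleftrightarrow> (\<forall>A>1. (f \<longlongrightarrow> l) (at \<zeta> within Stolz A \<zeta>))"

text \<open>The boundary function \<open>f\<^sup>*\<close>. Its value is arbitrary where the non-tangential limit
  does not exist, which for \<open>f\<close> in the Nevanlinna class is a null set.\<close>

definition boundary_fun :: "(complex \<Rightarrow> complex) \<Rightarrow> complex \<Rightarrow> complex" where
  "boundary_fun f \<zeta> = (THE l. has_nontangential_limit f \<zeta> l)"

definition log_plus_mean :: "(complex \<Rightarrow> complex) \<Rightarrow> real \<Rightarrow> real" where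
  "log_plus_mean f r =
     1 / (2 * pi) * (LINT \<theta>:{0..2*pi}|lebesgue. log_plus (cmod (f (of_real r * cis \<theta>))))"

definition Nevanlinna :: "(complex \<Rightarrow> complex) set" where
  "Nevanlinna =
     {f. f holomorphic_on unit_disk \<and> (\<exists>L::real. (log_plus_mean f \<longlongrightarrow> L) (at_left 1))}"

text \<open>The Bochner integral of a non-integrable function is \<open>0\<close>, so finiteness of the boundary
  integral is stated as integrability.\<close>

definition Smirnov :: "(complex \<Rightarrow> complex) set" where
  "Smirnov =
     {f \<in> Nevanlinna.
        set_integrable lebesgue {0..2*pi} (\<lambda>\<theta>. log_plus (cmod (boundary_fun f (cis \<theta>)))) \<and>
        (log_plus_mean f \<longlongrightarrow>
           1 / (2 * pi) * (LINT \<theta>:{0..2*pi}|lebesgue. log_plus (cmod (boundary_fun f (cis \<theta>)))))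
          (at_left 1)}"

text \<open>\<open>Nev_size_on f \<Lambda>\<close> is \<open>N(f|\<Lambda>)\<close>. The infimum is over a set of non-negative reals,
  which is non-empty for \<open>f\<close> in the Nevanlinna class, so the real-valued \<open>Inf\<close> is harmless there.\<close>

definition Nev_size_on :: "(complex \<Rightarrow> complex) \<Rightarrow> complex set \<Rightarrow> real" where
  "Nev_size_on f \<Lambda> = Inf {h 0 | h. h \<in> Har_plus \<and> (\<forall>z\<in>\<Lambda>. ln (1 + cmod (f z)) \<le> h z)}"

definition Nev_size :: "(complex \<Rightarrow> complex) \<Rightarrow> real" where
  "Nev_size f = Nev_size_on f unit_disk"

definition sampling_Smirnov :: "complex set \<Rightarrow> bool" where
  "sampling_Smirnov \<Lambda> \<longleftrightarrow> (\<exists>C>0. \<forall>f\<in>Smirnov. Nev_size f \<le> Nev_size_on f \<Lambda> + C)"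

definition determination_Smirnov :: "complex set \<Rightarrow> bool" where
  "determination_Smirnov \<Lambda> \<longleftrightarrow>
     (\<forall>f\<in>Smirnov. bounded (f ` \<Lambda>) \<longrightarrow> bounded (f ` unit_disk))"

definition strongly_sampling_Smirnov :: "complex set \<Rightarrow> bool" where
  "strongly_sampling_Smirnov \<Lambda> \<longleftrightarrow>
     (\<forall>f\<in>Smirnov. \<forall>h\<in>Har_plus.
        (\<forall>z\<in>\<Lambda>. log_plus (cmod (f z)) \<le> h z) \<longrightarrow>
        (\<forall>z\<in>unit_disk. log_plus (cmod (f z)) \<le> h z))"

definition NT :: "complex set \<Rightarrow> complex set" where
  "NT \<Lambda> = {\<zeta> \<in> unit_circle.
     \<exists>A>1. \<exists>s :: nat \<Rightarrow> complex. (\<forall>n. s n \<in> \<Lambda> \<inter> Stolz A \<zeta>) \<and> s \<longlonglongrightarrow> \<zeta>}"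

definition arc_length :: "complex set \<Rightarrow> real" where
  "arc_length S = measure lebesgue {\<theta> \<in> {0..<2*pi}. cis \<theta> \<in> S}"

end

theory Submission
  imports Defs "HOL-Complex_Analysis.Complex_Analysis"
begin

text \<open>
The proof runs through (a), (b), (d), (c) and back to (a). Behind it are two facts on boundary
values. A function in the Nevanlinna class has nontangential limits almost everywhere
(\<open>Nevanlinna_majorant\<close>, \<open>majorant_nontangential_limits\<close>). In the Smirnov class the values of
\<open>log\<^sup>+ |f|\<close> on circles converge in \<open>L\<^sup>1\<close> to their boundary values (\<open>SmirnovD\<close>), so that no part of
the growth of \<open>f\<close> is hidden in a singular measure on the circle.

(d) implies (c). If \<open>log\<^sup>+ |f| \<le> h\<close> on \<open>\<Lambda>\<close> and \<open>h = Re H\<close>, then \<open>g = f exp (-H)\<close> is bounded by \<open>1\<close> on \<open>\<Lambda>\<close>.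
Almost every boundary point is approached nontangentially through \<open>\<Lambda>\<close>, so the boundary values of
\<open>g\<close> are bounded by \<open>1\<close> as well. Since \<open>|g| \<le> |f|\<close>, the circle means of \<open>log\<^sup>+ |g|\<close> tend to \<open>0\<close>, and
subharmonicity yields \<open>|g| \<le> 1\<close> (\<open>Smirnov_maximum_principle\<close>).

(c) implies (a) because \<open>log (1 + x)\<close> exceeds \<open>log\<^sup>+ x\<close> by at most \<open>log 2\<close>. For (a) implies (b), if
\<open>|f| \<le> M\<close> on \<open>\<Lambda>\<close> but \<open>|f w| > M\<close>, then for \<open>f\<^sub>n = (f / M)\<^sup>n\<close> the numbers \<open>N(f\<^sub>n | \<Lambda>)\<close> are at most \<open>log 2\<close>, whereas
\<open>N(f\<^sub>n)\<close> grows linearly in \<open>n\<close> by Harnack's inequality.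

(b) implies (d). If \<open>NT \<Lambda>\<close> misses a set of positive measure, then near the circle \<open>\<Lambda>\<close> avoids the Stolz
angles over some compact set \<open>K\<close> of positive measure. The harmonic measure of \<open>K\<close> is then bounded
away from \<open>1\<close> on \<open>\<Lambda>\<close>, although its supremum over the disc is \<open>1\<close>
(\<open>harmonic_measure_le_off_tents\<close>, \<open>harmonic_measure_gets_near_one\<close>). Exponentiating a holomorphic
function with this real part gives \<open>w\<close> with \<open>|w| < 1\<close>, with \<open>|w|\<close> bounded away from \<open>1\<close> on \<open>\<Lambda>\<close>, and with
a cluster value \<open>a\<close> of modulus \<open>1\<close>; the square root of \<open>1 / (1 - cnj a w)\<close> contradicts (b).

Fatou's theorem for bounded functions rests on a maximal inequality. The remainder of the Taylor
series is small in square mean, uniformly on all circles, and its nontangential maximal function is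
controlled by Hardy-Littlewood averages, which obey a weak-type bound by Vitali's covering lemma
(\<open>nontangential_weak_type\<close>, \<open>fatou_bounded\<close>). For \<open>f\<close> in the Nevanlinna class a normal family argument
produces a holomorphic \<open>H\<close> with \<open>log\<^sup>+ |f| \<le> Re H\<close>. Then \<open>f\<close> is the quotient of the bounded functions
\<open>f exp (-H)\<close> and \<open>exp (-H)\<close>, and the boundary values of the latter are almost nowhere \<open>0\<close>
(\<open>exp_neg_boundary_nonzero\<close>).
\<close>

section \<open>The Poisson kernel and the Herglotz transform\<close>

abbreviation circ :: "real measure" where
  "circ \<equiv> lebesgue_on {0..2*pi}"

definition poisson :: "complex \<Rightarrow> real \<Rightarrow> real" where
  "poisson z t = (1 - (cmod z)\<^sup>2) / (cmod (cis t - z))\<^sup>2"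

text \<open>The holomorphic function whose real part is the Poisson integral of \<open>v\<close>; its imaginary part
  vanishes at \<open>0\<close>.\<close>

definition herglotz :: "(real \<Rightarrow> real) \<Rightarrow> complex \<Rightarrow> complex" where
  "herglotz v z = 1 / (2*pi) * (LINT t|circ. (cis t + z) / (cis t - z) * of_real (v t))"

lemma cmod_radial_diff: "cmod (of_real r * cis s - cis s) = \<bar>r - 1\<bar>"
proof -
  have "of_real r * cis s - cis s = of_real (r - 1) * cis s" by (simp add: algebra_simps)
  then show ?thesis by (simp only: norm_mult norm_of_real norm_cis) simp
qed

lemma cmod_cis_diff: "cmod (cis x - cis y) = 2 * \<bar>sin ((x - y) / 2)\<bar>"
proof -
  have "cis x - cis y = cis y * (cis (x - y) - 1)" by (simp add: algebra_simps cis_mult)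
  then have "cmod (cis x - cis y) = cmod (exp (\<i> * complex_of_real (x - y)) - 1)"
    by (simp only: norm_mult norm_cis mult_1 cis_conv_exp[symmetric])
  also have "\<dots> = 2 * \<bar>sin ((x - y) / 2)\<bar>" by (rule dist_exp_i_1)
  finally show ?thesis .
qed

lemma chord_le: "cmod (cis x - cis y) \<le> \<bar>x - y\<bar>"
  using abs_sin_x_le_abs_x[of "(x - y)/2"] by (simp add: cmod_cis_diff)

lemma cis_diff_nonzero: "cmod z < 1 \<Longrightarrow> cis t - z \<noteq> 0"
  by auto

lemma cmod_cis_diff_ge: "1 - cmod z \<le> cmod (cis t - z)"
  by (metis norm_cis norm_triangle_ineq2)

lemma cmod_cis_diff_le: "cmod (cis t - z) \<le> 1 + cmod z"
  by (metis norm_cis norm_triangle_ineq4)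

lemma poisson_pos: "cmod z < 1 \<Longrightarrow> 0 < poisson z t"
  using cis_diff_nonzero[of z t] unfolding poisson_def
  by (intro divide_pos_pos) (auto simp: power_less_one_iff abs_square_less_1)

lemma poisson_nonneg: "cmod z < 1 \<Longrightarrow> 0 \<le> poisson z t"
  using poisson_pos[of z t] by simp

lemma one_minus_square: "1 - (x::real)\<^sup>2 = (1 - x) * (1 + x)"
  by (simp add: power2_eq_square algebra_simps)

lemma poisson_le:
  assumes "cmod z < 1" shows "poisson z t \<le> (1 + cmod z) / (1 - cmod z)"
proof -
  have "(1 - cmod z)\<^sup>2 \<le> (cmod (cis t - z))\<^sup>2"
    using assms cmod_cis_diff_ge[of z t] by (intro power_mono) auto
  then have "poisson z t \<le> ((1 - cmod z) * (1 + cmod z)) / (1 - cmod z)\<^sup>2"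
    unfolding poisson_def one_minus_square using assms cis_diff_nonzero[OF assms]
    by (intro divide_left_mono mult_pos_pos) auto
  also have "\<dots> = (1 + cmod z) / (1 - cmod z)"
    using assms by (simp add: power2_eq_square)
  finally show ?thesis .
qed

lemma poisson_ge:
  assumes "cmod z < 1" shows "(1 - cmod z) / (1 + cmod z) \<le> poisson z t"
proof -
  have "(cmod (cis t - z))\<^sup>2 \<le> (1 + cmod z)\<^sup>2"
    using assms cmod_cis_diff_le[of t z] by (intro power_mono) auto
  moreover have "0 < (cmod (cis t - z))\<^sup>2"
    using cis_diff_nonzero[OF assms] by simp
  ultimately have "((1 - cmod z) * (1 + cmod z)) / (1 + cmod z)\<^sup>2 \<le> poisson z t"
    unfolding poisson_def one_minus_square using assms
    by (intro divide_left_mono mult_pos_pos zero_less_power) (auto intro: add_pos_nonneg)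
  moreover have "((1 - cmod z) * (1 + cmod z)) / (1 + cmod z)\<^sup>2 = (1 - cmod z) / (1 + cmod z)"
    using assms by (simp add: power2_eq_square add_pos_nonneg)
  ultimately show ?thesis by simp
qed

lemma continuous_on_poisson_shift: "cmod z < 1 \<Longrightarrow> continuous_on S (\<lambda>t. poisson z (t + a))"
  unfolding poisson_def using cis_diff_nonzero[of z]
  by (intro continuous_intros) auto

lemma continuous_on_poisson: "cmod z < 1 \<Longrightarrow> continuous_on S (poisson z)"
  using continuous_on_poisson_shift[of z S 0] by simp

text \<open>The kernel depends only on \<open>|s - t|\<close>; this is what makes Poisson extension self-adjoint.\<close>

lemma poisson_symmetric: "poisson (of_real r * cis s) t = poisson (of_real r * cis t) s"
proof -
  have "(cmod (cis t - of_real r * cis s))\<^sup>2 = (cmod (cis s - of_real r * cis t))\<^sup>2"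
  proof -
    have *: "(cmod (cis a - of_real r * cis b))\<^sup>2 = 1 + r\<^sup>2 - 2 * r * (cos a * cos b + sin a * sin b)" for a b
    proof -
      have "(x - r * p)\<^sup>2 + (y - r * q)\<^sup>2 = (x\<^sup>2 + y\<^sup>2) + r\<^sup>2 * (p\<^sup>2 + q\<^sup>2) - 2 * r * (x * p + y * q)" for x y p q :: real
        by (simp add: power2_eq_square algebra_simps)
      from this[of "cos a" "cos b" "sin a" "sin b"] show ?thesis unfolding cmod_power2 by simp
    qed
    show ?thesis unfolding * by (simp add: mult.commute)
  qed
  then show ?thesis by (simp add: poisson_def norm_mult)
qed

text \<open>The Poisson kernel is an approximate identity: at a distance \<open>d\<close> from the radial projection of \<open>z\<close>
  it is at most a multiple of the distance from \<open>z\<close> to the circle.\<close>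

lemma poisson_le_away:
  assumes r: "0 \<le> r" "r < 1" and d: "d \<le> cmod (cis t - cis s)" "0 < d" "1 - r \<le> d / 2"
  shows "poisson (of_real r * cis s) t \<le> 8 * (1 - r) / d\<^sup>2"
proof -
  have "cmod (cis t - cis s) \<le> cmod (cis t - of_real r * cis s) + cmod (of_real r * cis s - cis s)"
    by (rule order_trans[OF _ norm_triangle_ineq]) simp
  moreover have "cmod (of_real r * cis s - cis s) = 1 - r" using r by (simp add: cmod_radial_diff)
  ultimately have "d / 2 \<le> cmod (cis t - of_real r * cis s)" using d by simp
  then have "(d/2)\<^sup>2 \<le> (cmod (cis t - of_real r * cis s))\<^sup>2" using d by (intro power_mono) auto
  moreover have "1 - r\<^sup>2 \<le> 2 * (1 - r)"
    unfolding one_minus_square using r mult_left_mono[of "1 + r" 2 "1 - r"] by simp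
  moreover have "0 \<le> 1 - r\<^sup>2" unfolding one_minus_square using r by simp
  ultimately have "poisson (of_real r * cis s) t \<le> (2 * (1 - r)) / (d/2)\<^sup>2"
    unfolding poisson_def using r d by (intro frac_le) (auto simp: norm_mult)
  then show ?thesis by (simp add: power_divide field_simps)
qed

lemma circ_continuous_measurable:
  fixes k :: "real \<Rightarrow> 'a::euclidean_space"
  shows "continuous_on {0..2*pi} k \<Longrightarrow> k \<in> borel_measurable circ"
  by (intro continuous_imp_measurable_on_sets_lebesgue) auto

lemma circ_continuous_integrable:
  fixes k :: "real \<Rightarrow> 'a::euclidean_space"
  shows "continuous_on {0..2*pi} k \<Longrightarrow> integrable circ k"
  by (rule continuous_imp_integrable_real)

lemma measure_circ: "measure circ (space circ) = 2*pi"
  by (simp add: measure_restrict_space)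

lemma finite_measure_circ: "finite_measure circ"
  by (intro finite_measure_lebesgue_on) auto

lemma circ_integral_const: "(LINT t|circ. (c::'a::{banach,second_countable_topology})) = (2*pi) *\<^sub>R c"
  using measure_circ by simp

lemma integrable_continuous_mult:
  fixes k v :: "real \<Rightarrow> 'a::{euclidean_space,real_normed_algebra}"
  assumes k: "continuous_on {0..2*pi} k" and v: "integrable circ v"
  shows "integrable circ (\<lambda>t. k t * v t)"
proof -
  have "compact (k ` {0..2*pi})" using k by (intro compact_continuous_image) auto
  then obtain B where B: "\<And>t. t \<in> {0..2*pi} \<Longrightarrow> norm (k t) \<le> B"
    using compact_imp_bounded bounded_iff by (metis imageI)
  have [measurable]: "k \<in> borel_measurable circ" "v \<in> borel_measurable circ"
    using circ_continuous_measurable[OF k] v by auto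
  show ?thesis
  proof (rule Bochner_Integration.integrable_bound)
    show "integrable circ (\<lambda>t. B * norm (v t))" using v by auto
    show "(\<lambda>t. k t * v t) \<in> borel_measurable circ" by measurable
    show "AE t in circ. norm (k t * v t) \<le> norm (B * norm (v t))"
    proof (rule AE_I2)
      fix t assume "t \<in> space circ"
      then have "norm (k t) \<le> B" using B by simp
      then show "norm (k t * v t) \<le> norm (B * norm (v t))"
        by (smt (verit) mult_right_mono norm_ge_zero norm_mult_ineq real_norm_def mult_nonneg_nonneg)
    qed
  qed
qed

lemma integrable_poisson:
  "cmod z < 1 \<Longrightarrow> integrable circ v \<Longrightarrow> integrable circ (\<lambda>t. poisson z t * v t)"
  by (rule integrable_continuous_mult[OF continuous_on_poisson])

text \<open>Cauchy's formula for \<open>u \<mapsto> F u (1 - |z|\<^sup>2) / (1 - cnj z u)\<close>: the extra factor is \<open>1\<close> at \<open>u = z\<close>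
  and turns the Cauchy kernel into the Poisson kernel on the circle.\<close>

lemma poisson_formula:
  fixes F :: "complex \<Rightarrow> complex"
  assumes "continuous_on (cball 0 1) F" "F holomorphic_on ball 0 1" "cmod z < 1"
  shows "F z = 1 / (2*pi) * (LINT t|circ. of_real (poisson z t) * F (cis t))"
proof -
  have nz: "1 - cnj z * u \<noteq> 0" if "cmod u \<le> 1" for u
  proof
    assume "1 - cnj z * u = 0"
    then have "cmod (cnj z * u) = 1" by simp
    moreover have "cmod (cnj z * u) \<le> cmod z * 1"
      using that unfolding norm_mult complex_mod_cnj by (intro mult_left_mono) auto
    ultimately show False using assms by simp
  qed
  define g where "g u = F u * (1 - (cmod z)\<^sup>2) / (1 - cnj z * u)" for u
  have c1: "continuous_on (cball 0 1) g" unfolding g_def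
    using assms nz by (intro continuous_intros) auto
  have h1: "g holomorphic_on ball 0 1" unfolding g_def
    using assms nz by (intro holomorphic_intros) (auto simp: less_imp_le)
  have "((\<lambda>u. g u / (u - z)) has_contour_integral (2 * of_real pi * \<i> * g z)) (circlepath 0 1)"
    by (rule Cauchy_integral_circlepath[OF c1 h1]) (use assms in auto)
  then have hi: "((\<lambda>t. g (cis t) / (cis t - z) * \<i> * cis t) has_integral 2 * of_real pi * \<i> * g z) {0..2*pi}"
    unfolding circlepath_def
    by (subst (asm) has_contour_integral_part_circlepath_iff) auto
  have gz: "g z = F z"
  proof -
    have "1 - cnj z * z \<noteq> 0" using nz assms by simp
    moreover have "of_real (1 - (cmod z)\<^sup>2) = 1 - cnj z * z"
      by (simp only: of_real_diff complex_norm_square of_real_1 mult.commute)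
    ultimately show ?thesis unfolding g_def by simp
  qed
  have eq: "g (cis t) / (cis t - z) * \<i> * cis t = \<i> * (of_real (poisson z t) * F (cis t))" for t
  proof -
    have n1: "1 - cnj z * cis t \<noteq> 0" using nz by simp
    have n2: "cis t - z \<noteq> 0" using cis_diff_nonzero assms by simp
    define c d where "c = cnj (cis t - z)" and "d = cis t - z"
    have "d \<noteq> 0" using n2 by (simp add: d_def)
    have e1: "(1 - cnj z * cis t) = cis t * c"
      unfolding c_def by (simp add: algebra_simps flip: cis_cnj) (simp add: cis_cnj cis_mult)
    have e2: "of_real ((cmod (cis t - z))\<^sup>2) = d * c"
      unfolding c_def d_def by (rule complex_norm_square)
    have "c \<noteq> 0" using n1 e1 by auto
    have "of_real (poisson z t) = of_real (1 - (cmod z)\<^sup>2) / (d * c)"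
      unfolding poisson_def of_real_divide e2 ..
    moreover have "g (cis t) = F (cis t) * of_real (1 - (cmod z)\<^sup>2) / (cis t * c)"
      unfolding g_def e1 by simp
    ultimately show ?thesis using \<open>d \<noteq> 0\<close> \<open>c \<noteq> 0\<close> unfolding d_def[symmetric] by (simp add: mult_ac)
  qed
  have c2: "continuous_on {0..2*pi} (\<lambda>t. of_real (poisson z t) * F (cis t))"
  proof -
    have "continuous_on {0..2*pi} (\<lambda>t. F (cis t))"
      by (rule continuous_on_compose2[OF assms(1)]) (auto intro!: continuous_intros)
    then show ?thesis using continuous_on_poisson[OF assms(3)] by (intro continuous_intros) auto
  qed
  have "((\<lambda>t. \<i> * (of_real (poisson z t) * F (cis t))) has_integral 2 * of_real pi * \<i> * F z) {0..2*pi}"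
    using hi unfolding eq gz .
  then have "((\<lambda>t. (-\<i>) * (\<i> * (of_real (poisson z t) * F (cis t)))) has_integral (-\<i>) * (2 * of_real pi * \<i> * F z)) {0..2*pi}"
    by (rule has_integral_mult_right)
  moreover have "(-\<i>) * (\<i> * x) = x" "(-\<i>) * (2 * of_real pi * \<i> * x) = 2 * of_real pi * x" for x
    by (simp_all add: complex_eq_iff)
  ultimately have "((\<lambda>t. of_real (poisson z t) * F (cis t)) has_integral 2 * of_real pi * F z) {0..2*pi}"
    by (simp only:)
  then have "integral {0..2*pi} (\<lambda>t. of_real (poisson z t) * F (cis t)) = 2 * of_real pi * F z"
    by (rule integral_unique)
  moreover have "integral {0..2*pi} (\<lambda>t. of_real (poisson z t) * F (cis t)) = (LINT t|circ. of_real (poisson z t) * F (cis t))"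
    by (rule lebesgue_integral_eq_integral[symmetric]) (use circ_continuous_integrable[OF c2] in auto)
  ultimately show ?thesis by simp
qed

lemma poisson_shift: "poisson (z * cis (-a)) t = poisson z (t + a)"
proof -
  have "cis t - z * cis (-a) = cis (-a) * (cis (t + a) - z)"
    by (simp add: algebra_simps cis_mult)
  then have "cmod (cis t - z * cis (-a)) = cmod (cis (t + a) - z)"
    by (metis norm_mult norm_cis mult_1)
  then show ?thesis by (simp add: poisson_def norm_mult)
qed

text \<open>Rotating \<open>F\<close> lets the parameter run over any interval of length \<open>2 pi\<close>, in particular over one
  centred at a given boundary point.\<close>

lemma poisson_formula_shift:
  fixes F :: "complex \<Rightarrow> complex"
  assumes "continuous_on (cball 0 1) F" "F holomorphic_on ball 0 1" "cmod z < 1"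
  shows "F z = 1 / (2*pi) * (LINT t|circ. of_real (poisson z (t + a)) * F (cis (t + a)))"
proof -
  let ?G = "\<lambda>u. F (u * cis a)"
  have 1: "continuous_on (cball 0 1) ?G"
    by (rule continuous_on_compose2[OF assms(1)]) (auto intro!: continuous_intros simp: norm_mult)
  have 2: "?G holomorphic_on ball 0 1"
    by (rule holomorphic_on_compose_gen[unfolded o_def, OF _ assms(2)])
      (auto intro!: holomorphic_intros simp: norm_mult)
  have 3: "cmod (z * cis (-a)) < 1" using assms by (simp add: norm_mult)
  show ?thesis using poisson_formula[OF 1 2 3]
    by (simp add: poisson_shift cis_mult mult.assoc)
qed

lemma poisson_mass:
  assumes "cmod z < 1" shows "(LINT t|circ. poisson z t) = 2*pi"
proof -
  have "1 = 1 / (2*pi) * (LINT t|circ. complex_of_real (poisson z t))"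
    using poisson_formula[of "\<lambda>_. 1" z] assms by simp
  then have "complex_of_real (2*pi) = of_real (LINT t|circ. poisson z t)"
    by (simp add: field_simps)
  then show ?thesis by (simp only: of_real_eq_iff)
qed

lemma poisson_formula_Re:
  fixes F :: "complex \<Rightarrow> complex"
  assumes "continuous_on (cball 0 1) F" "F holomorphic_on ball 0 1" "cmod z < 1"
  shows "Re (F z) = 1 / (2*pi) * (LINT t|circ. poisson z t * Re (F (cis t)))"
proof -
  have c2: "continuous_on {0..2*pi} (\<lambda>t. of_real (poisson z t) * F (cis t))"
  proof -
    have "continuous_on {0..2*pi} (\<lambda>t. F (cis t))"
      by (rule continuous_on_compose2[OF assms(1)]) (auto intro!: continuous_intros)
    then show ?thesis using continuous_on_poisson[OF assms(3)] by (intro continuous_intros) auto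
  qed
  have "Re (F z) = 1 / (2*pi) * Re (LINT t|circ. of_real (poisson z t) * F (cis t))"
    by (subst poisson_formula[OF assms]) simp
  also have "Re (LINT t|circ. of_real (poisson z t) * F (cis t)) = (LINT t|circ. Re (of_real (poisson z t) * F (cis t)))"
    by (rule integral_Re[symmetric, OF circ_continuous_integrable[OF c2]])
  finally show ?thesis by simp
qed

lemma herglotz_kernel_continuous:
  "cmod z < 1 \<Longrightarrow> continuous_on {0..2*pi} (\<lambda>t. (cis t + z) / (cis t - z))"
  using cis_diff_nonzero[of z] by (intro continuous_intros) auto

lemma herglotz_integrable:
  assumes "integrable circ v" "cmod z < 1"
  shows "integrable circ (\<lambda>t. (cis t + z) / (cis t - z) * complex_of_real (v t))"
  by (rule integrable_continuous_mult[OF herglotz_kernel_continuous[OF assms(2)]]) (use assms in auto)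

lemma Re_herglotz:
  assumes "integrable circ v" "cmod z < 1"
  shows "Re (herglotz v z) = 1 / (2*pi) * (LINT t|circ. poisson z t * v t)"
proof -
  have "Re ((cis t + z) / (cis t - z) * complex_of_real (v t)) = poisson z t * v t" for t
  proof -
    have "Re ((cis t + z) / (cis t - z)) = Re ((cis t + z) * cnj (cis t - z)) / (cmod (cis t - z))\<^sup>2"
      by (metis complex_div_cnj Re_divide_of_real)
    also have "Re ((cis t + z) * cnj (cis t - z)) = 1 - (cmod z)\<^sup>2"
      unfolding cmod_power2 using sin_cos_squared_add3[of t]
      by (simp add: power2_eq_square algebra_simps)
    finally have "Re ((cis t + z) / (cis t - z)) = poisson z t" by (simp only: poisson_def)
    moreover have "Re (w * complex_of_real (v t)) = Re w * v t" for w by simp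
    ultimately show ?thesis by metis
  qed
  then have "(LINT t|circ. Re ((cis t + z) / (cis t - z) * complex_of_real (v t))) = (LINT t|circ. poisson z t * v t)"
    by presburger
  then show ?thesis
    unfolding herglotz_def using integral_Re[OF herglotz_integrable[OF assms]] by simp
qed

lemma herglotz_0:
  assumes "integrable circ v"
  shows "herglotz v 0 = of_real (1 / (2*pi) * (LINT t|circ. v t))"
  unfolding herglotz_def by simp

lemma herglotz_holomorphic:
  assumes v: "integrable circ v"
  shows "herglotz v holomorphic_on ball 0 1"
proof -
  \<comment> \<open>\<open>(\<zeta> + z) / (\<zeta> - z) = 2 / (1 - z / \<zeta>) - 1\<close> on the circle; the first term is expanded geometrically.\<close>
  define a where "a n = (LINT t|circ. cis (- (real n * t)) * complex_of_real (v t))" for n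
  define s where "s z = (LINT t|circ. 1 / (1 - z * cis (-t)) * complex_of_real (v t))" for z
  have v': "integrable circ (\<lambda>t. complex_of_real (v t))" using v by simp
  have nz: "1 - z * cis (-t) \<noteq> 0" if "cmod z < 1" for z t
  proof
    assume "1 - z * cis (-t) = 0"
    then have "cmod (z * cis (-t)) = 1" by simp
    then show False using that by (simp add: norm_mult)
  qed
  have sums: "(\<lambda>n. a n * (z - 0)^n) sums s z" if "z \<in> ball 0 1" for z
  proof -
    have z: "cmod z < 1" using that by simp
    let ?f = "\<lambda>n t. (z * cis (-t))^n * complex_of_real (v t)"
    have int: "integrable circ (?f n)" for n
      by (rule integrable_continuous_mult[OF _ v']) (intro continuous_intros)
    have nrm: "norm (?f n t) = cmod z ^ n * \<bar>v t\<bar>" for n t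
      by (simp add: norm_mult norm_power)
    have "(\<lambda>n. LINT t|circ. ?f n t) sums (LINT t|circ. (\<Sum>n. ?f n t))"
    proof (rule sums_integral)
      show "AE t in circ. summable (\<lambda>n. norm (?f n t))"
        using z by (intro AE_I2) (simp add: nrm summable_mult2 summable_geometric)
      show "summable (\<lambda>n. LINT t|circ. norm (?f n t))"
        using z by (simp add: nrm summable_mult2 summable_geometric)
    qed (rule int)
    moreover have "(LINT t|circ. ?f n t) = a n * (z - 0)^n" for n
    proof -
      have "?f n = (\<lambda>t. z^n * (cis (- (real n * t)) * complex_of_real (v t)))"
        by (simp add: power_mult_distrib mult.assoc Complex.DeMoivre)
      then show ?thesis by (simp add: a_def)
    qed
    moreover have "(\<Sum>n. ?f n t) = 1 / (1 - z * cis (-t)) * complex_of_real (v t)" for t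
    proof -
      have "(\<lambda>n. (z * cis (-t))^n) sums (1 / (1 - z * cis (-t)))"
        by (rule geometric_sums) (use z in \<open>simp add: norm_mult\<close>)
      then show ?thesis by (intro sums_unique[symmetric] sums_mult2)
    qed
    ultimately show ?thesis by (simp add: s_def)
  qed
  have "s holomorphic_on ball 0 1"
    by (rule power_series_holomorphic[OF sums])
  then have "(\<lambda>z. 1 / (2*pi) * (2 * s z - of_real (LINT t|circ. v t))) holomorphic_on ball 0 1"
    by (intro holomorphic_intros)
  moreover have "herglotz v z = 1 / (2*pi) * (2 * s z - of_real (LINT t|circ. v t))" if "z \<in> ball 0 1" for z
  proof -
    have z: "cmod z < 1" using that by simp
    have i1: "integrable circ (\<lambda>t. 1 / (1 - z * cis (-t)) * complex_of_real (v t))"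
      by (rule integrable_continuous_mult[OF _ v']) (use nz[OF z] in \<open>auto intro!: continuous_intros\<close>)
    have "(cis t + z) / (cis t - z) * complex_of_real (v t) = 2 * (1 / (1 - z * cis (-t)) * complex_of_real (v t)) - complex_of_real (v t)" for t
    proof -
      have "(cis t - z) = cis t * (1 - z * cis (-t))"
        by (simp add: algebra_simps cis_mult)
      moreover have "(cis t + z) = cis t * (1 + z * cis (-t))"
        by (simp add: algebra_simps cis_mult)
      ultimately have "(cis t + z) / (cis t - z) = (1 + z * cis (-t)) / (1 - z * cis (-t))" by simp
      also have "\<dots> = 2 * (1 / (1 - z * cis (-t))) - 1"
        using nz[OF z, of t] by (simp add: field_simps)
      finally show ?thesis by (simp only: left_diff_distrib mult.assoc mult_1)
    qed
    then have "(LINT t|circ. (cis t + z) / (cis t - z) * complex_of_real (v t)) =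
      (LINT t|circ. 2 * (1 / (1 - z * cis (-t)) * complex_of_real (v t)) - complex_of_real (v t))" by simp
    also have "\<dots> = 2 * s z - (LINT t|circ. complex_of_real (v t))"
      unfolding s_def by (simp only: Bochner_Integration.integral_diff[OF integrable_mult_right[OF i1] v'] integral_mult_right_zero)
    finally show ?thesis by (simp add: herglotz_def)
  qed
  ultimately show ?thesis by (metis (no_types, lifting) holomorphic_cong)
qed

section \<open>Positive harmonic functions as real parts\<close>

lemma dilation_holomorphic:
  assumes "F holomorphic_on unit_disk" "0 < r" "r < 1"
  shows "(\<lambda>z. F (of_real r * z)) holomorphic_on ball 0 (1/r)"
    and "continuous_on (cball 0 1) (\<lambda>z. F (of_real r * z))"
    and "(\<lambda>z. F (of_real r * z)) holomorphic_on unit_disk"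
proof -
  show 1: "(\<lambda>z. F (of_real r * z)) holomorphic_on ball 0 (1/r)"
    by (rule holomorphic_on_compose_gen[unfolded o_def, OF _ assms(1)])
      (use assms in \<open>auto intro!: holomorphic_intros simp: norm_mult field_simps\<close>)
  have "1 < 1 / r" using assms by simp
  then have "cball 0 1 \<subseteq> ball (0::complex) (1/r)" by (intro cball_subset_ball_iff[THEN iffD2]) simp
  then show 2: "continuous_on (cball 0 1) (\<lambda>z. F (of_real r * z))" "(\<lambda>z. F (of_real r * z)) holomorphic_on unit_disk"
    using 1 holomorphic_on_imp_continuous_on holomorphic_on_subset ball_subset_cball by blast+
qed

lemma dilated_circle_continuous:
  fixes F :: "complex \<Rightarrow> complex"
  assumes "F holomorphic_on unit_disk" "0 < r" "r < 1"
  shows "continuous_on S (\<lambda>t. F (of_real r * cis t))"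
  by (rule continuous_on_compose2[OF dilation_holomorphic(2)[OF assms]]) (auto intro!: continuous_intros)

lemma dilation_tendsto:
  assumes F: "F holomorphic_on unit_disk" and z: "z \<in> unit_disk" and \<rho>: "\<rho> \<longlonglongrightarrow> (1::real)"
  shows "(\<lambda>n. F (of_real (\<rho> n) * z)) \<longlonglongrightarrow> F z"
proof -
  have "isCont F z"
    using F z by (metis holomorphic_on_imp_continuous_on continuous_on_eq_continuous_at open_ball)
  moreover have "(\<lambda>n. of_real (\<rho> n) * z) \<longlonglongrightarrow> of_real 1 * z" by (intro tendsto_intros \<rho>)
  ultimately show ?thesis by (intro isCont_tendsto_compose[of z F]) auto
qed

definition radius :: "nat \<Rightarrow> real" where "radius n = 1 - 1 / (real n + 2)"

lemma radius_pos: "0 < radius n" and radius_less: "radius n < 1"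
  by (auto simp: radius_def field_simps)

lemma radius_tendsto: "radius \<longlonglongrightarrow> 1"
proof -
  have "(\<lambda>n. 1 / real n) \<longlonglongrightarrow> 0" by (rule lim_1_over_n)
  then have "(\<lambda>n. 1 / real (n + 2)) \<longlonglongrightarrow> 0" by (rule LIMSEQ_ignore_initial_segment)
  then have "(\<lambda>n. 1 - 1 / real (n + 2)) \<longlonglongrightarrow> 1 - 0" by (intro tendsto_intros)
  then show ?thesis by (simp add: radius_def[abs_def] add.commute)
qed

lemma radius_at_left: "filterlim radius (at_left 1) sequentially"
  by (rule filterlim_at_withinI[unfolded at_within_def, folded at_within_def])
    (use radius_tendsto radius_less in \<open>auto simp: less_le\<close>)

lemma has_derivative_horizontal:
  assumes "(h has_derivative (\<lambda>w. a * Re w + b * Im w)) (at (z + of_real x + \<i> * of_real y))"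
  shows "((\<lambda>x. h (z + of_real x + \<i> * of_real y)) has_real_derivative a) (at x)"
proof -
  have "((\<lambda>x. z + of_real x + \<i> * of_real y) has_derivative of_real) (at x)"
    by (auto intro!: derivative_eq_intros)
  from has_derivative_compose[OF this assms] show ?thesis
    by (simp add: has_field_derivative_def mult_commute_abs)
qed

lemma has_derivative_vertical:
  assumes "(h has_derivative (\<lambda>w. a * Re w + b * Im w)) (at (z + of_real x + \<i> * of_real y))"
  shows "((\<lambda>y. h (z + of_real x + \<i> * of_real y)) has_real_derivative b) (at y)"
proof -
  have "((\<lambda>y. z + of_real x + \<i> * of_real y) has_derivative (\<lambda>y. \<i> * of_real y)) (at y)"
    by (auto intro!: derivative_eq_intros)
  from has_derivative_compose[OF this assms] show ?thesis
    by (simp add: has_field_derivative_def mult_commute_abs)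
qed

text \<open>The second difference over a small square is evaluated by the mean value theorem in both orders.
  This supplies the Cauchy-Riemann equation that the definition of harmonicity does not contain
  explicitly.\<close>

lemma mixed_partials_eq:
  assumes U: "open U" "z \<in> U"
    and cxy: "continuous_on U hxy" and cyx: "continuous_on U hyx"
    and dh: "\<And>z. z \<in> U \<Longrightarrow> (h has_derivative (\<lambda>w. hx z * Re w + hy z * Im w)) (at z)"
    and dhx: "\<And>z. z \<in> U \<Longrightarrow> (hx has_derivative (\<lambda>w. hxx z * Re w + hxy z * Im w)) (at z)"
    and dhy: "\<And>z. z \<in> U \<Longrightarrow> (hy has_derivative (\<lambda>w. hyx z * Re w + hyy z * Im w)) (at z)"
  shows "hxy z = hyx z"
proof (rule ccontr)
  assume ne: "hxy z \<noteq> hyx z"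
  define e where "e = \<bar>hxy z - hyx z\<bar> / 2"
  have e: "e > 0" using ne by (simp add: e_def)
  obtain r where r: "r > 0" "ball z r \<subseteq> U" using U openE by blast
  have "isCont hxy z" "isCont hyx z" using U cxy cyx by (auto simp: continuous_on_eq_continuous_at)
  then have "\<exists>d>0. \<forall>w. dist w z < d \<longrightarrow> dist (hxy w) (hxy z) < e"
       "\<exists>d>0. \<forall>w. dist w z < d \<longrightarrow> dist (hyx w) (hyx z) < e"
    using e unfolding continuous_at_eps_delta by simp_all
  then obtain d1 d2 where d: "d1 > 0" "d2 > 0"
      "\<And>w. dist w z < d1 \<Longrightarrow> dist (hxy w) (hxy z) < e"
      "\<And>w. dist w z < d2 \<Longrightarrow> dist (hyx w) (hyx z) < e"
    by blast
  define s where "s = min r (min d1 d2) / 3"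
  have s: "s > 0" "2 * s < r" "2 * s < d1" "2 * s < d2" using r d by (auto simp: s_def min_def)
  have near: "dist (z + of_real x + \<i> * of_real y) z \<le> 2 * s" if "0 \<le> x" "x \<le> s" "0 \<le> y" "y \<le> s" for x y
  proof -
    have "dist (z + of_real x + \<i> * of_real y) z = cmod (of_real x + \<i> * of_real y)"
      by (simp add: dist_norm)
    also have "\<dots> \<le> cmod (of_real x) + cmod (\<i> * of_real y)" by (rule norm_triangle_ineq)
    also have "\<dots> \<le> 2 * s" using that by (simp add: norm_mult)
    finally show ?thesis .
  qed
  have inU: "z + of_real x + \<i> * of_real y \<in> U" if "0 \<le> x" "x \<le> s" "0 \<le> y" "y \<le> s" for x y
    using near[OF that] s r by (auto simp: subset_eq dist_commute)
  let ?p = "\<lambda>x y. z + of_real x + \<i> * of_real y"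
  \<comment> \<open>The second difference of \<open>h\<close> over a small square, taken first horizontally, then vertically.\<close>
  have "\<exists>\<xi>>0. \<xi> < s \<and> (h (?p s s) - h (?p s 0)) - (h (?p 0 s) - h (?p 0 0)) = (s - 0) * (hx (?p \<xi> s) - hx (?p \<xi> 0))"
    by (rule MVT2[where f = "\<lambda>x. h (?p x s) - h (?p x 0)"])
      (use s in \<open>auto intro!: DERIV_diff has_derivative_horizontal dh inU simp del: of_real_0\<close>)
  then obtain \<xi> where \<xi>: "0 < \<xi>" "\<xi> < s"
    "(h (?p s s) - h (?p s 0)) - (h (?p 0 s) - h (?p 0 0)) = s * (hx (?p \<xi> s) - hx (?p \<xi> 0))" by auto
  have "\<exists>\<eta>>0. \<eta> < s \<and> hx (?p \<xi> s) - hx (?p \<xi> 0) = (s - 0) * hxy (?p \<xi> \<eta>)"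
    by (rule MVT2[where f = "\<lambda>y. hx (?p \<xi> y)"])
      (use s \<xi> in \<open>auto intro!: has_derivative_vertical dhx inU simp del: of_real_0\<close>)
  then obtain \<eta> where \<eta>: "0 < \<eta>" "\<eta> < s" "hx (?p \<xi> s) - hx (?p \<xi> 0) = s * hxy (?p \<xi> \<eta>)" by auto
  have "\<exists>\<xi>>0. \<xi> < s \<and> (h (?p s s) - h (?p 0 s)) - (h (?p s 0) - h (?p 0 0)) = (s - 0) * (hy (?p s \<xi>) - hy (?p 0 \<xi>))"
    by (rule MVT2[where f = "\<lambda>y. h (?p s y) - h (?p 0 y)"])
      (use s in \<open>auto intro!: DERIV_diff has_derivative_vertical dh inU simp del: of_real_0\<close>)
  then obtain \<xi>' where \<xi>': "0 < \<xi>'" "\<xi>' < s"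
    "(h (?p s s) - h (?p 0 s)) - (h (?p s 0) - h (?p 0 0)) = s * (hy (?p s \<xi>') - hy (?p 0 \<xi>'))" by auto
  have "\<exists>\<eta>>0. \<eta> < s \<and> hy (?p s \<xi>') - hy (?p 0 \<xi>') = (s - 0) * hyx (?p \<eta> \<xi>')"
    by (rule MVT2[where f = "\<lambda>x. hy (?p x \<xi>')"])
      (use s \<xi>' in \<open>auto intro!: has_derivative_horizontal dhy inU simp del: of_real_0\<close>)
  then obtain \<eta>' where \<eta>': "0 < \<eta>'" "\<eta>' < s" "hy (?p s \<xi>') - hy (?p 0 \<xi>') = s * hyx (?p \<eta>' \<xi>')" by auto
  have "s * (s * hxy (?p \<xi> \<eta>)) = s * (s * hyx (?p \<eta>' \<xi>'))"
    using \<xi>(3) \<xi>'(3) unfolding \<eta>(3) \<eta>'(3) by argo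
  then have eq: "hxy (?p \<xi> \<eta>) = hyx (?p \<eta>' \<xi>')" using s by simp
  have "dist (hxy (?p \<xi> \<eta>)) (hxy z) < e"
    by (rule d(3)) (use near[of \<xi> \<eta>] \<xi> \<eta> s in auto)
  moreover have "dist (hyx (?p \<eta>' \<xi>')) (hyx z) < e"
    by (rule d(4)) (use near[of \<eta>' \<xi>'] \<xi>' \<eta>' s in auto)
  ultimately have "\<bar>hxy z - hyx z\<bar> < 2 * e" unfolding eq dist_real_def by argo
  then show False by (simp add: e_def)
qed

lemma Re_holomorphic_has_derivative:
  assumes "(H has_field_derivative D) (at z)"
  shows "((\<lambda>z. Re (H z)) has_derivative (\<lambda>w. Re D * Re w + (- Im D) * Im w)) (at z)"
  using bounded_linear.has_derivative[OF bounded_linear_Re assms[unfolded has_field_derivative_def]]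
  by simp

lemma Im_holomorphic_has_derivative:
  assumes "(H has_field_derivative D) (at z)"
  shows "((\<lambda>z. - Im (H z)) has_derivative (\<lambda>w. (- Im D) * Re w + (- Re D) * Im w)) (at z)"
  using has_derivative_minus[OF bounded_linear.has_derivative[OF bounded_linear_Im assms[unfolded has_field_derivative_def]]]
  by (simp add: algebra_simps)

lemma Re_holomorphic_Har_plus:
  assumes H: "H holomorphic_on unit_disk" and pos: "\<And>z. z \<in> unit_disk \<Longrightarrow> 0 \<le> Re (H z)"
  shows "(\<lambda>z. Re (H z)) \<in> Har_plus"
proof -
  have H1: "deriv H holomorphic_on unit_disk" by (rule holomorphic_deriv[OF H open_ball])
  have H2: "deriv (deriv H) holomorphic_on unit_disk" by (rule holomorphic_deriv[OF H1 open_ball])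
  have D1: "(H has_field_derivative deriv H z) (at z)" if "z \<in> unit_disk" for z
    using holomorphic_derivI[OF H _ that] by simp
  have D2: "(deriv H has_field_derivative deriv (deriv H) z) (at z)" if "z \<in> unit_disk" for z
    using holomorphic_derivI[OF H1 _ that] by simp
  have c: "continuous_on unit_disk (deriv (deriv H))" using H2 holomorphic_on_imp_continuous_on by blast
  let ?p = "\<lambda>z. Re (deriv (deriv H) z)" and ?q = "\<lambda>z. - Im (deriv (deriv H) z)"
  have "harmonic_on (\<lambda>z. Re (H z)) unit_disk"
    unfolding harmonic_on_def
  proof (intro exI conjI ballI)
    show "continuous_on unit_disk ?p" "continuous_on unit_disk ?q" "continuous_on unit_disk ?q"
       "continuous_on unit_disk (\<lambda>z. - Re (deriv (deriv H) z))"
      using c by (auto intro!: continuous_intros)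
    fix z :: complex assume z: "z \<in> unit_disk"
    show "((\<lambda>z. Re (H z)) has_derivative (\<lambda>w. Re (deriv H z) * Re w + (- Im (deriv H z)) * Im w)) (at z)"
      by (rule Re_holomorphic_has_derivative[OF D1[OF z]])
    show "((\<lambda>z. Re (deriv H z)) has_derivative (\<lambda>w. ?p z * Re w + ?q z * Im w)) (at z)"
      by (rule Re_holomorphic_has_derivative[OF D2[OF z]])
    show "((\<lambda>z. - Im (deriv H z)) has_derivative (\<lambda>w. ?q z * Re w + (- Re (deriv (deriv H) z)) * Im w)) (at z)"
      by (rule Im_holomorphic_has_derivative[OF D2[OF z]])
  qed simp
  then show ?thesis using pos by (simp add: Har_plus_def)
qed

text \<open>The disc is convex, so the gradient field \<open>hx - \<i> hy\<close> has a holomorphic primitive; its real part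
  has the same derivative as \<open>h\<close>.\<close>

lemma Har_plus_Re_holomorphic:
  assumes "h \<in> Har_plus"
  obtains H where "H holomorphic_on unit_disk" "\<And>z. z \<in> unit_disk \<Longrightarrow> Re (H z) = h z"
proof -
  obtain hx hy hxx hxy hyx hyy where
    c: "continuous_on unit_disk hxy" "continuous_on unit_disk hyx" and
    dh: "\<And>z. z \<in> unit_disk \<Longrightarrow> (h has_derivative (\<lambda>w. hx z * Re w + hy z * Im w)) (at z)" and
    dhx: "\<And>z. z \<in> unit_disk \<Longrightarrow> (hx has_derivative (\<lambda>w. hxx z * Re w + hxy z * Im w)) (at z)" and
    dhy: "\<And>z. z \<in> unit_disk \<Longrightarrow> (hy has_derivative (\<lambda>w. hyx z * Re w + hyy z * Im w)) (at z)" and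
    lap: "\<And>z. z \<in> unit_disk \<Longrightarrow> hxx z + hyy z = 0"
    using assms unfolding Har_plus_def harmonic_on_def by blast
  have sym: "hxy z = hyx z" if "z \<in> unit_disk" for z
    by (rule mixed_partials_eq[OF _ that c dh dhx dhy]) auto
  \<comment> \<open>The Cauchy-Riemann equations for \<open>hx - \<i> hy\<close> are the Laplace equation and the symmetry of the mixed partials.\<close>
  define g where "g z = complex_of_real (hx z) - \<i> * complex_of_real (hy z)" for z
  have g': "(g has_field_derivative (of_real (hxx z) - \<i> * of_real (hyx z))) (at z)" if z: "z \<in> unit_disk" for z
  proof -
    have "(g has_derivative (\<lambda>w. of_real (hxx z * Re w + hxy z * Im w) - \<i> * of_real (hyx z * Re w + hyy z * Im w))) (at z)"
      unfolding g_def using dhx[OF z] dhy[OF z] by (intro derivative_intros)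
    moreover have "(\<lambda>w. of_real (hxx z * Re w + hxy z * Im w) - \<i> * of_real (hyx z * Re w + hyy z * Im w))
       = (*) (of_real (hxx z) - \<i> * of_real (hyx z))"
      using lap[OF z] sym[OF z] by (intro ext) (auto simp: complex_eq_iff algebra_simps eq_neg_iff_add_eq_0[symmetric])
    ultimately show ?thesis by (simp add: has_field_derivative_def)
  qed
  then have "g holomorphic_on unit_disk"
    unfolding holomorphic_on_def field_differentiable_def by (metis has_field_derivative_at_within)
  then obtain H where H: "\<And>z. z \<in> unit_disk \<Longrightarrow> (H has_field_derivative g z) (at z within unit_disk)"
    using holomorphic_convex_primitive'[of unit_disk g] by auto
  have H': "(H has_field_derivative g z) (at z)" if "z \<in> unit_disk" for z
    using H[OF that] unfolding at_within_open[OF that open_ball] .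
  have "((\<lambda>z. Re (H z) - h z) has_derivative (\<lambda>w. 0)) (at z within unit_disk)" if z: "z \<in> unit_disk" for z
  proof -
    have "((\<lambda>z. Re (H z)) has_derivative (\<lambda>w. Re (g z) * Re w + (- Im (g z)) * Im w)) (at z)"
      by (rule Re_holomorphic_has_derivative[OF H'[OF z]])
    from has_derivative_diff[OF this dh[OF z]]
    have "((\<lambda>z. Re (H z) - h z) has_derivative (\<lambda>w. 0)) (at z)" by (simp add: g_def)
    then show ?thesis by (rule has_derivative_at_withinI)
  qed
  then obtain k where k: "\<And>z. z \<in> unit_disk \<Longrightarrow> Re (H z) - h z = k"
    using has_derivative_zero_constant[of unit_disk "\<lambda>z. Re (H z) - h z"] by auto
  show ?thesis
  proof (rule that[of "\<lambda>z. H z - of_real k"])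
    show "(\<lambda>z. H z - of_real k) holomorphic_on unit_disk"
    proof (intro holomorphic_intros)
      show "H holomorphic_on unit_disk"
        unfolding holomorphic_on_def field_differentiable_def using H by blast
    qed
  qed (use k in force)
qed

lemma Re_mean_value:
  assumes H: "H holomorphic_on unit_disk" and r: "0 < r" "r < 1"
  shows "Re (H 0) = 1 / (2*pi) * (LINT t|circ. Re (H (of_real r * cis t)))"
  using poisson_formula_Re[OF dilation_holomorphic(2,3)[OF assms], of 0]
  by (simp add: poisson_def)

text \<open>Harnack's inequality: in the Poisson formula on a slightly smaller circle the kernel at \<open>z\<close> is at
  most \<open>(1 + |z|) / (1 - |z|)\<close> times the kernel at \<open>0\<close>.\<close>

lemma harnack_Re:
  assumes H: "H holomorphic_on unit_disk" and pos: "\<And>z. z \<in> unit_disk \<Longrightarrow> 0 \<le> Re (H z)"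
    and z: "z \<in> unit_disk"
  shows "Re (H z) \<le> (1 + cmod z) / (1 - cmod z) * Re (H 0)"
proof -
  have z1: "cmod z < 1" using z by simp
  have *: "Re (H (of_real r * z)) \<le> (1 + cmod z) / (1 - cmod z) * Re (H 0)" if r: "0 < r" "r < 1" for r
  proof -
    have c: "continuous_on {0..2*pi} (\<lambda>t. Re (H (of_real r * cis t)))"
      by (intro continuous_on_Re continuous_on_compose2[OF dilation_holomorphic(2)[OF H r]])
        (auto intro!: continuous_intros)
    have "Re (H (of_real r * z)) = 1 / (2*pi) * (LINT t|circ. poisson z t * Re (H (of_real r * cis t)))"
      using poisson_formula_Re[OF dilation_holomorphic(2,3)[OF H r] z1] .
    also have "\<dots> \<le> 1 / (2*pi) * (LINT t|circ. (1 + cmod z) / (1 - cmod z) * Re (H (of_real r * cis t)))"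
    proof (intro mult_left_mono integral_mono)
      show "integrable circ (\<lambda>t. poisson z t * Re (H (complex_of_real r * cis t)))"
        by (intro integrable_poisson z1 circ_continuous_integrable c)
      show "integrable circ (\<lambda>t. (1 + cmod z) / (1 - cmod z) * Re (H (complex_of_real r * cis t)))"
        by (intro integrable_mult_right circ_continuous_integrable c)
      fix t show "poisson z t * Re (H (of_real r * cis t)) \<le> (1 + cmod z) / (1 - cmod z) * Re (H (of_real r * cis t))"
        using poisson_le[OF z1] pos r by (intro mult_right_mono) (auto simp: norm_mult)
    qed auto
    also have "\<dots> = (1 + cmod z) / (1 - cmod z) * Re (H 0)"
      using Re_mean_value[OF H r] by simp
    finally show ?thesis .
  qed
  show ?thesis
    by (rule LIMSEQ_le_const2[OF tendsto_Re[OF dilation_tendsto[OF H z radius_tendsto]]])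
      (use *[OF radius_pos radius_less] in blast)
qed

lemma Har_plus_harnack:
  assumes "h \<in> Har_plus" "z \<in> unit_disk"
  shows "h z \<le> (1 + cmod z) / (1 - cmod z) * h 0"
proof -
  obtain H where "H holomorphic_on unit_disk" "\<And>z. z \<in> unit_disk \<Longrightarrow> Re (H z) = h z"
    using Har_plus_Re_holomorphic[OF assms(1)] by metis
  then show ?thesis using harnack_Re[of H z] assms by (auto simp: Har_plus_def)
qed

lemma Har_plus_add_const:
  assumes "h \<in> Har_plus" "0 \<le> c" shows "(\<lambda>z. h z + c) \<in> Har_plus"
proof -
  obtain hx hy hxx hxy hyx hyy where
    c: "continuous_on unit_disk hxx" "continuous_on unit_disk hxy" "continuous_on unit_disk hyx" "continuous_on unit_disk hyy" and
    d: "\<forall>z\<in>unit_disk. (h has_derivative (\<lambda>w. hx z * Re w + hy z * Im w)) (at z) \<and>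
           (hx has_derivative (\<lambda>w. hxx z * Re w + hxy z * Im w)) (at z) \<and>
           (hy has_derivative (\<lambda>w. hyx z * Re w + hyy z * Im w)) (at z) \<and> hxx z + hyy z = 0"
    using assms unfolding Har_plus_def harmonic_on_def by blast
  have "harmonic_on (\<lambda>z. h z + c) unit_disk"
    unfolding harmonic_on_def
    by (rule exI[of _ hx], rule exI[of _ hy], rule exI[of _ hxx], rule exI[of _ hxy], rule exI[of _ hyx], rule exI[of _ hyy])
      (use c d has_derivative_add_const in blast)
  then show ?thesis using assms by (simp add: Har_plus_def)
qed

lemma Har_plus_const: "0 \<le> c \<Longrightarrow> (\<lambda>z. c) \<in> Har_plus"
  using Re_holomorphic_Har_plus[of "\<lambda>_. of_real c"] by simp

section \<open>Subharmonicity of the positive logarithm\<close>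

lemma log_plus_nonneg: "0 \<le> log_plus x"
  by (simp add: log_plus_def)

lemma log_plus_le_iff: "0 \<le> c \<Longrightarrow> log_plus x \<le> c \<longleftrightarrow> x \<le> exp c"
proof -
  assume "0 \<le> c"
  have "log_plus x \<le> c \<longleftrightarrow> max 1 x \<le> exp c"
    unfolding log_plus_def by (metis exp_le_cancel_iff exp_ln less_max_iff_disj zero_less_one)
  then show ?thesis using \<open>0 \<le> c\<close> by simp
qed

lemma log_plus_mono: "x \<le> y \<Longrightarrow> log_plus x \<le> log_plus y"
  by (simp add: log_plus_def)

lemma le_exp_log_plus: "x \<le> exp (log_plus x)"
  using log_plus_le_iff[OF log_plus_nonneg, of x x] by simp

lemma isCont_log_plus: "isCont log_plus x"
  unfolding log_plus_def by (intro continuous_intros) auto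

lemma continuous_on_log_plus [continuous_intros]:
  "continuous_on S f \<Longrightarrow> continuous_on S (\<lambda>x. log_plus (f x))"
  unfolding log_plus_def by (intro continuous_intros) auto

lemma tendsto_log_plus: "(f \<longlongrightarrow> l) F \<Longrightarrow> ((\<lambda>x. log_plus (f x)) \<longlongrightarrow> log_plus l) F"
  by (rule isCont_tendsto_compose[OF isCont_log_plus])

lemma log_plus_le_self: "0 \<le> x \<Longrightarrow> log_plus x \<le> x"
  unfolding log_plus_def by (cases "x \<le> 1") (auto simp: max_def intro: ln_bound)

lemma log_plus_power: "0 \<le> x \<Longrightarrow> log_plus (x ^ n) = real n * log_plus x"
proof -
  assume x: "0 \<le> x"
  have "max 1 (x ^ n) = (max 1 x) ^ n"
    using x by (cases "x \<le> 1") (auto simp: max_def power_le_one one_le_power dest: order.antisym)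
  then show ?thesis unfolding log_plus_def by (simp add: ln_realpow)
qed

lemma log_plus_square_le:
  assumes "0 \<le> x" shows "(log_plus x)\<^sup>2 \<le> 4 * x"
proof -
  have "log_plus x = 2 * log_plus (sqrt x)" using log_plus_power[of "sqrt x" 2] assms by simp
  also have "\<dots> \<le> 2 * sqrt x" using log_plus_le_self[of "sqrt x"] assms by simp
  finally have "(log_plus x)\<^sup>2 \<le> (2 * sqrt x)\<^sup>2" using log_plus_nonneg by (intro power_mono)
  then show ?thesis using assms by (simp add: power_mult_distrib)
qed

lemma log_plus_le_ln_1: "0 \<le> x \<Longrightarrow> log_plus x \<le> ln (1 + x)"
  unfolding log_plus_def by (subst ln_le_cancel_iff) auto

lemma ln_1_le_log_plus: "0 \<le> x \<Longrightarrow> ln (1 + x) \<le> log_plus x + ln 2"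
proof -
  assume "0 \<le> x"
  then have "ln (1 + x) \<le> ln (max 1 x * 2)" by (subst ln_le_cancel_iff) auto
  also have "\<dots> = ln (max 1 x) + ln 2" by (rule ln_mult_pos) auto
  finally show ?thesis by (simp add: log_plus_def)
qed

text \<open>The Poisson mass concentrates at the radial projection, and \<open>g\<close> is uniformly continuous on the
  circle; so the Poisson integral converges to \<open>g\<close> uniformly.\<close>

lemma poisson_boundary_uniform:
  fixes g :: "complex \<Rightarrow> real"
  assumes g: "continuous_on unit_circle g" and e: "0 < e"
  obtains r0 where "0 < r0" "r0 < 1"
    "\<And>r s. r0 \<le> r \<Longrightarrow> r < 1 \<Longrightarrow>
       \<bar>1 / (2*pi) * (LINT t|circ. poisson (of_real r * cis s) t * g (cis t)) - g (cis s)\<bar> \<le> e"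
proof -
  have "compact (g ` unit_circle)" using g by (intro compact_continuous_image) auto
  then obtain B where B: "B > 0" "\<And>x. x \<in> unit_circle \<Longrightarrow> \<bar>g x\<bar> \<le> B"
    using compact_imp_bounded bounded_pos by (metis imageI real_norm_def)
  have "uniformly_continuous_on unit_circle g" using g compact_uniformly_continuous compact_sphere by blast
  then obtain d where d: "d > 0" "\<And>x y. x \<in> unit_circle \<Longrightarrow> y \<in> unit_circle \<Longrightarrow> dist y x < d \<Longrightarrow> dist (g y) (g x) < e/2"
    using e unfolding uniformly_continuous_on_def by (metis half_gt_zero)
  define r0 where "r0 = max (1/2) (max (1 - d/2) (1 - e * d\<^sup>2 / (32 * B)))"
  have r0: "0 < r0" "r0 < 1" using d e B by (auto simp: r0_def)
  show ?thesis
  proof (rule that[OF r0])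
    fix r s assume r: "r0 \<le> r" "r < 1"
    let ?z = "of_real r * cis s"
    have r1: "0 < r" "1 - r \<le> d/2" "1 - r \<le> e * d\<^sup>2 / (32 * B)" using r r0 by (auto simp: r0_def)
    have z: "cmod ?z < 1" using r r1 by (simp add: norm_mult)
    have cg: "continuous_on {0..2*pi} (\<lambda>t. g (cis t))"
      by (rule continuous_on_compose2[OF g]) (auto intro!: continuous_intros)
    have ip: "integrable circ (poisson ?z)" by (intro circ_continuous_integrable continuous_on_poisson z)
    have i1: "integrable circ (\<lambda>t. poisson ?z t * g (cis t))"
      by (intro integrable_poisson z circ_continuous_integrable cg)
    have i2: "integrable circ (\<lambda>t. poisson ?z t * (g (cis t) - g (cis s)))"
      by (intro integrable_poisson z circ_continuous_integrable continuous_intros cg)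
    have i3: "integrable circ (\<lambda>t. e/2 * poisson ?z t + 2 * B * (8 * (1 - r) / d\<^sup>2))"
      by (intro Bochner_Integration.integrable_add integrable_mult_right ip circ_continuous_integrable continuous_intros)
    have pt: "\<bar>poisson ?z t * (g (cis t) - g (cis s))\<bar> \<le> e/2 * poisson ?z t + 2 * B * (8 * (1 - r) / d\<^sup>2)" for t
    proof (cases "dist (cis t) (cis s) < d")
      case True
      then have "\<bar>g (cis t) - g (cis s)\<bar> \<le> e/2" using d(2)[of "cis s" "cis t"] by (simp add: dist_real_def)
      then have "poisson ?z t * \<bar>g (cis t) - g (cis s)\<bar> \<le> poisson ?z t * (e/2)"
        using poisson_nonneg[OF z] by (intro mult_left_mono)
      moreover have "0 \<le> 2 * B * (8 * (1 - r) / d\<^sup>2)" using r B by simp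
      ultimately show ?thesis using poisson_nonneg[OF z, of t] by (simp add: abs_mult mult.commute)
    next
      case False
      then have "poisson ?z t \<le> 8 * (1 - r) / d\<^sup>2"
        using r r1 d by (intro poisson_le_away) (auto simp: dist_norm)
      moreover have "\<bar>g (cis t) - g (cis s)\<bar> \<le> 2 * B" using B(2)[of "cis t"] B(2)[of "cis s"] by simp
      ultimately have "\<bar>g (cis t) - g (cis s)\<bar> * poisson ?z t \<le> 2 * B * (8 * (1 - r) / d\<^sup>2)"
        using poisson_nonneg[OF z] by (intro mult_mono) (use B in auto)
      moreover have "0 \<le> e/2 * poisson ?z t" using poisson_nonneg[OF z] e by simp
      ultimately show ?thesis using poisson_nonneg[OF z, of t] by (simp add: abs_mult mult.commute)
    qed
    let ?I = "LINT t|circ. poisson ?z t * g (cis t)" and ?e = "8 * (1 - r) / d\<^sup>2"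
    have "(LINT t|circ. poisson ?z t * (g (cis t) - g (cis s))) =
        (LINT t|circ. poisson ?z t * g (cis t) - poisson ?z t * g (cis s))"
      by (simp add: algebra_simps)
    also have "\<dots> = ?I - 2*pi * g (cis s)"
      using i1 ip by (subst Bochner_Integration.integral_diff) (auto simp: poisson_mass[OF z])
    finally have "\<bar>?I - 2*pi * g (cis s)\<bar> =
       \<bar>LINT t|circ. poisson ?z t * (g (cis t) - g (cis s))\<bar>" by simp
    also have "\<dots> \<le> (LINT t|circ. \<bar>poisson ?z t * (g (cis t) - g (cis s))\<bar>)" by (rule integral_abs_bound)
    also have "\<dots> \<le> (LINT t|circ. e/2 * poisson ?z t + 2 * B * (?e))"
      by (rule integral_mono[OF integrable_abs[OF i2] i3]) (rule pt)
    also have "\<dots> = (LINT t|circ. e/2 * poisson ?z t) + (LINT t|circ. 2 * B * (?e))"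
      by (intro Bochner_Integration.integral_add integrable_mult_right ip circ_continuous_integrable continuous_intros)
    also have "\<dots> = 2*pi * (e/2) + 2*pi * (2 * B * (?e))"
      by (simp only: integral_mult_right_zero poisson_mass[OF z] circ_integral_const) simp
    finally have "\<bar>?I - 2*pi * g (cis s)\<bar> \<le> 2*pi * (e/2 + 2 * B * (?e))"
      by (simp add: algebra_simps)
    moreover have "2 * B * (?e) \<le> 2 * B * (8 * (e * d\<^sup>2 / (32 * B)) / d\<^sup>2)"
      using r1 B by (intro mult_left_mono divide_right_mono) auto
    moreover have "2 * B * (8 * (e * d\<^sup>2 / (32 * B)) / d\<^sup>2) = e/2" using B d by (simp add: field_simps)
    ultimately have le: "\<bar>?I - 2*pi * g (cis s)\<bar> \<le> 2*pi * e"
      by (smt (verit) mult_left_mono pi_gt_zero field_sum_of_halves)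
    have "1 / (2*pi) * ?I - g (cis s) =
       (?I - 2*pi * g (cis s)) / (2*pi)"
      by (simp add: field_simps)
    then have "\<bar>1 / (2*pi) * ?I - g (cis s)\<bar> =
        \<bar>?I - 2*pi * g (cis s)\<bar> / (2*pi)"
      by (simp only: abs_divide) simp
    also have "\<dots> \<le> e" using le by (simp add: field_simps)
    finally show "\<bar>1 / (2*pi) * ?I - g (cis s)\<bar> \<le> e" .
  qed
qed

text \<open>Subharmonicity of \<open>log\<^sup>+ |F|\<close> with an explicit majorant. Let \<open>G\<close> be the Herglotz transform of the
  boundary values of \<open>log\<^sup>+ |F|\<close>; near the circle \<open>|F exp (-G)|\<close> is at most a number close to \<open>1\<close>, and
  the maximum modulus principle carries this bound inside.\<close>

lemma log_plus_le_Re_herglotz: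
  fixes F :: "complex \<Rightarrow> complex"
  assumes Fc: "continuous_on (cball 0 1) F" and Fh: "F holomorphic_on unit_disk" and z: "z \<in> unit_disk"
  shows "log_plus (cmod (F z)) \<le> Re (herglotz (\<lambda>t. log_plus (cmod (F (cis t)))) z)"
proof -
  define g where "g u = log_plus (cmod (F u))" for u
  have gc: "continuous_on (cball 0 1) g" unfolding g_def using Fc by (intro continuous_intros)
  have gs: "continuous_on unit_circle g" using gc by (rule continuous_on_subset) auto
  let ?v = "\<lambda>t. g (cis t)"
  have vc: "continuous_on {0..2*pi} ?v"
    by (rule continuous_on_compose2[OF gs]) (auto intro!: continuous_intros)
  have vi: "integrable circ ?v" using vc by (rule circ_continuous_integrable)
  let ?G = "herglotz ?v"
  have hG: "?G holomorphic_on unit_disk" by (rule herglotz_holomorphic[OF vi])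
  have ReG: "0 \<le> Re (?G w)" if "w \<in> unit_disk" for w
    using that poisson_nonneg[of w] log_plus_nonneg
    by (subst Re_herglotz[OF vi]) (auto intro!: mult_nonneg_nonneg Bochner_Integration.integral_nonneg simp: g_def)
  have key: "g z \<le> Re (?G z) + 2 * e" if e: "e > 0" for e
  proof -
    obtain r0 where r0: "0 < r0" "r0 < 1"
      "\<And>r s. r0 \<le> r \<Longrightarrow> r < 1 \<Longrightarrow>
       \<bar>1 / (2*pi) * (LINT t|circ. poisson (of_real r * cis s) t * g (cis t)) - g (cis s)\<bar> \<le> e"
      using poisson_boundary_uniform[OF gs e] by metis
    have "uniformly_continuous_on (cball 0 1) g" using gc compact_uniformly_continuous compact_cball by blast
    then obtain d where d: "d > 0" "\<And>x y. x \<in> cball 0 1 \<Longrightarrow> y \<in> cball 0 1 \<Longrightarrow> dist y x < d \<Longrightarrow> dist (g y) (g x) < e"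
      using e unfolding uniformly_continuous_on_def by metis
    define r where "r = max (max r0 (1 - d/2)) ((1 + cmod z)/2)"
    have r: "r0 \<le> r" "0 < r" "r < 1" "1 - d/2 \<le> r" "cmod z < r"
      using z d r0 by (auto simp: r_def max_def)
    \<comment> \<open>Only \<open>Re ?G\<close> is continuous up to the circle, so the maximum principle is used on a slightly smaller disc.\<close>
    have "cmod (F z * exp (- ?G z)) \<le> exp (2 * e)"
    proof (rule maximum_modulus_frontier[of "\<lambda>w. F w * exp (- ?G w)" "cball 0 r"])
      have sub: "cball 0 r \<subseteq> unit_disk" using r by auto
      show "(\<lambda>w. F w * exp (- ?G w)) holomorphic_on interior (cball 0 r)"
        using holomorphic_on_subset[OF Fh, of "interior (cball 0 r)"] holomorphic_on_subset[OF hG, of "interior (cball 0 r)"]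
          sub r by (intro holomorphic_intros) (auto simp: subset_eq)
      have "continuous_on (cball 0 r) F" "continuous_on (cball 0 r) ?G"
        using Fh hG sub holomorphic_on_imp_continuous_on continuous_on_subset by blast+
      then show "continuous_on (closure (cball 0 r)) (\<lambda>w. F w * exp (- ?G w))"
        by (auto intro!: continuous_intros)
      fix w :: complex assume "w \<in> frontier (cball 0 r)"
      then have cw: "cmod w = r" using r by simp
      define s where "s = Arg w"
      have w: "w = of_real r * cis s" using cw r by (metis s_def rcis_cmod_Arg rcis_def)
      have wd: "w \<in> unit_disk" using cw r by simp
      have "dist w (cis s) < d" using r d unfolding w dist_norm cmod_radial_diff by simp
      then have "g w \<le> g (cis s) + e" using d(2)[of "cis s" w] wd by (simp add: dist_real_def)
      moreover have "g (cis s) \<le> Re (?G w) + e"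
        using r0(3)[OF r(1) r(3), of s] Re_herglotz[OF vi, of w] wd w by simp
      ultimately have "g w \<le> Re (?G w) + 2 * e" by simp
      moreover have "cmod (F w) \<le> exp (g w)" unfolding g_def by (rule le_exp_log_plus)
      ultimately have "cmod (F w) \<le> exp (Re (?G w) + 2 * e)" by (meson exp_le_cancel_iff order_trans)
      then have "cmod (F w) * exp (- Re (?G w)) \<le> exp (Re (?G w) + 2 * e) * exp (- Re (?G w))"
        by (intro mult_right_mono) auto
      then show "cmod (F w * exp (- ?G w)) \<le> exp (2 * e)" by (simp add: norm_mult flip: exp_add)
    qed (use r in auto)
    then have "cmod (F z) * exp (- Re (?G z)) * exp (Re (?G z)) \<le> exp (2 * e) * exp (Re (?G z))"
      by (intro mult_right_mono) (auto simp: norm_mult)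
    then have "cmod (F z) \<le> exp (Re (?G z) + 2 * e)" by (simp add: mult.assoc flip: exp_add) (simp add: add.commute)
    then show ?thesis unfolding g_def using ReG[OF z] e by (subst log_plus_le_iff) (auto simp: g_def)
  qed
  have "g z \<le> Re (?G z)"
  proof (rule field_le_epsilon)
    fix e :: real assume "e > 0" then show "g z \<le> Re (?G z) + e" using key[of "e/2"] by simp
  qed
  then show ?thesis by (simp add: g_def)
qed

section \<open>Nontangential maximal functions\<close>

text \<open>A crude form of Jordan's inequality, enough to compare chords with arcs.\<close>

lemma half_le_sin:
  assumes "0 \<le> y" "y \<le> pi/2" shows "y / 2 \<le> sin y"
proof -
  have tan: "u * cos u \<le> sin u" if u: "0 \<le> u" "u \<le> pi" for u :: real
  proof -
    have "sin 0 - 0 * cos 0 \<le> sin u - u * cos u"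
    proof (rule DERIV_nonneg_imp_nondecreasing[OF u(1)])
      fix x assume "0 \<le> x" "x \<le> u"
      then have "0 \<le> x * sin x" using u by (intro mult_nonneg_nonneg sin_ge_zero) auto
      moreover have "((\<lambda>x. sin x - x * cos x) has_real_derivative (x * sin x)) (at x)"
        by (auto intro!: derivative_eq_intros)
      ultimately show "\<exists>y. ((\<lambda>x. sin x - x * cos x) has_real_derivative y) (at x) \<and> 0 \<le> y" by blast
    qed
    then show ?thesis by simp
  qed
  \<comment> \<open>\<open>sin y = 2 sin (y/2) cos (y/2) \<ge> y cos\<^sup>2 (y/2) = y (1 + cos y) / 2\<close>.\<close>
  have c: "0 \<le> cos (y/2)" using assms by (intro cos_ge_zero) auto
  have "cos (2 * (y/2)) = 2 * (cos (y/2))\<^sup>2 - 1" by (rule cos_double_cos)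
  then have "y * ((1 + cos y) / 2) = 2 * (y/2 * cos (y/2)) * cos (y/2)" by (simp add: power2_eq_square)
  also have "\<dots> \<le> 2 * sin (y/2) * cos (y/2)"
    using tan[of "y/2"] assms c by (intro mult_right_mono mult_left_mono) auto
  also have "\<dots> = sin y" using sin_double[of "y/2"] by simp
  finally have "y * ((1 + cos y) / 2) \<le> sin y" .
  moreover have "y * (1/2) \<le> y * ((1 + cos y) / 2)"
    using assms cos_ge_zero[of y] by (intro mult_left_mono) auto
  ultimately show ?thesis by simp
qed

lemma chord_ge:
  assumes "\<bar>x - y\<bar> \<le> pi" shows "\<bar>x - y\<bar> \<le> 2 * cmod (cis x - cis y)"
proof -
  note cmod_cis_diff[of x y]
  also have "\<bar>sin ((x - y) / 2)\<bar> = sin (\<bar>x - y\<bar> / 2)"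
  proof -
    have "\<bar>sin u\<bar> = sin \<bar>u\<bar>" if "\<bar>u\<bar> \<le> pi" for u :: real
    proof (cases "0 \<le> u")
      case True then show ?thesis using sin_ge_zero[of u] that by simp
    next
      case False then show ?thesis using sin_ge_zero[of "-u"] that by simp
    qed
    from this[of "(x - y) / 2"] show ?thesis using assms by simp
  qed
  finally show ?thesis using half_le_sin[of "\<bar>x - y\<bar> / 2"] assms by simp
qed

text \<open>The Hardy-Littlewood weak-type inequality. Each point of the exceptional set is the centre of an
  interval on which \<open>g\<close> has a large integral; Vitali's lemma selects disjoint ones whose fivefold
  enlargements cover the set.\<close>

lemma weak_type_maximal:
  fixes g :: "real \<Rightarrow> real"
  assumes nonneg: "\<And>x. 0 \<le> g x" and t: "0 < t"
    and int: "set_integrable lborel {a - R..b + R} g"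
  obtains T where "T \<in> lmeasurable"
    "{\<theta> \<in> {a..b}. \<exists>s. 0 < s \<and> s \<le> R \<and> t * s < (LINT x:{\<theta> - s..\<theta> + s}|lborel. g x)} \<subseteq> T"
    "measure lebesgue T \<le> 10 / t * (LINT x:{a - R..b + R}|lborel. g x)"
proof -
  define E where "E = {\<theta> \<in> {a..b}. \<exists>s. 0 < s \<and> s \<le> R \<and> t * s < (LINT x:{\<theta> - s..\<theta> + s}|lborel. g x)}"
  have "\<forall>\<theta>\<in>E. \<exists>s. 0 < s \<and> s \<le> R \<and> t * s < (LINT x:{\<theta> - s..\<theta> + s}|lborel. g x)"
    unfolding E_def by auto
  then obtain s where s: "\<And>\<theta>. \<theta> \<in> E \<Longrightarrow> 0 < s \<theta>" "\<And>\<theta>. \<theta> \<in> E \<Longrightarrow> s \<theta> \<le> R"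
     "\<And>\<theta>. \<theta> \<in> E \<Longrightarrow> t * s \<theta> < (LINT x:{\<theta> - s \<theta>..\<theta> + s \<theta>}|lborel. g x)"
    by metis
  have "E \<subseteq> (\<Union>\<theta>\<in>E. cball \<theta> (s \<theta>))" using s(1) by (auto simp: less_imp_le)
  then obtain C where C: "countable C" "C \<subseteq> E"
     "pairwise (\<lambda>i j. disjnt (cball i (s i)) (cball j (s j))) C"
     "E \<subseteq> (\<Union>i\<in>C. cball i (5 * s i))"
    by (rule Vitali_covering_lemma_cballs[where B = R and K = E and a = "\<lambda>\<theta>. \<theta>" and r = s]) (use s in auto)
  let ?I = "LINT x:{a - R..b + R}|lborel. g x"
  let ?T = "\<Union>i\<in>C. cball i (5 * s i)"
  have fin: "measure lebesgue (\<Union>i\<in>I. cball i (5 * s i)) \<le> 10 / t * ?I" if I: "I \<subseteq> C" "finite I" for I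
  proof -
    have IE: "I \<subseteq> E" using I C by auto
    have sub: "cball i (s i) \<subseteq> {a - R..b + R}" if "i \<in> I" for i
      using that IE s(2)[of i] unfolding cball_eq_atLeastAtMost E_def by force
    have inti: "integrable lborel (\<lambda>x. indicator (cball i (s i)) x * g x)" if "i \<in> I" for i
      using set_integrable_subset[OF int _ sub[OF that]] by (simp add: set_integrable_def)
    have "measure lebesgue (\<Union>i\<in>I. cball i (5 * s i)) \<le> (\<Sum>i\<in>I. measure lebesgue (cball i (5 * s i)))"
      by (rule measure_UNION_le[OF I(2)]) auto
    also have "\<dots> \<le> (\<Sum>i\<in>I. 10 / t * (LINT x|lborel. indicator (cball i (s i)) x * g x))"
    proof (rule sum_mono)
      fix i assume i: "i \<in> I"
      then have iE: "i \<in> E" using IE by auto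
      have "measure lebesgue (cball i (5 * s i)) = 10 * s i"
        using s(1)[OF iE] by (simp add: cball_eq_atLeastAtMost)
      also have "\<dots> \<le> 10 / t * (LINT x|lborel. indicator (cball i (s i)) x * g x)"
        using s(3)[OF iE] t unfolding set_lebesgue_integral_def cball_eq_atLeastAtMost
        by (simp add: field_simps)
      finally show "measure lebesgue (cball i (5 * s i)) \<le> 10 / t * (LINT x|lborel. indicator (cball i (s i)) x * g x)" .
    qed
    also have "\<dots> = 10 / t * (LINT x|lborel. (\<Sum>i\<in>I. indicator (cball i (s i)) x * g x))"
      by (subst Bochner_Integration.integral_sum) (use inti in \<open>auto simp: sum_distrib_left\<close>)
    also have "\<dots> \<le> 10 / t * ?I"
      unfolding set_lebesgue_integral_def
    proof (intro mult_left_mono integral_mono)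
      show "integrable lborel (\<lambda>x. \<Sum>i\<in>I. indicator (cball i (s i)) x * g x)" using inti by auto
      show "integrable lborel (\<lambda>x. indicat_real {a - R..b + R} x *\<^sub>R g x)" using int by (simp add: set_integrable_def)
      fix x :: real
      have "(\<Sum>i\<in>I. indicator (cball i (s i)) x) = (indicator (\<Union>i\<in>I. cball i (s i)) x :: real)"
        using C(3) I by (intro indicator_UN_disjoint[symmetric])
          (auto simp: disjoint_family_on_def pairwise_def disjnt_def subset_eq)
      also have "\<dots> \<le> indicator {a - R..b + R} x" using sub by (intro indicator_leI) blast
      finally show "(\<Sum>i\<in>I. indicator (cball i (s i)) x * g x) \<le> indicator {a - R..b + R} x *\<^sub>R g x"
        using nonneg[of x] by (simp flip: sum_distrib_right) (intro mult_right_mono, auto)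
    qed (use t in auto)
    finally show ?thesis .
  qed
  have "?T \<in> lmeasurable" "measure lebesgue ?T \<le> 10 / t * ?I"
    by (rule fmeasurable_UN_bound measure_UN_bound; use C fin in auto)+
  then show ?thesis using that C(4) unfolding E_def by blast
qed

text \<open>The constant in the comparison of the Poisson kernel at points of \<open>Stolz A (cis \<theta>)\<close> with averages
  over intervals centred at \<open>\<theta>\<close>.\<close>

definition stolz_const :: "real \<Rightarrow> real" where "stolz_const A = 16 * (1 + A)\<^sup>2"

text \<open>For \<open>z\<close> in a Stolz angle at \<open>cis \<theta>\<close> and \<open>\<delta> = 1 - |z|\<close>, the kernel at \<open>x\<close> decays like
  \<open>\<delta> / max \<delta> |x - \<theta>|\<^sup>2\<close>, because \<open>|cis x - z|\<close> is comparable from below with \<open>|x - \<theta>|\<close>. Summing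
  over dyadic scales dominates it by intervals centred at \<open>\<theta>\<close>.\<close>

lemma poisson_dyadic_bound:
  assumes z: "z \<in> Stolz A (cis \<theta>)" and A: "A > 1"
  obtains n where "2^n * (1 - cmod z) \<le> 2*pi"
    "\<And>x. \<bar>x - \<theta>\<bar> \<le> pi \<Longrightarrow> poisson z x \<le>
      (\<Sum>k\<le>n. 2 * stolz_const A / (4^k * (1 - cmod z)) * indicator {\<theta> - 2^k * (1 - cmod z)..\<theta> + 2^k * (1 - cmod z)} x)"
proof -
  define \<delta> where "\<delta> = 1 - cmod z"
  have z1: "cmod z < 1" and zA: "cmod (z - cis \<theta>) \<le> A * \<delta>" using z by (auto simp: Stolz_def \<delta>_def)
  have \<delta>: "0 < \<delta>" "\<delta> \<le> 1" using z1 by (auto simp: \<delta>_def)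
  \<comment> \<open>The least dyadic multiple of \<open>\<delta>\<close> that reaches \<open>pi\<close>; being the least it is at most \<open>2 pi\<close>.\<close>
  have "\<exists>n. pi / \<delta> < 2^n" by (rule real_arch_pow) simp
  then have ex: "\<exists>n. pi \<le> 2^n * \<delta>" using \<delta> by (auto simp: field_simps intro: less_imp_le)
  define n where "n = (LEAST n. pi \<le> 2^n * \<delta>)"
  have n: "pi \<le> 2^n * \<delta>" unfolding n_def using ex by (rule LeastI_ex)
  have n2: "2^n * \<delta> \<le> 2*pi"
  proof (cases n)
    case 0 then show ?thesis using \<delta> pi_ge_two by simp
  next
    case (Suc m)
    then have "\<not> pi \<le> 2^m * \<delta>" using not_less_Least[of m "\<lambda>n. pi \<le> 2^n * \<delta>"] by (simp add: n_def)
    then show ?thesis using Suc by simp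
  qed
  define \<kappa> where "\<kappa> = 2 * (1 + A)"
  have c: "stolz_const A = 4 * \<kappa>\<^sup>2" unfolding stolz_const_def \<kappa>_def power_mult_distrib by simp
  have k1: "1 \<le> \<kappa>\<^sup>2" using A by (intro one_le_power) (simp add: \<kappa>_def)
  show ?thesis
  proof (rule that[of n])
    fix x assume x: "\<bar>x - \<theta>\<bar> \<le> pi"
    define d where "d = cmod (cis x - z)"
    have d: "\<delta> \<le> d" unfolding d_def \<delta>_def by (rule cmod_cis_diff_ge)
    have dx: "\<bar>x - \<theta>\<bar> \<le> \<kappa> * d"
    proof -
      have "\<bar>x - \<theta>\<bar> \<le> 2 * cmod (cis x - cis \<theta>)" by (rule chord_ge[OF x])
      also have "cmod (cis x - cis \<theta>) \<le> d + cmod (z - cis \<theta>)"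
        unfolding d_def by (rule order_trans[OF _ norm_triangle_ineq]) simp
      also have "\<dots> \<le> d + A * d" using zA d A by (smt (verit) mult_left_mono)
      finally show ?thesis by (simp add: \<kappa>_def algebra_simps)
    qed
    have "\<delta> * (1 + cmod z) \<le> \<delta> * 2" using \<delta> z1 by (intro mult_left_mono) auto
    then have "1 - (cmod z)\<^sup>2 \<le> 2 * \<delta>" unfolding one_minus_square \<delta>_def[symmetric] by simp
    then have P: "poisson z x \<le> 2 * \<delta> / d\<^sup>2" unfolding poisson_def d_def[symmetric]
      by (intro divide_right_mono) auto
    let ?f = "\<lambda>k. 2 * stolz_const A / (4^k * \<delta>) * indicator {\<theta> - 2^k * \<delta>..\<theta> + 2^k * \<delta>} x"
    have "\<exists>k\<le>n. 2 * \<delta> / d\<^sup>2 \<le> ?f k"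
    proof (cases "\<bar>x - \<theta>\<bar> \<le> \<delta>")
      case True
      have "2 * \<delta> / d\<^sup>2 \<le> 2 * \<delta> / \<delta>\<^sup>2" using d \<delta> by (intro divide_left_mono power_mono) auto
      also have "\<dots> \<le> 2 * stolz_const A / \<delta>" using \<delta> k1 by (simp add: power2_eq_square c field_simps)
      finally show ?thesis using True by (intro exI[of _ 0]) (auto simp: abs_le_iff)
    next
      case False
      have exk: "\<exists>k. \<bar>x - \<theta>\<bar> \<le> 2^k * \<delta>" using order_trans[OF x n] by blast
      define k where "k = (LEAST k. \<bar>x - \<theta>\<bar> \<le> 2^k * \<delta>)"
      have k: "\<bar>x - \<theta>\<bar> \<le> 2^k * \<delta>" unfolding k_def using exk by (rule LeastI_ex)
      have kn: "k \<le> n" unfolding k_def using x n by (intro Least_le) auto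
      obtain m where m: "k = Suc m" using k False by (cases k) auto
      then have "2^m * \<delta> < \<bar>x - \<theta>\<bar>" using not_less_Least[of m "\<lambda>k. \<bar>x - \<theta>\<bar> \<le> 2^k * \<delta>"] by (simp add: k_def)
      then have "2^m * \<delta> \<le> \<kappa> * d" using dx by simp
      then have "(2^m * \<delta>)\<^sup>2 \<le> (\<kappa> * d)\<^sup>2" using \<delta> by (intro power_mono) auto
      then have sq: "4^m * \<delta>\<^sup>2 \<le> \<kappa>\<^sup>2 * d\<^sup>2" by (simp add: power_mult_distrib power_mult[symmetric] mult.commute[of m] power_mult[of 2 2])
      have d0: "0 < d" using d \<delta> by simp
      have "2 * \<delta> / d\<^sup>2 \<le> 2 * \<kappa>\<^sup>2 / (4^m * \<delta>)"
        using sq \<delta> d0 by (simp add: divide_le_eq le_divide_eq power2_eq_square mult_ac)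
      also have "\<dots> = ?f k" using k m by (auto simp: c abs_le_iff indicator_def)
      finally show ?thesis using kn by blast
    qed
    then obtain k where k: "k \<le> n" "2 * \<delta> / d\<^sup>2 \<le> ?f k" by blast
    have "?f k \<le> (\<Sum>k\<le>n. ?f k)"
      using k \<delta> by (intro member_le_sum) (auto simp: stolz_const_def intro!: divide_nonneg_nonneg mult_nonneg_nonneg)
    then show "poisson z x \<le> (\<Sum>k\<le>n. 2 * stolz_const A / (4^k * (1 - cmod z)) * indicator {\<theta> - 2^k * (1 - cmod z)..\<theta> + 2^k * (1 - cmod z)} x)"
      using P k unfolding \<delta>_def[symmetric] by linarith
  qed (use n2 in \<open>simp add: \<delta>_def\<close>)
qed

lemma circ_integral_lborel:
  fixes f :: "real \<Rightarrow> real"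
  assumes [measurable]: "f \<in> borel_measurable borel"
  shows "(LINT t|circ. f t) = (LINT t:{0..2*pi}|lborel. f t)"
  by (simp add: integral_restrict_space integral_completion set_lebesgue_integral_def)

text \<open>If all averages of \<open>|F|\<^sup>2\<close> over arcs centred at \<open>cis \<theta>\<close> are small, then \<open>|F|\<^sup>2\<close> is small on the
  whole Stolz angle: integrate the dyadic bound for the Poisson kernel.\<close>

lemma nontangential_le_averages:
  assumes F: "F holomorphic_on unit_disk" and r: "0 < r" "r < 1"
    and A: "A > 1" and z: "z \<in> Stolz A (cis \<theta>)"
    and avg: "\<And>s. 0 < s \<Longrightarrow> s \<le> 2*pi \<Longrightarrow>
       (LINT x:{\<theta> - s..\<theta> + s}|lborel. (cmod (F (of_real r * cis x)))\<^sup>2) \<le> t * s"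
  shows "(cmod (F (of_real r * z)))\<^sup>2 \<le> stolz_const A * t"
proof -
  define g where "g x = (cmod (F (of_real r * cis x)))\<^sup>2" for x
  have cF: "continuous_on UNIV (\<lambda>x. F (of_real r * cis x))"
    by (rule continuous_on_compose2[OF dilation_holomorphic(2)[OF F r]]) (auto intro!: continuous_intros)
  have cg: "continuous_on UNIV g" unfolding g_def using cF by (intro continuous_intros)
  have [measurable]: "g \<in> borel_measurable borel" using cg by (rule borel_measurable_continuous_onI)
  have g0: "0 \<le> g x" for x by (simp add: g_def)
  define \<delta> where "\<delta> = 1 - cmod z"
  have z1: "cmod z < 1" using z by (auto simp: Stolz_def)
  have \<delta>: "0 < \<delta>" using z1 by (simp add: \<delta>_def)
  obtain n where n: "2^n * \<delta> \<le> 2*pi"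
    "\<And>x. \<bar>x - \<theta>\<bar> \<le> pi \<Longrightarrow> poisson z x \<le>
      (\<Sum>k\<le>n. 2 * stolz_const A / (4^k * \<delta>) * indicator {\<theta> - 2^k * \<delta>..\<theta> + 2^k * \<delta>} x)"
    by (rule poisson_dyadic_bound[OF z A, folded \<delta>_def]) (rule that; assumption)
  \<comment> \<open>With this shift the circle is parametrized over the window \<open>[\<theta> - pi, \<theta> + pi]\<close> centred at \<open>\<theta>\<close>.\<close>
  define a where "a = \<theta> - pi"
  let ?J = "\<lambda>k. {\<theta> - 2^k * \<delta>..\<theta> + 2^k * \<delta>}"
  let ?c = "\<lambda>k. 2 * stolz_const A / (4^k * \<delta>)"
  let ?S = "\<lambda>x. \<Sum>k\<le>n. ?c k * (indicator (?J k) (x + a) * g (x + a))"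
  have c0: "0 \<le> ?c k" for k using \<delta> by (simp add: stolz_const_def)
  have ig: "integrable lborel (\<lambda>x. indicator {p..q} x * g x)" for p q
    using borel_integrable_atLeastAtMost'[of p q g] continuous_on_subset[OF cg] by (auto simp: set_integrable_def)
  have ig': "integrable lborel (\<lambda>x. indicator {p..q} (x + a) * g (x + a))" for p q
    using lborel_integrable_real_affine[OF ig[of p q], of 1 a] by (simp add: add.commute)
  have J: "(LINT x|circ. indicator (?J k) (x + a) * g (x + a)) \<le> t * (2^k * \<delta>)" if "k \<le> n" for k
  proof -
    have "(LINT x|circ. indicator (?J k) (x + a) * g (x + a)) =
       (LINT x|lborel. indicator {0..2*pi} x * (indicator (?J k) (x + a) * g (x + a)))"
      by (subst circ_integral_lborel) (auto simp: set_lebesgue_integral_def)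
    also have "\<dots> \<le> (LINT x|lborel. indicator (?J k) (x + a) * g (x + a))"
    proof (rule integral_mono')
      show "integrable lborel (\<lambda>x. indicator (?J k) (x + a) * g (x + a))" by (rule ig')
    qed (auto simp: indicator_def g0)
    also have "\<dots> = (LINT x|lborel. indicator (?J k) x * g x)"
      using lborel_integral_real_affine[of 1 "\<lambda>x. indicator (?J k) x * g x" a] by (simp add: add.commute)
    also have "\<dots> \<le> t * (2^k * \<delta>)"
    proof -
      have "2^k * \<delta> \<le> 2^n * \<delta>" using that \<delta> by simp
      then have "2^k * \<delta> \<le> 2*pi" using n(1) by linarith
      then show ?thesis using avg[of "2^k * \<delta>"] \<delta> unfolding g_def set_lebesgue_integral_def by simp
    qed
    finally show ?thesis .
  qed
  have iJ: "integrable circ (\<lambda>x. indicator (?J k) (x + a) * g (x + a))" for k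
  proof -
    have "integrable lborel (\<lambda>x. indicator {0..2*pi} x *\<^sub>R (indicator (?J k) (x + a) * g (x + a)))"
      by (rule integrable_mult_indicator[OF _ ig']) simp
    then have "integrable lebesgue (\<lambda>x. indicator {0..2*pi} x *\<^sub>R (indicator (?J k) (x + a) * g (x + a)))"
      by (intro integrable_completion[THEN iffD2]) measurable
    then show ?thesis by (simp add: integrable_restrict_space)
  qed
  \<comment> \<open>The square is holomorphic, so the Poisson formula for it bounds \<open>|F|\<^sup>2\<close> by the Poisson integral of \<open>|F|\<^sup>2\<close>.\<close>
  let ?G = "\<lambda>u. (F (of_real r * u))\<^sup>2"
  have eq: "?G z = 1 / (2*pi) * (LINT x|circ. of_real (poisson z (x + a)) * ?G (cis (x + a)))"
    by (rule poisson_formula_shift[OF _ _ z1])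
      (use dilation_holomorphic[OF F r] in \<open>auto intro!: continuous_intros holomorphic_intros\<close>)
  have "g' \<le> 1 / (2*pi) * (LINT x|circ. cmod (of_real (poisson z (x + a)) * ?G (cis (x + a))))"
    if "g' = cmod (?G z)" for g'
  proof -
    have "g' = 1 / (2*pi) * cmod (LINT x|circ. of_real (poisson z (x + a)) * ?G (cis (x + a)))"
      unfolding that by (subst eq) (simp add: norm_divide)
    then show ?thesis
      using integral_norm_bound[of circ "\<lambda>x. of_real (poisson z (x + a)) * ?G (cis (x + a))"]
      by (simp only:) (intro mult_left_mono, auto)
  qed
  then have "(cmod (F (of_real r * z)))\<^sup>2 \<le> 1 / (2*pi) * (LINT x|circ. cmod (of_real (poisson z (x + a)) * ?G (cis (x + a))))"
    by (simp add: norm_power)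
  also have "(LINT x|circ. cmod (of_real (poisson z (x + a)) * ?G (cis (x + a)))) = (LINT x|circ. poisson z (x + a) * g (x + a))"
    using poisson_nonneg[OF z1] by (simp add: norm_mult norm_power g_def)
  also have "1 / (2*pi) * \<dots> \<le> 1 / (2*pi) * (LINT x|circ. ?S x)"
  proof (intro mult_left_mono integral_mono)
    have "continuous_on UNIV (\<lambda>x. g (x + a))" by (rule continuous_on_compose2[OF cg]) (auto intro!: continuous_intros)
    then have c1: "continuous_on {0..2*pi} (\<lambda>x. g (x + a))" using continuous_on_subset by blast
    show "integrable circ (\<lambda>x. poisson z (x + a) * g (x + a))"
      by (intro circ_continuous_integrable continuous_intros c1 continuous_on_poisson_shift z1)
    show "integrable circ ?S"
      by (intro Bochner_Integration.integrable_sum integrable_mult_right iJ)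
    fix x assume "x \<in> space circ"
    then have "\<bar>(x + a) - \<theta>\<bar> \<le> pi" by (auto simp: a_def)
    then have "poisson z (x + a) * g (x + a) \<le> (\<Sum>k\<le>n. ?c k * indicator (?J k) (x + a)) * g (x + a)"
      by (intro mult_right_mono n(2) g0)
    then show "poisson z (x + a) * g (x + a) \<le> ?S x"
      by (simp add: sum_distrib_right mult.assoc)
  qed auto
  finally have 1: "(cmod (F (of_real r * z)))\<^sup>2 \<le> 1 / (2*pi) * (LINT x|circ. ?S x)" .
  have "(LINT x|circ. ?S x) =
     (\<Sum>k\<le>n. ?c k * (LINT x|circ. indicator (?J k) (x + a) * g (x + a)))"
    by (simp only: Bochner_Integration.integral_sum[OF integrable_mult_right[OF iJ]] integral_mult_right_zero)
  also have "\<dots> \<le> (\<Sum>k\<le>n. ?c k * (t * (2^k * \<delta>)))"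
    by (intro sum_mono mult_left_mono J c0) auto
  also have "\<dots> = 2 * stolz_const A * t * (\<Sum>k\<le>n. (1/2)^k)"
    unfolding sum_distrib_left
  proof (rule sum.cong)
    fix k :: nat
    have "(4::real)^k = 2^k * 2^k" by (simp flip: power_mult_distrib)
    then show "?c k * (t * (2^k * \<delta>)) = 2 * stolz_const A * t * (1/2)^k"
      using \<delta> by (simp add: field_simps power_one_over)
  qed simp
  also have "\<dots> \<le> 2 * stolz_const A * t * 2"
  proof (intro mult_left_mono)
    have "(\<Sum>k\<le>n. (1/2)^k) \<le> (\<Sum>k. (1/2::real)^k)" by (intro sum_le_suminf summable_geometric) auto
    then show "(\<Sum>k\<le>n. (1/2)^k) \<le> (2::real)" by (simp add: suminf_geometric)
    have "0 \<le> (LINT x:{\<theta> - 1..\<theta> + 1}|lborel. (cmod (F (of_real r * cis x)))\<^sup>2)"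
      unfolding set_lebesgue_integral_def by (intro Bochner_Integration.integral_nonneg) auto
    then have "0 \<le> t" using avg[of 1] pi_ge_two by simp
    then show "0 \<le> 2 * stolz_const A * t" by (simp add: stolz_const_def)
  qed
  finally have "1 / (2*pi) * (LINT x|circ. ?S x) \<le>
      1 / (2*pi) * (2 * stolz_const A * t * 2)"
    by (rule mult_left_mono) simp
  with 1 have "(cmod (F (of_real r * z)))\<^sup>2 \<le> 1 / (2*pi) * (4 * (stolz_const A * t))" by simp
  also have "\<dots> \<le> stolz_const A * t"
  proof -
    have "0 \<le> stolz_const A * t"
      using \<open>(cmod (F (of_real r * z)))\<^sup>2 \<le> 1 / (2*pi) * (4 * (stolz_const A * t))\<close>
      by (smt (verit) zero_le_power2 mult_pos_neg pi_gt_zero zero_less_divide_iff)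
    then show ?thesis using mult_right_mono[OF pi_ge_two, of "stolz_const A * t"] by (simp add: field_simps)
  qed
  finally show ?thesis .
qed

text \<open>The intervals in the maximal inequality reach up to one period beyond either end of
  \<open>[0, 2 pi]\<close>, hence the factor \<open>3\<close>.\<close>

lemma periodic_three_periods:
  fixes g :: "real \<Rightarrow> real"
  assumes cg: "continuous_on UNIV g" and nonneg: "\<And>x. 0 \<le> g x" and per: "\<And>x. g (x + 2*pi) = g x"
  shows "(LINT x:{0 - 2*pi..2*pi + 2*pi}|lborel. g x) \<le> 3 * (LINT x|circ. g x)"
proof -
  have [measurable]: "g \<in> borel_measurable borel" using cg by (rule borel_measurable_continuous_onI)
  have per': "g (x - 2*pi) = g x" for x using per[of "x - 2*pi"] by simp
  let ?f = "\<lambda>x. indicator {0..2*pi} x * g x"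
  have i0: "integrable lborel ?f"
    using borel_integrable_atLeastAtMost'[of 0 "2*pi" g] continuous_on_subset[OF cg] by (auto simp: set_integrable_def)
  have i1: "integrable lborel (\<lambda>x. ?f (x + c))" for c
    using lborel_integrable_real_affine[OF i0, of 1 c] by (simp add: add.commute)
  have e1: "(LINT x|lborel. ?f (x + c)) = (LINT x|lborel. ?f x)" for c
    using lborel_integral_real_affine[of 1 ?f c] by (simp add: add.commute)
  have "(LINT x:{0 - 2*pi..2*pi + 2*pi}|lborel. g x) \<le> (LINT x|lborel. ?f x + ?f (x + 2*pi) + ?f (x + (- 2*pi)))"
    unfolding set_lebesgue_integral_def
  proof (rule integral_mono)
    show "integrable lborel (\<lambda>x. indicat_real {0 - 2*pi..2*pi + 2*pi} x *\<^sub>R g x)"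
      using borel_integrable_atLeastAtMost'[of "0 - 2*pi" "2*pi + 2*pi" g] continuous_on_subset[OF cg] by (auto simp: set_integrable_def)
    show "integrable lborel (\<lambda>x. ?f x + ?f (x + 2*pi) + ?f (x + (- 2*pi)))"
      using i0 i1[of "2*pi"] i1[of "- 2*pi"] by (intro Bochner_Integration.integrable_add)
    fix x
    show "indicat_real {0 - 2*pi..2*pi + 2*pi} x *\<^sub>R g x \<le> ?f x + ?f (x + 2*pi) + ?f (x + (- 2*pi))"
      using nonneg[of x] by (auto simp: indicator_def per per')
  qed
  also have "\<dots> = 3 * (LINT x|lborel. ?f x)"
    using i0 i1[of "2*pi"] i1[of "- 2*pi"] e1[of "2*pi"] e1[of "- 2*pi"] by simp
  also have "(LINT x|lborel. ?f x) = (LINT x|circ. g x)"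
    by (subst circ_integral_lborel) (auto simp: set_lebesgue_integral_def)
  finally show ?thesis .
qed

text \<open>The weak-type bound for the nontangential maximal function of a holomorphic function with bounded
  square means. It is proved for the dilations of \<open>F\<close>, which are continuous on the closed disc, and
  passes to \<open>F\<close> through the lower limit of the exceptional sets.\<close>

lemma nontangential_weak_type:
  assumes F: "F holomorphic_on unit_disk" and A: "A > 1" and l: "0 < l"
    and L2: "\<And>r. 0 < r \<Longrightarrow> r < 1 \<Longrightarrow> (LINT t|circ. (cmod (F (of_real r * cis t)))\<^sup>2) \<le> \<tau>"
  obtains T where "T \<in> lmeasurable"
    "{\<theta> \<in> {0..2*pi}. \<exists>z\<in>Stolz A (cis \<theta>). l < (cmod (F z))\<^sup>2} \<subseteq> T"
    "measure lebesgue T \<le> 30 * stolz_const A * \<tau> / l"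
proof -
  have c0: "0 < stolz_const A" using A by (simp add: stolz_const_def)
  define t where "t = l / stolz_const A"
  have t: "0 < t" using l c0 by (simp add: t_def)
  define g where "g n x = (cmod (F (of_real (radius n) * cis x)))\<^sup>2" for n x
  define E where "E n = {\<theta> \<in> {0..2*pi}. \<exists>s. 0 < s \<and> s \<le> 2*pi \<and> t * s < (LINT x:{\<theta> - s..\<theta> + s}|lborel. g n x)}" for n
  have "\<exists>T. T \<in> lmeasurable \<and> E n \<subseteq> T \<and> measure lebesgue T \<le> 30 * stolz_const A * \<tau> / l" for n
  proof -
    have cF: "continuous_on UNIV (\<lambda>x. F (of_real (radius n) * cis x))"
      by (rule continuous_on_compose2[OF dilation_holomorphic(2)[OF F radius_pos radius_less]]) (auto intro!: continuous_intros)
    have cg: "continuous_on UNIV (g n)" unfolding g_def using cF by (intro continuous_intros)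
    have int: "set_integrable lborel {0 - 2*pi..2*pi + 2*pi} (g n)"
      by (rule borel_integrable_atLeastAtMost'[OF continuous_on_subset[OF cg]]) auto
    have nn: "0 \<le> g n x" for x by (simp add: g_def)
    obtain T where T: "T \<in> lmeasurable" "E n \<subseteq> T"
       "measure lebesgue T \<le> 10 / t * (LINT x:{0 - 2*pi..2*pi + 2*pi}|lborel. g n x)"
      by (rule weak_type_maximal[OF nn t int, folded E_def]) (rule that; assumption)
    have "(LINT x:{0 - 2*pi..2*pi + 2*pi}|lborel. g n x) \<le> 3 * (LINT x|circ. g n x)"
      by (rule periodic_three_periods[OF cg]) (auto simp: g_def simp flip: cis_mult)
    also have "\<dots> \<le> 3 * \<tau>" unfolding g_def using L2[OF radius_pos radius_less] by (intro mult_left_mono) auto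
    finally have "10 / t * (LINT x:{0 - 2*pi..2*pi + 2*pi}|lborel. g n x) \<le> 10 / t * (3 * \<tau>)"
      using t by (intro mult_left_mono) auto
    also have "\<dots> = 30 * stolz_const A * \<tau> / l" using c0 l by (simp add: t_def)
    finally show ?thesis using T by force
  qed
  then obtain T where T: "\<And>n. T n \<in> lmeasurable" "\<And>n. E n \<subseteq> T n" "\<And>n. measure lebesgue (T n) \<le> 30 * stolz_const A * \<tau> / l"
    by metis
  \<comment> \<open>A point of the set for \<open>F\<close> is exceptional for all dilations of \<open>F\<close> with radius close to \<open>1\<close>.\<close>
  define S where "S m = (\<Inter>n\<in>{m..}. T n)" for m
  have Sm: "S m \<in> lmeasurable" for m
    unfolding S_def by (rule fmeasurable_INT[of _ m]) (use T in \<open>auto intro: fmeasurableD\<close>)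
  have Sle: "measure lebesgue (S m) \<le> 30 * stolz_const A * \<tau> / l" for m
  proof -
    have "measure lebesgue (S m) \<le> measure lebesgue (T m)"
      using Sm T by (intro measure_mono_fmeasurable) (auto simp: S_def intro: fmeasurableD)
    then show ?thesis using T(3)[of m] by simp
  qed
  have SU: "(\<Union>i\<le>m. S i) = S m" for m unfolding S_def by fastforce
  have "(\<Union>m. S m) \<in> lmeasurable" "measure lebesgue (\<Union>m. S m) \<le> 30 * stolz_const A * \<tau> / l"
    using fmeasurable_countable_Union[of S lebesgue, OF Sm, unfolded SU, OF Sle]
      measure_countable_Union_le[of S lebesgue, OF Sm, unfolded SU, OF Sle] by auto
  moreover have "{\<theta> \<in> {0..2*pi}. \<exists>z\<in>Stolz A (cis \<theta>). l < (cmod (F z))\<^sup>2} \<subseteq> (\<Union>m. S m)"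
  proof
    fix \<theta> assume "\<theta> \<in> {\<theta> \<in> {0..2*pi}. \<exists>z\<in>Stolz A (cis \<theta>). l < (cmod (F z))\<^sup>2}"
    then obtain z where \<theta>: "\<theta> \<in> {0..2*pi}" and z: "z \<in> Stolz A (cis \<theta>)" "l < (cmod (F z))\<^sup>2" by auto
    have zd: "z \<in> unit_disk" using z by (auto simp: Stolz_def)
    have "(\<lambda>n. (cmod (F (of_real (radius n) * z)))\<^sup>2) \<longlonglongrightarrow> (cmod (F z))\<^sup>2"
      by (intro tendsto_intros dilation_tendsto[OF F zd radius_tendsto])
    then have "\<forall>\<^sub>F n in sequentially. l < (cmod (F (of_real (radius n) * z)))\<^sup>2"
      using z(2) by (rule order_tendstoD)
    then obtain m where m: "\<And>n. n \<ge> m \<Longrightarrow> l < (cmod (F (of_real (radius n) * z)))\<^sup>2"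
      unfolding eventually_sequentially by auto
    have "\<theta> \<in> E n" if "n \<ge> m" for n
    proof (rule ccontr)
      assume "\<theta> \<notin> E n"
      then have "(LINT x:{\<theta> - s..\<theta> + s}|lborel. g n x) \<le> t * s" if "0 < s" "s \<le> 2*pi" for s
        using \<theta> that unfolding E_def by force
      then have "(cmod (F (of_real (radius n) * z)))\<^sup>2 \<le> stolz_const A * t"
        unfolding g_def by (intro nontangential_le_averages[OF F radius_pos radius_less A z(1)])
      then show False using m[OF that] c0 by (simp add: t_def)
    qed
    then have "\<theta> \<in> S m" unfolding S_def using T(2) by auto
    then show "\<theta> \<in> (\<Union>m. S m)" by blast
  qed
  ultimately show ?thesis using that by blast
qed

section \<open>Fatou's theorem for bounded holomorphic functions\<close>

lemma circ_integral_cis_Suc: "(LINT t|circ. cis (real (Suc k) * t)) = 0"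
proof -
  have "0 = 1 / (2*pi) * (LINT t|circ. complex_of_real (poisson 0 t) * (cis t) ^ Suc k)"
    by (subst poisson_formula[of "\<lambda>z. z ^ Suc k" 0, symmetric])
      (auto intro!: continuous_intros holomorphic_intros)
  then show ?thesis by (simp add: poisson_def Complex.DeMoivre del: power_Suc)
qed

text \<open>Parseval's identity for finite sums. In the induction the cross term is a combination of
  \<open>cis (j t)\<close> with \<open>j > 0\<close>, which integrate to \<open>0\<close>.\<close>

lemma circ_integral_trig_polynomial:
  fixes b :: "nat \<Rightarrow> complex"
  shows "(LINT t|circ. (cmod (\<Sum>n<N. b n * cis (real n * t)))\<^sup>2) = 2*pi * (\<Sum>n<N. (cmod (b n))\<^sup>2)"
proof (induction N)
  case (Suc N)
  define p where "p t = (\<Sum>n<N. b n * cis (real n * t))" for t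
  define c where "c t = b N * cis (real N * t) * cnj (p t)" for t
  have contp: "continuous_on {0..2*pi} p" unfolding p_def by (intro continuous_intros)
  have contc: "continuous_on {0..2*pi} c" unfolding c_def using contp by (intro continuous_intros)
  have "c t = (\<Sum>n<N. b N * cnj (b n) * cis (real (Suc (N - n - 1)) * t))" for t
  proof -
    have "cis (real N * t) * cnj (cis (real n * t)) = cis (real (Suc (N - n - 1)) * t)" if "n < N" for n
    proof -
      have "real (Suc (N - n - 1)) = real N - real n" using that by (simp add: of_nat_diff)
      then show ?thesis by (simp add: cis_cnj cis_mult algebra_simps)
    qed
    then show ?thesis unfolding c_def p_def cnj_sum sum_distrib_left
      by (intro sum.cong) (auto simp: mult_ac)
  qed
  note ceq = this
  have ic: "integrable circ (\<lambda>t. b N * cnj (b n) * cis (real (Suc (N - n - 1)) * t))" for n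
    by (intro circ_continuous_integrable continuous_intros)
  have "(LINT t|circ. c t) = (\<Sum>n<N. b N * cnj (b n) * (LINT t|circ. cis (real (Suc (N - n - 1)) * t)))"
    unfolding ceq by (simp only: Bochner_Integration.integral_sum[OF ic] integral_mult_right_zero)
  then have int0: "(LINT t|circ. c t) = 0" by (simp only: circ_integral_cis_Suc) simp
  have "(cmod (p t + b N * cis (real N * t)))\<^sup>2 = (cmod (p t))\<^sup>2 + (cmod (b N))\<^sup>2 + 2 * Re (c t)" for t
  proof -
    have "(cmod (p t + b N * cis (real N * t)))\<^sup>2 = (cmod (p t))\<^sup>2 + (cmod (b N * cis (real N * t)))\<^sup>2 + 2 * Re (c t)"
    proof -
      have "(cmod (u + w))\<^sup>2 = (cmod u)\<^sup>2 + (cmod w)\<^sup>2 + 2 * Re (w * cnj u)" for u w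
        unfolding cmod_power2 by (simp add: power2_eq_square algebra_simps)
      then show ?thesis by (simp only: c_def)
    qed
    then show ?thesis by (simp add: norm_mult)
  qed
  then have "(LINT t|circ. (cmod (\<Sum>n<Suc N. b n * cis (real n * t)))\<^sup>2) =
       (LINT t|circ. (cmod (p t))\<^sup>2 + (cmod (b N))\<^sup>2 + 2 * Re (c t))" by (simp add: p_def)
  also have "\<dots> = (LINT t|circ. (cmod (p t))\<^sup>2) + (LINT t|circ. (cmod (b N))\<^sup>2) + 2 * (LINT t|circ. Re (c t))"
  proof -
    have i1: "integrable circ (\<lambda>t. (cmod (p t))\<^sup>2)" "integrable circ (\<lambda>t. (cmod (b N))\<^sup>2)" "integrable circ (\<lambda>t. Re (c t))"
      by (intro circ_continuous_integrable continuous_intros contp contc)+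
    show ?thesis using i1 by (subst Bochner_Integration.integral_add) (auto intro!: Bochner_Integration.integrable_add simp del: integral_const)
  qed
  also have "(LINT t|circ. Re (c t)) = 0"
    using integral_Re[OF circ_continuous_integrable[OF contc]] int0 by simp
  also have "(LINT t|circ. (cmod (b N))\<^sup>2) = 2*pi * (cmod (b N))\<^sup>2" by (simp only: circ_integral_const) simp
  finally show ?case using Suc unfolding p_def by (simp add: algebra_simps)
qed simp

text \<open>A Taylor polynomial approximates \<open>f\<close> in square mean, uniformly over all circles: the Taylor
  coefficients are square summable by Bessel's inequality, and the error on every circle is at most
  the tail of that series.\<close>

lemma bounded_holomorphic_L2_tail:
  assumes f: "f holomorphic_on unit_disk" and f1: "\<And>z. z \<in> unit_disk \<Longrightarrow> cmod (f z) \<le> 1" and e: "0 < e"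
  obtains p :: "complex \<Rightarrow> complex" where "p holomorphic_on UNIV"
    "\<And>r. 0 < r \<Longrightarrow> r < 1 \<Longrightarrow> (LINT t|circ. (cmod (f (of_real r * cis t) - p (of_real r * cis t)))\<^sup>2) \<le> e"
proof -
  define a where "a n = (deriv ^^ n) f 0 / fact n" for n
  let ?R = "\<lambda>N r t. (cmod (f (of_real r * cis t) - (\<Sum>n<N. a n * (of_real r * cis t)^n)))\<^sup>2"
  let ?P = "\<lambda>N M r. \<Sum>n=N..<M. (cmod (a n))\<^sup>2 * (r\<^sup>2) ^ n"
  have S: "(\<lambda>n. a n * z ^ n) sums f z" if "z \<in> unit_disk" for z
    using holomorphic_power_series[OF f that] by (simp add: a_def)
  have summ: "summable (\<lambda>n. cmod (a n) * r ^ n)" if "0 < r" "r < 1" for r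
  proof -
    have nrm: "norm (complex_of_real ((1 + r)/2)) = (1 + r)/2"
      unfolding norm_of_real using that by simp
    have "summable (\<lambda>n. a n * (of_real ((1 + r)/2)) ^ n)"
      by (rule sums_summable[OF S]) (use that nrm in \<open>simp only: mem_ball dist_0_norm, simp\<close>)
    then have "summable (\<lambda>n. cmod (a n * of_real r ^ n))"
      by (rule powser_insidea) (unfold nrm norm_of_real, use that in simp)
    then show ?thesis using that by (simp add: norm_mult norm_power)
  qed
  have lim: "(\<lambda>M. 2*pi * ?P N M r) \<longlonglongrightarrow>
       (LINT t|circ. ?R N r t)"
    if r: "0 < r" "r < 1" for r N
  proof -
    define s where "s M t = (\<Sum>n=N..<M. a n * (of_real r * cis t)^n)" for M t
    define D where "D = (\<Sum>n. cmod (a n) * r ^ n)"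
    have sD: "cmod (s M t) \<le> D" for M t
    proof -
      have "cmod (s M t) \<le> (\<Sum>n=N..<M. cmod (a n) * r ^ n)" unfolding s_def
        by (rule sum_norm_le) (use r in \<open>simp add: norm_mult norm_power\<close>)
      also have "\<dots> \<le> D" unfolding D_def by (rule sum_le_suminf[OF summ[OF r]]) (use r in auto)
      finally show ?thesis .
    qed
    have "(\<lambda>M. LINT t|circ. (cmod (s M t))\<^sup>2) \<longlonglongrightarrow>
       (LINT t|circ. ?R N r t)"
    proof (rule integral_dominated_convergence[where w = "\<lambda>_. D\<^sup>2"])
      show "(\<lambda>t. (cmod (s M t))\<^sup>2) \<in> borel_measurable circ" for M
        unfolding s_def by (intro circ_continuous_measurable continuous_intros)
      have "continuous_on {0..2*pi} (\<lambda>t. f (of_real r * cis t))"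
        by (rule continuous_on_compose2[OF dilation_holomorphic(2)[OF f r]]) (auto intro!: continuous_intros)
      then show "(\<lambda>t. ?R N r t) \<in> borel_measurable circ"
        by (intro circ_continuous_measurable continuous_intros)
      show "integrable circ (\<lambda>_. D\<^sup>2)" by (intro circ_continuous_integrable continuous_intros)
      show "AE t in circ. norm ((cmod (s M t))\<^sup>2) \<le> D\<^sup>2" for M
        using sD by (intro AE_I2) (auto intro!: power_mono)
      show "AE t in circ. (\<lambda>M. (cmod (s M t))\<^sup>2) \<longlonglongrightarrow> ?R N r t"
      proof (intro AE_I2 tendsto_intros)
        fix t
        have "(\<lambda>M. \<Sum>n<M. a n * (of_real r * cis t)^n) \<longlonglongrightarrow> f (of_real r * cis t)"
          using S[of "of_real r * cis t"] r by (simp add: sums_def norm_mult)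
        then have "(\<lambda>M. (\<Sum>n<M. a n * (of_real r * cis t)^n) - (\<Sum>n<N. a n * (of_real r * cis t)^n)) \<longlonglongrightarrow>
            f (of_real r * cis t) - (\<Sum>n<N. a n * (of_real r * cis t)^n)" by (intro tendsto_intros)
        moreover have "\<forall>\<^sub>F M in sequentially. (\<Sum>n<M. a n * (of_real r * cis t)^n) - (\<Sum>n<N. a n * (of_real r * cis t)^n) = s M t"
          unfolding eventually_sequentially
        proof (intro exI[of _ N] allI impI)
          fix M assume "N \<le> M"
          then show "(\<Sum>n<M. a n * (of_real r * cis t)^n) - (\<Sum>n<N. a n * (of_real r * cis t)^n) = s M t"
            unfolding s_def using sum_diff_nat_ivl[of 0 N M "\<lambda>n. a n * (of_real r * cis t)^n"] by (simp add: atLeast0LessThan)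
        qed
        ultimately show "(\<lambda>M. s M t) \<longlonglongrightarrow> f (of_real r * cis t) - (\<Sum>n<N. a n * (of_real r * cis t)^n)"
          by (rule Lim_transform_eventually)
      qed
    qed
    moreover have "(LINT t|circ. (cmod (s M t))\<^sup>2) = 2*pi * ?P N M r" for M
    proof -
      define b where "b n = (if N \<le> n then a n * of_real r ^ n else 0)" for n
      have "s M t = (\<Sum>n<M. b n * cis (real n * t))" for t
      proof -
        have "s M t = (\<Sum>n=N..<M. b n * cis (real n * t))" unfolding s_def
          by (rule sum.cong) (auto simp: b_def power_mult_distrib Complex.DeMoivre)
        also have "\<dots> = (\<Sum>n<M. b n * cis (real n * t))"
          by (rule sum.mono_neutral_left) (auto simp: b_def)
        finally show ?thesis .
      qed
      then have "(LINT t|circ. (cmod (s M t))\<^sup>2) = 2*pi * (\<Sum>n<M. (cmod (b n))\<^sup>2)"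
        by (simp add: circ_integral_trig_polynomial)
      also have "(\<Sum>n<M. (cmod (b n))\<^sup>2) = (\<Sum>n=N..<M. (cmod (b n))\<^sup>2)"
        by (rule sum.mono_neutral_right) (auto simp: b_def)
      also have "\<dots> = ?P N M r"
        using r by (intro sum.cong) (auto simp: b_def norm_mult norm_power power_mult_distrib power_mult[symmetric] mult.commute)
      finally show ?thesis .
    qed
    ultimately show ?thesis by simp
  qed
  \<comment> \<open>Bessel's inequality: the case \<open>N = 0\<close> of the limit above bounds the coefficients by \<open>|f| \<le> 1\<close>.\<close>
  have "(\<Sum>n<M. (cmod (a n))\<^sup>2) \<le> 1" for M
  proof -
    have le: "(\<Sum>n<M. (cmod (a n))\<^sup>2 * (r\<^sup>2) ^ n) \<le> 1" if r: "0 < r" "r < 1" for r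
    proof -
      have "2*pi * ?P 0 M r \<le> (LINT t|circ. ?R 0 r t)"
        by (rule incseq_le[OF _ lim[OF r]]) (auto intro!: incseq_SucI mult_left_mono simp: field_simps)
      also have "\<dots> \<le> (LINT t|circ. 1)"
      proof (rule integral_mono)
        have "continuous_on {0..2*pi} (\<lambda>t. f (of_real r * cis t))"
          by (rule continuous_on_compose2[OF dilation_holomorphic(2)[OF f r]]) (auto intro!: continuous_intros)
        then show "integrable circ (\<lambda>t. ?R 0 r t)"
          by (intro circ_continuous_integrable continuous_intros)
        show "integrable circ (\<lambda>_. 1::real)" by (intro circ_continuous_integrable continuous_intros)
        show "?R 0 r t \<le> 1" for t
          using f1[of "of_real r * cis t"] r by (simp add: norm_mult power_le_one)
      qed
      also have "\<dots> = 2*pi * 1" by (simp only: circ_integral_const) simp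
      finally show ?thesis by (simp add: atLeast0LessThan)
    qed
    have "(\<lambda>k. \<Sum>n<M. (cmod (a n))\<^sup>2 * ((radius k)\<^sup>2) ^ n) \<longlonglongrightarrow> (\<Sum>n<M. (cmod (a n))\<^sup>2 * (1\<^sup>2) ^ n)"
      by (intro tendsto_intros radius_tendsto)
    then have "(\<Sum>n<M. (cmod (a n))\<^sup>2 * (1\<^sup>2) ^ n) \<le> 1"
      by (rule LIMSEQ_le_const2) (use le radius_pos radius_less in auto)
    then show ?thesis by simp
  qed
  then have sa: "summable (\<lambda>n. (cmod (a n))\<^sup>2)"
    by (intro summableI_nonneg_bounded) auto
  have "(\<lambda>N. \<Sum>n<N. (cmod (a n))\<^sup>2) \<longlonglongrightarrow> (\<Sum>n. (cmod (a n))\<^sup>2)" by (rule summable_LIMSEQ[OF sa])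
  moreover have "(\<Sum>n. (cmod (a n))\<^sup>2) - e / (2*pi) < (\<Sum>n. (cmod (a n))\<^sup>2)" using e by simp
  ultimately have "\<forall>\<^sub>F N in sequentially. (\<Sum>n. (cmod (a n))\<^sup>2) - e / (2*pi) < (\<Sum>n<N. (cmod (a n))\<^sup>2)"
    by (rule order_tendstoD)
  then obtain N where N: "(\<Sum>n. (cmod (a n))\<^sup>2) - e / (2*pi) < (\<Sum>n<N. (cmod (a n))\<^sup>2)"
    unfolding eventually_sequentially by auto
  show ?thesis
  proof (rule that[of "\<lambda>z. \<Sum>n<N. a n * z ^ n"])
    show "(\<lambda>z. \<Sum>n<N. a n * z ^ n) holomorphic_on UNIV" by (intro holomorphic_intros)
    fix r :: real assume r: "0 < r" "r < 1"
    have "2*pi * ?P N M r \<le> e" for M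
    proof (cases "N \<le> M")
      case True
      have "?P N M r \<le> (\<Sum>n=N..<M. (cmod (a n))\<^sup>2 * 1)"
        using r by (intro sum_mono mult_left_mono power_le_one) (auto simp: power_le_one)
      also have "\<dots> = (\<Sum>n<M. (cmod (a n))\<^sup>2) - (\<Sum>n<N. (cmod (a n))\<^sup>2)"
        using True sum_diff_nat_ivl[of 0 N M "\<lambda>n. (cmod (a n))\<^sup>2"] by (simp add: atLeast0LessThan)
      also have "\<dots> \<le> e / (2*pi)"
        using N sum_le_suminf[OF sa, of "{..<M}"] by simp
      finally show ?thesis by (simp add: field_simps)
    qed (use e in auto)
    then show "(LINT t|circ. ?R N r t) \<le> e"
      by (intro LIMSEQ_le_const2[OF lim[OF r]]) auto
  qed
qed

lemma Stolz_mono: "A \<le> B \<Longrightarrow> Stolz A \<zeta> \<subseteq> Stolz B \<zeta>"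
  unfolding Stolz_def by (auto intro: order_trans[OF _ mult_right_mono])

lemma radial_in_Stolz:
  assumes "A > 1" "0 < r" "r < 1" shows "of_real r * cis \<theta> \<in> Stolz A (cis \<theta>)"
proof -
  have "cmod (of_real r * cis \<theta> - cis \<theta>) = 1 - r" using assms by (simp add: cmod_radial_diff)
  moreover have "1 * (1 - r) \<le> A * (1 - r)" using assms by (intro mult_right_mono) auto
  ultimately show ?thesis using assms by (simp add: Stolz_def norm_mult)
qed

lemma radial_tendsto:
  assumes "\<rho> \<longlonglongrightarrow> (1::real)" shows "(\<lambda>n. of_real (\<rho> n) * cis \<theta>) \<longlonglongrightarrow> cis \<theta>"
  using tendsto_mult_right[OF tendsto_of_real[OF assms], of "cis \<theta>"] by simp

lemma nt_limit_sequence: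
  assumes "has_nontangential_limit f \<zeta> l" "A > 1" "\<And>n. s n \<in> Stolz A \<zeta>" "s \<longlonglongrightarrow> \<zeta>" "cmod \<zeta> = 1"
  shows "(\<lambda>n. f (s n)) \<longlonglongrightarrow> l"
proof -
  have "s n \<noteq> \<zeta>" for n using assms(3)[of n] assms(5) by (auto simp: Stolz_def)
  moreover have "(f \<longlongrightarrow> l) (at \<zeta> within Stolz A \<zeta>)" using assms by (simp add: has_nontangential_limit_def)
  ultimately show ?thesis using assms(3,4) unfolding tendsto_at_iff_sequentially comp_def by blast
qed

lemma nt_limit_radial:
  assumes "has_nontangential_limit f (cis \<theta>) l" "\<And>n. 0 < \<rho> n" "\<And>n. \<rho> n < 1" "\<rho> \<longlonglongrightarrow> 1"
  shows "(\<lambda>n. f (of_real (\<rho> n) * cis \<theta>)) \<longlonglongrightarrow> l"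
  by (rule nt_limit_sequence[OF assms(1), of 2]) (use assms radial_in_Stolz radial_tendsto in auto)

lemma boundary_fun_eq:
  assumes "has_nontangential_limit f (cis \<theta>) l" shows "boundary_fun f (cis \<theta>) = l"
  unfolding boundary_fun_def
proof (rule the_equality[where P = "has_nontangential_limit f (cis \<theta>)", OF assms])
  fix l' assume "has_nontangential_limit f (cis \<theta>) l'"
  then show "l' = l"
    using nt_limit_radial[OF assms radius_pos radius_less radius_tendsto]
      nt_limit_radial[OF _ radius_pos radius_less radius_tendsto] LIMSEQ_unique by blast
qed

lemma AE_circI:
  assumes "negligible {\<theta> \<in> {0..2*pi}. \<not> P \<theta>}" shows "AE \<theta> in circ. P \<theta>"
proof -
  have "AE \<theta> in lebesgue. \<theta> \<in> {0..2*pi} \<longrightarrow> P \<theta>"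
    by (rule AE_I'[OF assms[unfolded negligible_iff_null_sets]]) auto
  then show ?thesis by (subst AE_restrict_space_iff) auto
qed

text \<open>Subtracting a polynomial, which is continuous, does not change the boundary oscillation, and the
  remainder is small in square mean. The weak-type inequality therefore covers the points of large
  oscillation by sets of arbitrarily small measure.\<close>

lemma bounded_oscillation_negligible:
  assumes f: "f holomorphic_on unit_disk" and f1: "\<And>z. z \<in> unit_disk \<Longrightarrow> cmod (f z) \<le> 1"
    and A: "A > 1" and e: "0 < \<epsilon>"
  shows "negligible {\<theta> \<in> {0..2*pi}. \<not> (\<exists>d>0. \<forall>z\<in>Stolz A (cis \<theta>). \<forall>w\<in>Stolz A (cis \<theta>).
      dist z (cis \<theta>) < d \<longrightarrow> dist w (cis \<theta>) < d \<longrightarrow> dist (f z) (f w) \<le> \<epsilon>)}" (is "negligible ?B")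
  unfolding negligible_outer_le
proof (intro allI impI)
  fix \<eta> :: real assume \<eta>: "0 < \<eta>"
  have c0: "0 < stolz_const A" using A by (simp add: stolz_const_def)
  \<comment> \<open>Chosen so that the weak-type bound at level \<open>(\<epsilon>/4)\<^sup>2\<close> is exactly \<open>\<eta>\<close>.\<close>
  define \<tau> where "\<tau> = \<eta> * (\<epsilon>/4)\<^sup>2 / (30 * stolz_const A)"
  have \<tau>: "0 < \<tau>" using \<eta> c0 e by (simp add: \<tau>_def)
  obtain p where p: "p holomorphic_on UNIV"
    "\<And>r. 0 < r \<Longrightarrow> r < 1 \<Longrightarrow> (LINT t|circ. (cmod (f (of_real r * cis t) - p (of_real r * cis t)))\<^sup>2) \<le> \<tau>"
    using bounded_holomorphic_L2_tail[OF f f1 \<tau>] by blast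
  have F: "(\<lambda>z. f z - p z) holomorphic_on unit_disk" using f holomorphic_on_subset[OF p(1)] by (intro holomorphic_intros) auto
  have l: "0 < (\<epsilon>/4)\<^sup>2" using e by simp
  obtain T where T: "T \<in> lmeasurable"
    "{\<theta> \<in> {0..2*pi}. \<exists>z\<in>Stolz A (cis \<theta>). (\<epsilon>/4)\<^sup>2 < (cmod (f z - p z))\<^sup>2} \<subseteq> T"
    "measure lebesgue T \<le> 30 * stolz_const A * \<tau> / (\<epsilon>/4)\<^sup>2"
    by (rule nontangential_weak_type[OF F A l p(2)]) (assumption | rule that)+
  have "30 * stolz_const A * \<tau> / (\<epsilon>/4)\<^sup>2 = \<eta>" using c0 l unfolding \<tau>_def by simp
  moreover have "?B \<subseteq> T"
  proof
    fix \<theta> assume \<theta>: "\<theta> \<in> ?B"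
    have "\<exists>z\<in>Stolz A (cis \<theta>). (\<epsilon>/4)\<^sup>2 < (cmod (f z - p z))\<^sup>2"
    proof (rule ccontr)
      assume "\<not> ?thesis"
      then have sm: "dist (f z) (p z) \<le> \<epsilon>/4" if "z \<in> Stolz A (cis \<theta>)" for z
        using that e power2_le_imp_le[of "cmod (f z - p z)" "\<epsilon>/4"] by (force simp: dist_norm not_less)
      have "isCont p (cis \<theta>)" using p(1) by (metis holomorphic_on_imp_continuous_on continuous_on_eq_continuous_at open_UNIV UNIV_I)
      then obtain d where d: "d > 0" "\<And>z. dist z (cis \<theta>) < d \<Longrightarrow> dist (p z) (p (cis \<theta>)) < \<epsilon>/4"
        unfolding continuous_at_eps_delta using e by (metis zero_less_divide_iff zero_less_numeral)
      have "dist (f z) (f w) \<le> \<epsilon>" if "z \<in> Stolz A (cis \<theta>)" "w \<in> Stolz A (cis \<theta>)" "dist z (cis \<theta>) < d" "dist w (cis \<theta>) < d" for z w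
        using sm[OF that(1)] sm[OF that(2)] d(2)[OF that(3)] d(2)[OF that(4)]
          dist_triangle[of "f z" "f w" "p z"] dist_triangle[of "p z" "f w" "p w"] dist_triangle[of "p z" "p w" "p (cis \<theta>)"]
        by (simp add: dist_commute)
      then show False using \<theta> d(1) by blast
    qed
    then show "\<theta> \<in> T" using T(2) \<theta> by blast
  qed
  ultimately show "\<exists>T. ?B \<subseteq> T \<and> T \<in> lmeasurable \<and> measure lebesgue T \<le> \<eta>" using T by auto
qed

text \<open>Fatou's theorem. Outside a countable union of null sets the oscillation of \<open>f\<close> in every Stolz
  angle tends to \<open>0\<close>, so the radial values form a Cauchy sequence and their limit is the
  nontangential limit.\<close>

theorem fatou_bounded:
  assumes f: "f holomorphic_on unit_disk" and f1: "\<And>z. z \<in> unit_disk \<Longrightarrow> cmod (f z) \<le> 1"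
  shows "AE \<theta> in circ. \<exists>l. has_nontangential_limit f (cis \<theta>) l"
proof (rule AE_circI)
  define osc where "osc A \<epsilon> \<theta> \<longleftrightarrow> (\<exists>d>0. \<forall>z\<in>Stolz A (cis \<theta>). \<forall>w\<in>Stolz A (cis \<theta>).
      dist z (cis \<theta>) < d \<longrightarrow> dist w (cis \<theta>) < d \<longrightarrow> dist (f z) (f w) \<le> \<epsilon>)" for A \<epsilon> \<theta>
  have neg: "negligible (\<Union>m::nat. \<Union>k::nat. {\<theta> \<in> {0..2*pi}. \<not> osc (real m + 2) (1 / (real k + 1)) \<theta>})"
    unfolding osc_def by (intro negligible_Union_nat bounded_oscillation_negligible[OF f f1]) auto
  show "negligible {\<theta> \<in> {0..2*pi}. \<not> (\<exists>l. has_nontangential_limit f (cis \<theta>) l)}"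
  proof (rule negligible_subset[OF neg], rule subsetI, rule ccontr)
    fix \<theta> assume \<theta>: "\<theta> \<in> {\<theta> \<in> {0..2*pi}. \<not> (\<exists>l. has_nontangential_limit f (cis \<theta>) l)}"
      and "\<theta> \<notin> (\<Union>m::nat. \<Union>k::nat. {\<theta> \<in> {0..2*pi}. \<not> osc (real m + 2) (1 / (real k + 1)) \<theta>})"
    then have osc: "osc (real m + 2) (1 / (real k + 1)) \<theta>" for m k :: nat by auto
    have osc': "\<exists>d>0. \<forall>z\<in>Stolz A (cis \<theta>). \<forall>w\<in>Stolz A (cis \<theta>).
      dist z (cis \<theta>) < d \<longrightarrow> dist w (cis \<theta>) < d \<longrightarrow> dist (f z) (f w) < \<epsilon>" if eps: "\<epsilon> > 0" for A \<epsilon>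
    proof -
      obtain m :: nat where "A < real m" using reals_Archimedean2 by blast
      then have sub: "Stolz A (cis \<theta>) \<subseteq> Stolz (real m + 2) (cis \<theta>)" by (intro Stolz_mono) simp
      obtain k :: nat where "1 / (real k + 1) < \<epsilon>" using nat_approx_posE[OF eps] by (metis of_nat_Suc add.commute)
      then show ?thesis using osc[of m k] sub unfolding osc_def by (meson le_less_trans subsetD)
    qed
    let ?x = "\<lambda>n. of_real (radius n) * cis \<theta>"
    have xt: "?x \<longlonglongrightarrow> cis \<theta>" by (rule radial_tendsto[OF radius_tendsto])
    have near: "\<exists>N. \<forall>n\<ge>N. dist (?x n) (cis \<theta>) < d" if "d > 0" for d
      using metric_LIMSEQ_D[OF xt that] .
    have xS: "?x n \<in> Stolz A (cis \<theta>)" if "A > 1" for n A by (rule radial_in_Stolz[OF that radius_pos radius_less])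
    have "Cauchy (\<lambda>n. f (?x n))"
    proof (rule metric_CauchyI)
      fix \<epsilon> :: real assume "\<epsilon> > 0"
      then obtain d where d: "d > 0" "\<And>z w. z\<in>Stolz 2 (cis \<theta>) \<Longrightarrow> w\<in>Stolz 2 (cis \<theta>) \<Longrightarrow>
          dist z (cis \<theta>) < d \<Longrightarrow> dist w (cis \<theta>) < d \<Longrightarrow> dist (f z) (f w) < \<epsilon>"
        using osc'[of \<epsilon> 2] by blast
      obtain N where "\<forall>n\<ge>N. dist (?x n) (cis \<theta>) < d" using near[OF d(1)] by blast
      then show "\<exists>M. \<forall>m\<ge>M. \<forall>n\<ge>M. dist (f (?x m)) (f (?x n)) < \<epsilon>"
        using d(2) xS[of 2] by (intro exI[of _ N]) auto
    qed
    then obtain l where l: "(\<lambda>n. f (?x n)) \<longlonglongrightarrow> l" using Cauchy_convergent convergent_def by blast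
    have "has_nontangential_limit f (cis \<theta>) l"
      unfolding has_nontangential_limit_def
    proof (intro allI impI)
      fix A :: real assume A: "A > 1"
      show "(f \<longlongrightarrow> l) (at (cis \<theta>) within Stolz A (cis \<theta>))"
        unfolding Lim_within
      proof (intro allI impI)
        fix \<epsilon> :: real assume \<epsilon>: "\<epsilon> > 0"
        then obtain d where d: "d > 0" "\<And>z w. z\<in>Stolz A (cis \<theta>) \<Longrightarrow> w\<in>Stolz A (cis \<theta>) \<Longrightarrow>
          dist z (cis \<theta>) < d \<Longrightarrow> dist w (cis \<theta>) < d \<Longrightarrow> dist (f z) (f w) < \<epsilon>/2"
          using osc'[of "\<epsilon>/2" A] by (metis half_gt_zero)
        obtain N where N: "\<And>n. n\<ge>N \<Longrightarrow> dist (?x n) (cis \<theta>) < d" using near[OF d(1)] by blast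
        obtain M where M: "\<And>n. n\<ge>M \<Longrightarrow> dist (f (?x n)) l < \<epsilon>/2" using metric_LIMSEQ_D[OF l, of "\<epsilon>/2"] \<epsilon> by auto
        define n where "n = max M N"
        have "dist (f z) l < \<epsilon>" if "z \<in> Stolz A (cis \<theta>)" "dist z (cis \<theta>) < d" for z
        proof -
          have "dist (f z) (f (?x n)) < \<epsilon>/2" by (rule d(2)) (use that xS[OF A] N in \<open>auto simp: n_def\<close>)
          moreover have "dist (f (?x n)) l < \<epsilon>/2" by (rule M) (simp add: n_def)
          ultimately show ?thesis using dist_triangle[of "f z" l "f (?x n)"] by simp
        qed
        then show "\<exists>d>0. \<forall>x\<in>Stolz A (cis \<theta>). 0 < dist x (cis \<theta>) \<and> dist x (cis \<theta>) < d \<longrightarrow> dist (f x) l < \<epsilon>"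
          using d(1) by blast
      qed
    qed
    then show False using \<theta> by blast
  qed
qed

section \<open>Harmonic majorants and the Nevanlinna class\<close>

text \<open>The mean of \<open>Re H\<close> over every circle about \<open>0\<close> equals \<open>Re (H 0)\<close>. By Fatou's lemma its lower
  radial limit is finite almost everywhere, which excludes a vanishing boundary value of \<open>exp (-H)\<close>.\<close>

lemma exp_neg_boundary_nonzero:
  assumes H: "H holomorphic_on unit_disk" and pos: "\<And>z. z \<in> unit_disk \<Longrightarrow> 0 \<le> Re (H z)"
  shows "AE \<theta> in circ. \<exists>l. l \<noteq> 0 \<and> has_nontangential_limit (\<lambda>z. exp (- H z)) (cis \<theta>) l"
proof -
  define X where "X n \<theta> = ennreal (Re (H (of_real (radius n) * cis \<theta>)))" for n \<theta>
  have cX: "continuous_on {0..2*pi} (\<lambda>\<theta>. Re (H (of_real (radius n) * cis \<theta>)))" for n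
    by (intro continuous_intros dilated_circle_continuous[OF H radius_pos radius_less])
  have [measurable]: "X n \<in> borel_measurable circ" for n
    unfolding X_def using circ_continuous_measurable[OF cX] by measurable
  have int: "(\<integral>\<^sup>+ \<theta>. X n \<theta> \<partial>circ) = ennreal (2*pi * Re (H 0))" for n
  proof -
    have "(\<integral>\<^sup>+ \<theta>. X n \<theta> \<partial>circ) = ennreal (LINT \<theta>|circ. Re (H (of_real (radius n) * cis \<theta>)))"
      unfolding X_def using radius_pos[of n] radius_less[of n]
      by (intro nn_integral_eq_integral circ_continuous_integrable cX AE_I2 pos) (simp add: norm_mult)
    then show ?thesis using Re_mean_value[OF H radius_pos radius_less, of n] by simp
  qed
  have "(\<integral>\<^sup>+ \<theta>. liminf (\<lambda>n. X n \<theta>) \<partial>circ) \<le> liminf (\<lambda>n. \<integral>\<^sup>+ \<theta>. X n \<theta> \<partial>circ)"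
    by (rule nn_integral_liminf) measurable
  also have "\<dots> = ennreal (2*pi * Re (H 0))" unfolding int by (simp add: Liminf_const)
  finally have "(\<integral>\<^sup>+ \<theta>. liminf (\<lambda>n. X n \<theta>) \<partial>circ) < \<infinity>" by (rule le_less_trans) simp
  then have "(\<integral>\<^sup>+ \<theta>. liminf (\<lambda>n. X n \<theta>) \<partial>circ) \<noteq> \<infinity>" by simp
  then have 1: "AE \<theta> in circ. liminf (\<lambda>n. X n \<theta>) \<noteq> \<infinity>" by (intro nn_integral_PInf_AE) measurable
  have 2: "AE \<theta> in circ. \<exists>l. has_nontangential_limit (\<lambda>z. exp (- H z)) (cis \<theta>) l"
    by (rule fatou_bounded) (use H pos in \<open>auto intro!: holomorphic_intros\<close>)
  show ?thesis using 1 2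
  proof eventually_elim
    case (elim \<theta>)
    then obtain l where l: "has_nontangential_limit (\<lambda>z. exp (- H z)) (cis \<theta>) l" by blast
    \<comment> \<open>A vanishing limit means that \<open>Re H\<close> tends to infinity along the radius.\<close>
    have "l \<noteq> 0"
    proof
      assume "l = 0"
      then have "(\<lambda>n. exp (- H (of_real (radius n) * cis \<theta>))) \<longlonglongrightarrow> 0"
        using nt_limit_radial[OF l radius_pos radius_less radius_tendsto] by simp
      then have lim: "(\<lambda>n. exp (- Re (H (of_real (radius n) * cis \<theta>)))) \<longlonglongrightarrow> 0"
        using tendsto_norm_zero by fastforce
      have "ennreal K \<le> liminf (\<lambda>n. X n \<theta>)" for K :: real
      proof (rule Liminf_bounded)
        have "\<forall>\<^sub>F n in sequentially. exp (- Re (H (of_real (radius n) * cis \<theta>))) < exp (- K)"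
          by (rule order_tendstoD(2)[OF lim]) simp
        then show "\<forall>\<^sub>F n in sequentially. ennreal K \<le> X n \<theta>"
          by eventually_elim (auto simp: X_def intro!: ennreal_leI)
      qed
      then have "liminf (\<lambda>n. X n \<theta>) = \<infinity>"
        by (cases "liminf (\<lambda>n. X n \<theta>)") (auto, metis ennreal_le_iff gt_ex not_less)
      then show False using elim by simp
    qed
    then show ?case using l by blast
  qed
qed

text \<open>A harmonic majorant of \<open>log\<^sup>+ |f|\<close>, given through a holomorphic function of which it is the real
  part, so that the bounded function \<open>exp (-H)\<close> is at hand.\<close>

definition has_majorant :: "(complex \<Rightarrow> complex) \<Rightarrow> (complex \<Rightarrow> complex) \<Rightarrow> bool" where
  "has_majorant f H \<longleftrightarrow> H holomorphic_on unit_disk \<and>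
     (\<forall>z\<in>unit_disk. log_plus (cmod (f z)) \<le> Re (H z))"

lemma has_majorant_nonneg: "has_majorant f H \<Longrightarrow> z \<in> unit_disk \<Longrightarrow> 0 \<le> Re (H z)"
  unfolding has_majorant_def using log_plus_nonneg order_trans by blast

lemma has_majorant_bound:
  assumes "has_majorant f H" "z \<in> unit_disk" shows "cmod (f z * exp (- H z)) \<le> 1"
proof -
  have "cmod (f z) \<le> exp (Re (H z))"
    using assms unfolding log_plus_le_iff[OF has_majorant_nonneg[OF assms], symmetric]
    by (simp add: has_majorant_def)
  then have "cmod (f z) * exp (- Re (H z)) \<le> exp (Re (H z)) * exp (- Re (H z))" by (intro mult_right_mono) auto
  then show ?thesis by (simp add: norm_mult flip: exp_add)
qed

text \<open>The quotient of the bounded functions \<open>f exp (-H)\<close> and \<open>exp (-H)\<close> is \<open>f\<close>, and the boundary values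
  of the denominator vanish almost nowhere.\<close>

theorem majorant_nontangential_limits:
  assumes f: "f holomorphic_on unit_disk" and H: "has_majorant f H"
  shows "AE \<theta> in circ. has_nontangential_limit f (cis \<theta>) (boundary_fun f (cis \<theta>))"
proof -
  have hH: "H holomorphic_on unit_disk" using H by (simp add: has_majorant_def)
  have 1: "AE \<theta> in circ. \<exists>l. has_nontangential_limit (\<lambda>z. f z * exp (- H z)) (cis \<theta>) l"
    by (rule fatou_bounded) (use f hH has_majorant_bound[OF H] in \<open>auto intro!: holomorphic_intros\<close>)
  have 2: "AE \<theta> in circ. \<exists>l. l \<noteq> 0 \<and> has_nontangential_limit (\<lambda>z. exp (- H z)) (cis \<theta>) l"
    by (rule exp_neg_boundary_nonzero[OF hH has_majorant_nonneg[OF H]])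
  show ?thesis using 1 2
  proof eventually_elim
    case (elim \<theta>)
    then obtain l1 l2 where l: "has_nontangential_limit (\<lambda>z. f z * exp (- H z)) (cis \<theta>) l1"
      "l2 \<noteq> 0" "has_nontangential_limit (\<lambda>z. exp (- H z)) (cis \<theta>) l2" by blast
    have "has_nontangential_limit f (cis \<theta>) (l1 / l2)"
      unfolding has_nontangential_limit_def
    proof (intro allI impI)
      fix A :: real assume "1 < A"
      then have "((\<lambda>z. (f z * exp (- H z)) / exp (- H z)) \<longlongrightarrow> l1 / l2) (at (cis \<theta>) within Stolz A (cis \<theta>))"
        using l by (intro tendsto_divide) (auto simp: has_nontangential_limit_def)
      then show "(f \<longlongrightarrow> l1 / l2) (at (cis \<theta>) within Stolz A (cis \<theta>))" by simp
    qed
    then show ?case using boundary_fun_eq by metis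
  qed
qed

lemma log_plus_mean_circ:
  "log_plus_mean f r = 1 / (2*pi) * (LINT \<theta>|circ. log_plus (cmod (f (of_real r * cis \<theta>))))"
  unfolding log_plus_mean_def set_lebesgue_integral_def by (simp add: integral_restrict_space)

text \<open>On the disc of radius \<open>r\<close> the Herglotz transform \<open>G\<^sub>r\<close> of \<open>log\<^sup>+ |f|\<close> on its boundary provides a
  majorant. The functions \<open>exp (-G\<^sub>r)\<close> form a normal family, and their value at \<open>0\<close> stays away from
  \<open>0\<close> because the circle means are bounded. By Hurwitz's theorem a locally uniform limit has no
  zeros, and its logarithm gives the majorant.\<close>

theorem Nevanlinna_majorant:
  assumes "f \<in> Nevanlinna"
  obtains H where "has_majorant f H"
proof -
  have f: "f holomorphic_on unit_disk" using assms by (simp add: Nevanlinna_def)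
  obtain L where L: "(log_plus_mean f \<longlongrightarrow> L) (at_left 1)" using assms by (auto simp: Nevanlinna_def)
  define v where "v n t = log_plus (cmod (f (of_real (radius n) * cis t)))" for n t
  have vi: "integrable circ (v n)" for n unfolding v_def
    by (intro circ_continuous_integrable continuous_intros dilated_circle_continuous[OF f radius_pos radius_less])
  define B where "B n z = exp (- herglotz (v n) z)" for n z
  have Bh: "B n holomorphic_on unit_disk" for n
    unfolding B_def by (intro holomorphic_intros herglotz_holomorphic vi)
  have fB: "has_majorant (\<lambda>z. f (of_real (radius n) * z)) (herglotz (v n))" for n
    unfolding has_majorant_def v_def
    using log_plus_le_Re_herglotz[OF dilation_holomorphic(2,3)[OF f radius_pos radius_less, of n]] herglotz_holomorphic[OF vi, of n]
    by (auto simp: v_def[abs_def])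
  have B1: "cmod (B n z) \<le> 1" if "z \<in> unit_disk" for n z
    using has_majorant_nonneg[OF fB that] by (simp add: B_def)
  let ?\<H> = "{h. h holomorphic_on unit_disk \<and> (\<forall>z\<in>unit_disk. cmod (h z) \<le> 1)}"
  obtain g k where g: "g holomorphic_on unit_disk" and k: "strict_mono k"
    and lim: "\<And>z. z \<in> unit_disk \<Longrightarrow> (\<lambda>n. B (k n) z) \<longlonglongrightarrow> g z"
    and ul: "\<And>K. \<lbrakk>compact K; K \<subseteq> unit_disk\<rbrakk> \<Longrightarrow> uniform_limit K (B \<circ> k) g sequentially"
  proof (rule Montel[of unit_disk ?\<H> B])
    show "\<exists>C. \<forall>h\<in>?\<H>. \<forall>z\<in>K. cmod (h z) \<le> C" if "K \<subseteq> unit_disk" for K using that by (intro exI[of _ 1]) blast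
    show "range B \<subseteq> ?\<H>" using Bh B1 by auto
  qed auto
  have rk: "(\<lambda>n. radius (k n)) \<longlonglongrightarrow> 1"
    using LIMSEQ_subseq_LIMSEQ[OF radius_tendsto k] by (simp add: o_def)
  have B0: "B n 0 = exp (- of_real (log_plus_mean f (radius n)))" for n
    unfolding B_def log_plus_mean_circ by (subst herglotz_0[OF vi]) (simp add: v_def[abs_def])
  have "(\<lambda>n. log_plus_mean f (radius n)) \<longlonglongrightarrow> L" by (rule filterlim_compose[OF L radius_at_left])
  then have "(\<lambda>n. log_plus_mean f (radius (k n))) \<longlonglongrightarrow> L" using LIMSEQ_subseq_LIMSEQ[OF _ k] by (simp add: o_def)
  then have "(\<lambda>n. B (k n) 0) \<longlonglongrightarrow> exp (- of_real L)" unfolding B0 by (intro tendsto_intros)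
  then have g0: "g 0 = exp (- of_real L)" using lim[of 0] LIMSEQ_unique by fastforce
  \<comment> \<open>The circle means are bounded, so the limit does not vanish at \<open>0\<close>; Hurwitz's theorem excludes all zeros.\<close>
  have gnz: "g z \<noteq> 0" if z: "z \<in> unit_disk" for z
  proof (cases "g constant_on unit_disk")
    case True
    then have "g z = g 0" using z by (auto simp: constant_on_def)
    then show ?thesis by (simp add: g0)
  next
    case False
    show ?thesis
      by (rule Hurwitz_no_zeros[of unit_disk "B \<circ> k" g]) (use Bh g ul z False in \<open>auto simp: B_def[abs_def]\<close>)
  qed
  obtain l where l: "l holomorphic_on unit_disk" "\<And>z. z \<in> unit_disk \<Longrightarrow> g z = exp (l z)"
    using contractible_imp_holomorphic_log[OF g _ gnz] convex_imp_contractible by blast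
  have "has_majorant f (\<lambda>z. - l z)"
    unfolding has_majorant_def
  proof (intro conjI ballI)
    show "(\<lambda>z. - l z) holomorphic_on unit_disk" using l by (intro holomorphic_intros)
    fix z :: complex assume z: "z \<in> unit_disk"
    have "cmod (g z) \<le> 1" by (rule LIMSEQ_le_const2[OF tendsto_norm[OF lim[OF z]]]) (use B1[OF z] in auto)
    then have Re0: "0 \<le> Re (- l z)" using l(2)[OF z] by simp
    have "(\<lambda>n. f (of_real (radius (k n)) * z)) \<longlonglongrightarrow> f z" by (rule dilation_tendsto[OF f z rk])
    then have "(\<lambda>n. f (of_real (radius (k n)) * z) * B (k n) z) \<longlonglongrightarrow> f z * g z" by (intro tendsto_intros lim z)
    then have "cmod (f z * g z) \<le> 1"
      by (rule LIMSEQ_le_const2[OF tendsto_norm]) (use has_majorant_bound[OF fB z] in \<open>auto simp: B_def\<close>)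
    then have "cmod (f z) * exp (Re (l z)) * exp (- Re (l z)) \<le> 1 * exp (- Re (l z))"
      using l(2)[OF z] by (intro mult_right_mono) (auto simp: norm_mult)
    then have "cmod (f z) \<le> exp (Re (- l z))" by (simp add: mult.assoc flip: exp_add)
    then show "log_plus (cmod (f z)) \<le> Re (- l z)" using log_plus_le_iff[OF Re0] by simp
  qed
  then show ?thesis using that by blast
qed

section \<open>The Smirnov class\<close>

lemma circ_complete: "complete_measure circ"
proof
  fix A B :: "real set" assume AB: "B \<subseteq> A" "A \<in> null_sets circ"
  then have "A \<in> null_sets lebesgue" "A \<subseteq> {0..2*pi}"
    by (auto simp: null_sets_restrict_space)
  then have "B \<in> null_sets lebesgue" "B \<subseteq> {0..2*pi}" using AB completion.complete2 by blast+
  then show "B \<in> sets circ" by (auto simp: sets_restrict_space_iff)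
qed

text \<open>Needed because the boundary function is a limit only almost everywhere and is arbitrary on the
  remaining null set.\<close>

lemma circ_measurable_AE_limit:
  fixes X :: "nat \<Rightarrow> real \<Rightarrow> real"
  assumes X[measurable]: "\<And>n. X n \<in> borel_measurable circ" and lim: "AE \<theta> in circ. (\<lambda>n. X n \<theta>) \<longlonglongrightarrow> Y \<theta>"
  shows "Y \<in> borel_measurable circ"
proof (rule borel_measurableI)
  fix S :: "real set" assume S: "open S"
  define Z where "Z \<theta> = lim (\<lambda>n. X n \<theta>)" for \<theta>
  have Z: "Z \<in> borel_measurable circ" unfolding Z_def by measurable
  have "AE \<theta> in circ. Z \<theta> = Y \<theta>" using lim by eventually_elim (simp add: Z_def limI)
  then have "AE \<theta> in circ. \<theta> \<in> Z -` S \<inter> space circ \<longleftrightarrow> \<theta> \<in> Y -` S \<inter> space circ"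
    by eventually_elim auto
  then show "Y -` S \<inter> space circ \<in> sets circ"
    by (rule complete_measure.in_sets_AE[OF circ_complete])
      (use measurable_sets[OF Z borel_open[OF S]] in auto)
qed

text \<open>Scheffe's lemma for non-negative functions.\<close>

lemma L1_convergenceI:
  fixes X :: "nat \<Rightarrow> 'a \<Rightarrow> real"
  assumes Xi: "\<And>n. integrable M (X n)" and Yi: "integrable M Y"
    and nonneg: "\<And>n x. 0 \<le> X n x" "\<And>x. 0 \<le> Y x"
    and lim: "AE x in M. (\<lambda>n. X n x) \<longlonglongrightarrow> Y x" and int: "(\<lambda>n. LINT x|M. X n x) \<longlonglongrightarrow> (LINT x|M. Y x)"
  shows "(\<lambda>n. LINT x|M. \<bar>X n x - Y x\<bar>) \<longlonglongrightarrow> 0"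
proof -
  have [measurable]: "X n \<in> borel_measurable M" "Y \<in> borel_measurable M" for n using Xi Yi by auto
  \<comment> \<open>\<open>|X - Y| = X + Y - 2 min X Y\<close>, and the minimum is dominated by \<open>Y\<close>.\<close>
  have mi: "integrable M (\<lambda>x. min (X n x) (Y x))" for n using Xi Yi by (rule integrable_min)
  have "(\<lambda>n. LINT x|M. min (X n x) (Y x)) \<longlonglongrightarrow> (LINT x|M. min (Y x) (Y x))"
  proof (rule integral_dominated_convergence[where w = Y])
    show "AE x in M. (\<lambda>n. min (X n x) (Y x)) \<longlonglongrightarrow> min (Y x) (Y x)"
      using lim by eventually_elim (intro tendsto_intros)
    show "AE x in M. norm (min (X n x) (Y x)) \<le> Y x" for n using nonneg by (intro AE_I2) auto
  qed (use Yi in auto)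
  then have "(\<lambda>n. (LINT x|M. X n x) + (LINT x|M. Y x) - 2 * (LINT x|M. min (X n x) (Y x))) \<longlonglongrightarrow>
     (LINT x|M. Y x) + (LINT x|M. Y x) - 2 * (LINT x|M. min (Y x) (Y x))"
    by (intro tendsto_intros int)
  moreover have "(LINT x|M. \<bar>X n x - Y x\<bar>) = (LINT x|M. X n x) + (LINT x|M. Y x) - 2 * (LINT x|M. min (X n x) (Y x))" for n
  proof -
    have "(LINT x|M. \<bar>X n x - Y x\<bar>) = (LINT x|M. X n x + Y x - 2 * min (X n x) (Y x))"
      by (rule Bochner_Integration.integral_cong) auto
    also have "\<dots> = (LINT x|M. X n x) + (LINT x|M. Y x) - 2 * (LINT x|M. min (X n x) (Y x))"
      using Xi Yi mi by simp
    finally show ?thesis .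
  qed
  ultimately show ?thesis by simp
qed

text \<open>Dominated convergence with dominating functions that vary with \<open>n\<close> and converge in \<open>L\<^sup>1\<close>.\<close>

lemma dominated_by_L1_convergent:
  fixes X Y :: "nat \<Rightarrow> 'a \<Rightarrow> real"
  assumes Xi: "\<And>n. integrable M (X n)" and Ui: "integrable M U"
    and Xlim: "AE x in M. (\<lambda>n. X n x) \<longlonglongrightarrow> U x" and L1: "(\<lambda>n. LINT x|M. \<bar>X n x - U x\<bar>) \<longlonglongrightarrow> 0"
    and Yi: "\<And>n. integrable M (Y n)" and V: "V \<in> borel_measurable M"
    and Ylim: "AE x in M. (\<lambda>n. Y n x) \<longlonglongrightarrow> V x"
    and dom: "\<And>n x. 0 \<le> Y n x" "\<And>n x. Y n x \<le> c * X n x" and c: "0 \<le> c" and U0: "\<And>x. 0 \<le> U x"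
  shows "integrable M V" "(\<lambda>n. LINT x|M. Y n x) \<longlonglongrightarrow> (LINT x|M. V x)"
proof -
  have [measurable]: "U \<in> borel_measurable M" "Y n \<in> borel_measurable M" for n using Ui Yi by auto
  \<comment> \<open>Truncating at \<open>c U\<close> reduces to dominated convergence; the loss is at most \<open>c |X - U|\<close>.\<close>
  define Z where "Z n x = min (Y n x) (c * U x)" for n x
  have Zi: "integrable M (Z n)" for n unfolding Z_def using Yi Ui by (intro integrable_min) auto
  have m: "Z n \<in> borel_measurable M" for n unfolding Z_def by measurable
  have VU: "AE x in M. V x \<le> c * U x" using Xlim Ylim
  proof eventually_elim
    case (elim x)
    have "(\<lambda>n. c * X n x) \<longlonglongrightarrow> c * U x" using elim(1) by (intro tendsto_intros)
    from LIMSEQ_le[OF elim(2) this] dom show ?case by blast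
  qed
  have Zlim: "AE x in M. (\<lambda>n. Z n x) \<longlonglongrightarrow> V x" using Ylim VU
  proof eventually_elim
    case (elim x)
    have "(\<lambda>n. min (Y n x) (c * U x)) \<longlonglongrightarrow> min (V x) (c * U x)" using elim(1) by (intro tendsto_intros)
    then show ?case using elim(2) by (simp add: Z_def min_absorb1)
  qed
  have bd: "AE x in M. norm (Z n x) \<le> c * U x" for n using dom c U0 by (intro AE_I2) (auto simp: Z_def)
  have cU: "integrable M (\<lambda>x. c * U x)" using Ui by simp
  note dc = integral_dominated_convergence[OF V m cU Zlim bd]
  show "integrable M V" by (rule integrable_dominated_convergence[OF V m cU Zlim bd])
  have "(\<lambda>n. (LINT x|M. Y n x) - (LINT x|M. Z n x)) \<longlonglongrightarrow> 0"
  proof (rule tendsto_sandwich[where f = "\<lambda>_. 0" and h = "\<lambda>n. c * (LINT x|M. \<bar>X n x - U x\<bar>)"])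
    show "\<forall>\<^sub>F n in sequentially. 0 \<le> (LINT x|M. Y n x) - (LINT x|M. Z n x)"
      by (intro always_eventually allI) (simp, intro integral_mono Zi Yi, simp add: Z_def)
    show "\<forall>\<^sub>F n in sequentially. (LINT x|M. Y n x) - (LINT x|M. Z n x) \<le> c * (LINT x|M. \<bar>X n x - U x\<bar>)"
    proof (intro always_eventually allI)
      fix n
      have "(LINT x|M. Y n x) - (LINT x|M. Z n x) = (LINT x|M. Y n x - Z n x)" using Yi Zi by simp
      also have "\<dots> \<le> (LINT x|M. c * \<bar>X n x - U x\<bar>)"
      proof (rule integral_mono)
        show "integrable M (\<lambda>x. Y n x - Z n x)" using Yi Zi by simp
        show "integrable M (\<lambda>x. c * \<bar>X n x - U x\<bar>)" using Xi Ui by simp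
        show "Y n x - Z n x \<le> c * \<bar>X n x - U x\<bar>" for x
        proof -
          have "Y n x \<le> c * U x + c * (X n x - U x)" using dom(2)[of n x] by (simp add: algebra_simps)
          moreover have "c * (X n x - U x) \<le> c * \<bar>X n x - U x\<bar>" "0 \<le> c * \<bar>X n x - U x\<bar>" using c by (auto intro: mult_left_mono)
          ultimately show ?thesis by (simp add: Z_def min_def)
        qed
      qed
      finally show "(LINT x|M. Y n x) - (LINT x|M. Z n x) \<le> c * (LINT x|M. \<bar>X n x - U x\<bar>)" by simp
    qed
    show "(\<lambda>n. c * (LINT x|M. \<bar>X n x - U x\<bar>)) \<longlonglongrightarrow> 0" using tendsto_mult_right_zero[OF L1] .
  qed simp
  from tendsto_add[OF this dc] show "(\<lambda>n. LINT x|M. Y n x) \<longlonglongrightarrow> (LINT x|M. V x)" by simp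
qed

abbreviation boundary_log :: "(complex \<Rightarrow> complex) \<Rightarrow> real \<Rightarrow> real" where
  "boundary_log f \<theta> \<equiv> log_plus (cmod (boundary_fun f (cis \<theta>)))"

abbreviation dilated_log :: "(complex \<Rightarrow> complex) \<Rightarrow> real \<Rightarrow> real \<Rightarrow> real" where
  "dilated_log f r \<theta> \<equiv> log_plus (cmod (f (of_real r * cis \<theta>)))"

lemma dilated_log_continuous:
  "f holomorphic_on unit_disk \<Longrightarrow> 0 < r \<Longrightarrow> r < 1 \<Longrightarrow> continuous_on S (dilated_log f r)"
  by (intro continuous_intros dilated_circle_continuous)

lemma dilated_log_integrable:
  "f holomorphic_on unit_disk \<Longrightarrow> 0 < r \<Longrightarrow> r < 1 \<Longrightarrow> integrable circ (dilated_log f r)"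
  by (intro circ_continuous_integrable dilated_log_continuous)

lemma dilated_log_AE_tendsto:
  assumes "f holomorphic_on unit_disk" "has_majorant f H"
    "\<And>n. 0 < \<rho> n" "\<And>n. \<rho> n < 1" "\<rho> \<longlonglongrightarrow> 1"
  shows "AE \<theta> in circ. (\<lambda>n. dilated_log f (\<rho> n) \<theta>) \<longlonglongrightarrow> boundary_log f \<theta>"
  using majorant_nontangential_limits[OF assms(1,2)]
  by eventually_elim (intro tendsto_log_plus tendsto_norm nt_limit_radial assms)

lemma boundary_log_measurable:
  assumes "f holomorphic_on unit_disk" "has_majorant f H"
  shows "boundary_log f \<in> borel_measurable circ"
  by (rule circ_measurable_AE_limit[OF _ dilated_log_AE_tendsto[OF assms radius_pos radius_less radius_tendsto]])
    (intro circ_continuous_measurable dilated_log_continuous[OF assms(1) radius_pos radius_less])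

lemma boundary_log_set_integrable:
  "set_integrable lebesgue {0..2*pi} (boundary_log f) \<longleftrightarrow> integrable circ (boundary_log f)"
  "(LINT \<theta>:{0..2*pi}|lebesgue. boundary_log f \<theta>) = (LINT \<theta>|circ. boundary_log f \<theta>)"
  by (simp_all add: set_integrable_def set_lebesgue_integral_def integrable_restrict_space integral_restrict_space)

lemma SmirnovI:
  assumes f: "f holomorphic_on unit_disk" and int: "integrable circ (boundary_log f)"
    and lim: "\<And>\<rho>. (\<And>n. 0 < \<rho> n) \<Longrightarrow> (\<And>n. \<rho> n < 1) \<Longrightarrow> \<rho> \<longlonglongrightarrow> 1 \<Longrightarrow>
       (\<lambda>n. LINT \<theta>|circ. dilated_log f (\<rho> n) \<theta>) \<longlonglongrightarrow> (LINT \<theta>|circ. boundary_log f \<theta>)"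
  shows "f \<in> Smirnov"
proof -
  have "(log_plus_mean f \<longlongrightarrow> 1 / (2*pi) * (LINT \<theta>|circ. boundary_log f \<theta>)) (at_left 1)"
  proof (rule tendsto_at_left_sequentially[of 0])
    fix \<rho> :: "nat \<Rightarrow> real" assume "\<And>n. \<rho> n < 1" "\<And>n. 0 < \<rho> n" "\<rho> \<longlonglongrightarrow> 1"
    then show "(\<lambda>n. log_plus_mean f (\<rho> n)) \<longlonglongrightarrow> 1 / (2*pi) * (LINT \<theta>|circ. boundary_log f \<theta>)"
      unfolding log_plus_mean_circ by (intro tendsto_mult_left lim)
  qed simp
  then show ?thesis using f int unfolding Smirnov_def Nevanlinna_def boundary_log_set_integrable by blast
qed

text \<open>The defining equality of the means and almost everywhere convergence together give convergence of
  \<open>log\<^sup>+ |f|\<close> on circles to its boundary values in \<open>L\<^sup>1\<close>. All later uses of the Smirnov class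
  go through this.\<close>

lemma SmirnovD:
  assumes "f \<in> Smirnov"
  obtains H where "f holomorphic_on unit_disk" "has_majorant f H" "integrable circ (boundary_log f)"
    "\<And>\<rho>. (\<And>n. 0 < \<rho> n) \<Longrightarrow> (\<And>n. \<rho> n < 1) \<Longrightarrow> \<rho> \<longlonglongrightarrow> 1 \<Longrightarrow>
       (\<lambda>n. LINT \<theta>|circ. \<bar>dilated_log f (\<rho> n) \<theta> - boundary_log f \<theta>\<bar>) \<longlonglongrightarrow> 0"
proof -
  have N: "f \<in> Nevanlinna" and int: "integrable circ (boundary_log f)"
    and lim: "(log_plus_mean f \<longlongrightarrow> 1 / (2*pi) * (LINT \<theta>|circ. boundary_log f \<theta>)) (at_left 1)"
    using assms unfolding Smirnov_def boundary_log_set_integrable by auto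
  have f: "f holomorphic_on unit_disk" using N by (simp add: Nevanlinna_def)
  obtain H where H: "has_majorant f H" using Nevanlinna_majorant[OF N] .
  show ?thesis
  proof (rule that[OF f H int])
    fix \<rho> :: "nat \<Rightarrow> real" assume \<rho>: "\<And>n. 0 < \<rho> n" "\<And>n. \<rho> n < 1" "\<rho> \<longlonglongrightarrow> 1"
    have "filterlim \<rho> (at_left 1) sequentially"
      using \<rho> by (intro filterlim_at_withinI) (auto simp: less_le)
    then have "(\<lambda>n. log_plus_mean f (\<rho> n)) \<longlonglongrightarrow> 1 / (2*pi) * (LINT \<theta>|circ. boundary_log f \<theta>)"
      by (rule filterlim_compose[OF lim])
    then have "(\<lambda>n. 2*pi * log_plus_mean f (\<rho> n)) \<longlonglongrightarrow> 2*pi * (1 / (2*pi) * (LINT \<theta>|circ. boundary_log f \<theta>))"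
      by (intro tendsto_intros)
    then have "(\<lambda>n. LINT \<theta>|circ. dilated_log f (\<rho> n) \<theta>) \<longlonglongrightarrow> (LINT \<theta>|circ. boundary_log f \<theta>)"
      unfolding log_plus_mean_circ by simp
    then show "(\<lambda>n. LINT \<theta>|circ. \<bar>dilated_log f (\<rho> n) \<theta> - boundary_log f \<theta>\<bar>) \<longlonglongrightarrow> 0"
      by (intro L1_convergenceI dilated_log_integrable f \<rho> int dilated_log_AE_tendsto[OF f H] log_plus_nonneg)
  qed
qed

text \<open>Membership in the Smirnov class passes to every holomorphic \<open>g\<close> whose \<open>log\<^sup>+\<close> is dominated: the
  convergence in \<open>L\<^sup>1\<close> for \<open>f\<close> serves as the dominating sequence for \<open>g\<close>.\<close>

lemma Smirnov_dominated:
  assumes f: "f \<in> Smirnov" and g: "g holomorphic_on unit_disk" and c: "0 \<le> c"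
    and dom: "\<And>z. z \<in> unit_disk \<Longrightarrow> log_plus (cmod (g z)) \<le> c * log_plus (cmod (f z))"
  obtains H where "has_majorant f H" "has_majorant g (\<lambda>z. of_real c * H z)" "integrable circ (boundary_log g)"
    "\<And>\<rho>. (\<And>n. 0 < \<rho> n) \<Longrightarrow> (\<And>n. \<rho> n < 1) \<Longrightarrow> \<rho> \<longlonglongrightarrow> 1 \<Longrightarrow>
       (\<lambda>n. LINT \<theta>|circ. dilated_log g (\<rho> n) \<theta>) \<longlonglongrightarrow> (LINT \<theta>|circ. boundary_log g \<theta>)"
    "g \<in> Smirnov"
proof -
  obtain H where hf: "f holomorphic_on unit_disk" and H: "has_majorant f H" and int: "integrable circ (boundary_log f)"
    and L1: "\<And>\<rho>. (\<And>n. 0 < \<rho> n) \<Longrightarrow> (\<And>n. \<rho> n < 1) \<Longrightarrow> \<rho> \<longlonglongrightarrow> 1 \<Longrightarrow>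
       (\<lambda>n. LINT \<theta>|circ. \<bar>dilated_log f (\<rho> n) \<theta> - boundary_log f \<theta>\<bar>) \<longlonglongrightarrow> 0"
    using SmirnovD[OF f] by blast
  have Hg: "has_majorant g (\<lambda>z. of_real c * H z)"
    unfolding has_majorant_def
  proof (intro conjI ballI)
    show "(\<lambda>z. of_real c * H z) holomorphic_on unit_disk" using H by (intro holomorphic_intros) (simp add: has_majorant_def)
    fix z :: complex assume z: "z \<in> unit_disk"
    have "c * log_plus (cmod (f z)) \<le> c * Re (H z)" using H z c by (intro mult_left_mono) (auto simp: has_majorant_def)
    then show "log_plus (cmod (g z)) \<le> Re (of_real c * H z)" using dom[OF z] by simp
  qed
  have key: "integrable circ (boundary_log g) \<and> (\<lambda>n. LINT \<theta>|circ. dilated_log g (\<rho> n) \<theta>) \<longlonglongrightarrow> (LINT \<theta>|circ. boundary_log g \<theta>)"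
    if \<rho>: "\<And>n. 0 < \<rho> n" "\<And>n. \<rho> n < 1" "\<rho> \<longlonglongrightarrow> 1" for \<rho>
  proof (rule conjI; rule dominated_by_L1_convergent[where X = "\<lambda>n. dilated_log f (\<rho> n)" and U = "boundary_log f" and c = c and Y = "\<lambda>n. dilated_log g (\<rho> n)"])
    show "dilated_log g (\<rho> n) \<theta> \<le> c * dilated_log f (\<rho> n) \<theta>" for n \<theta>
      by (rule dom) (use \<rho>(1)[of n] \<rho>(2)[of n] in \<open>simp add: norm_mult\<close>)
    then show "dilated_log g (\<rho> n) \<theta> \<le> c * dilated_log f (\<rho> n) \<theta>" for n \<theta> .
  qed (intro dilated_log_integrable hf g \<rho> int dilated_log_AE_tendsto[OF hf H] dilated_log_AE_tendsto[OF g Hg]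
        log_plus_nonneg L1 boundary_log_measurable[OF g Hg] c)+
  show ?thesis
  proof (rule that[OF H Hg])
    show int: "integrable circ (boundary_log g)" using key[OF radius_pos radius_less radius_tendsto] by blast
    show "(\<lambda>n. LINT \<theta>|circ. dilated_log g (\<rho> n) \<theta>) \<longlonglongrightarrow> (LINT \<theta>|circ. boundary_log g \<theta>)"
      if "\<And>n. 0 < \<rho> n" "\<And>n. \<rho> n < 1" "\<rho> \<longlonglongrightarrow> 1" for \<rho> using key[OF that] by blast
    show "g \<in> Smirnov" by (rule SmirnovI[OF g int]) (use key in blast)
  qed
qed

text \<open>The hypotheses make the boundary values of \<open>log\<^sup>+ |g|\<close> vanish, so its circle means tend to \<open>0\<close>;
  being subharmonic, \<open>log\<^sup>+ |g|\<close> is bounded at \<open>z\<close> by a constant multiple of these means.\<close>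

theorem Smirnov_maximum_principle:
  assumes f: "f \<in> Smirnov" and g: "g holomorphic_on unit_disk"
    and dom: "\<And>z. z \<in> unit_disk \<Longrightarrow> cmod (g z) \<le> cmod (f z)"
    and bd: "AE \<theta> in circ. \<forall>l. has_nontangential_limit g (cis \<theta>) l \<longrightarrow> cmod l \<le> 1"
    and z: "z \<in> unit_disk"
  shows "cmod (g z) \<le> 1"
proof -
  have dom': "log_plus (cmod (g z)) \<le> 1 * log_plus (cmod (f z))" if "z \<in> unit_disk" for z
    using log_plus_mono[OF dom[OF that]] by simp
  obtain H where Hg: "has_majorant g (\<lambda>z. of_real 1 * H z)"
    and lim: "\<And>\<rho>. (\<And>n. 0 < \<rho> n) \<Longrightarrow> (\<And>n. \<rho> n < 1) \<Longrightarrow> \<rho> \<longlonglongrightarrow> 1 \<Longrightarrow>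
       (\<lambda>n. LINT \<theta>|circ. dilated_log g (\<rho> n) \<theta>) \<longlonglongrightarrow> (LINT \<theta>|circ. boundary_log g \<theta>)"
    using Smirnov_dominated[OF f g _ dom'] by (metis zero_le_one)
  have "AE \<theta> in circ. boundary_log g \<theta> = 0"
    using bd majorant_nontangential_limits[OF g Hg]
  proof eventually_elim
    case (elim \<theta>)
    then have "cmod (boundary_fun g (cis \<theta>)) \<le> 1" by blast
    then show ?case by (simp add: log_plus_def max_absorb1)
  qed
  then have "(LINT \<theta>|circ. boundary_log g \<theta>) = 0" by (rule integral_eq_zero_AE)
  then have l0: "(\<lambda>n. LINT \<theta>|circ. dilated_log g (radius n) \<theta>) \<longlonglongrightarrow> 0"
    using lim[OF radius_pos radius_less radius_tendsto] by simp
  have z1: "cmod z < 1" using z by simp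
  define K where "K = (1 + cmod z) / (1 - cmod z)"
  have le: "log_plus (cmod (g (of_real (radius n) * z))) \<le> 1 / (2*pi) * (K * (LINT \<theta>|circ. dilated_log g (radius n) \<theta>))" for n
  proof -
    have i: "integrable circ (dilated_log g (radius n))" by (rule dilated_log_integrable[OF g radius_pos radius_less])
    have "log_plus (cmod (g (of_real (radius n) * z))) \<le> Re (herglotz (dilated_log g (radius n)) z)"
      by (rule log_plus_le_Re_herglotz[OF dilation_holomorphic(2,3)[OF g radius_pos radius_less] z])
    also have "\<dots> = 1 / (2*pi) * (LINT t|circ. poisson z t * dilated_log g (radius n) t)" by (rule Re_herglotz[OF i z1])
    also have "\<dots> \<le> 1 / (2*pi) * (LINT t|circ. K * dilated_log g (radius n) t)"
      by (intro mult_left_mono integral_mono integrable_poisson[OF z1 i] integrable_mult_right i mult_right_mono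
          poisson_le[OF z1, folded K_def] log_plus_nonneg) auto
    finally show ?thesis by simp
  qed
  have "(\<lambda>n. g (of_real (radius n) * z)) \<longlonglongrightarrow> g z" by (rule dilation_tendsto[OF g z radius_tendsto])
  then have "(\<lambda>n. log_plus (cmod (g (of_real (radius n) * z)))) \<longlonglongrightarrow> log_plus (cmod (g z))"
    by (intro tendsto_log_plus tendsto_norm)
  moreover have "(\<lambda>n. 1 / (2*pi) * (K * (LINT \<theta>|circ. dilated_log g (radius n) \<theta>))) \<longlonglongrightarrow> 1 / (2*pi) * (K * 0)"
    by (intro tendsto_intros l0)
  ultimately have "log_plus (cmod (g z)) \<le> 1 / (2*pi) * (K * 0)"
    by (rule LIMSEQ_le) (use le in blast)
  then show ?thesis using log_plus_le_iff[of 0 "cmod (g z)"] by simp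
qed

text \<open>A bound in \<open>L\<^sup>2\<close> gives uniform integrability, so almost everywhere convergence implies convergence
  of the integrals.\<close>

lemma L1_convergence_of_L2_bounded:
  fixes Y :: "nat \<Rightarrow> 'a \<Rightarrow> real"
  assumes M: "finite_measure M"
    and Ym: "\<And>n. Y n \<in> borel_measurable M" and Vm: "V \<in> borel_measurable M"
    and Y2: "\<And>n. integrable M (\<lambda>x. (Y n x)\<^sup>2)" "\<And>n. (LINT x|M. (Y n x)\<^sup>2) \<le> B"
    and lim: "AE x in M. (\<lambda>n. Y n x) \<longlonglongrightarrow> V x"
  shows "integrable M V" "(\<lambda>n. LINT x|M. Y n x) \<longlonglongrightarrow> (LINT x|M. V x)"
proof -
  interpret finite_measure M by (rule M)
  note [measurable] = Ym Vm
  have le1: "\<bar>y\<bar> \<le> 1 + y\<^sup>2" for y :: real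
    using sum_squares_bound[of 1 "\<bar>y\<bar>"] abs_ge_zero[of y] by (simp add: power2_abs)
  have B0: "0 \<le> B" using Y2(2)[of 0] order_trans[OF Bochner_Integration.integral_nonneg[of M "\<lambda>x. (Y 0 x)\<^sup>2"]] by auto
  have "(\<integral>\<^sup>+ x. ennreal ((V x)\<^sup>2) \<partial>M) = (\<integral>\<^sup>+ x. liminf (\<lambda>n. ennreal ((Y n x)\<^sup>2)) \<partial>M)"
  proof (rule nn_integral_cong_AE)
    show "AE x in M. ennreal ((V x)\<^sup>2) = liminf (\<lambda>n. ennreal ((Y n x)\<^sup>2))"
      using lim
    proof eventually_elim
      case (elim x)
      have "(\<lambda>n. ennreal ((Y n x)\<^sup>2)) \<longlonglongrightarrow> ennreal ((V x)\<^sup>2)" by (intro tendsto_ennrealI tendsto_intros elim)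
      then show ?case by (rule lim_imp_Liminf[OF sequentially_bot, symmetric])
    qed
  qed
  also have "\<dots> \<le> liminf (\<lambda>n. \<integral>\<^sup>+ x. ennreal ((Y n x)\<^sup>2) \<partial>M)" by (rule nn_integral_liminf) measurable
  also have "\<dots> \<le> liminf (\<lambda>n. ennreal B)"
  proof (intro Liminf_mono always_eventually allI)
    fix n
    have "(\<integral>\<^sup>+ x. ennreal ((Y n x)\<^sup>2) \<partial>M) = ennreal (LINT x|M. (Y n x)\<^sup>2)"
      by (rule nn_integral_eq_integral[OF Y2(1)]) auto
    then show "(\<integral>\<^sup>+ x. ennreal ((Y n x)\<^sup>2) \<partial>M) \<le> ennreal B" using Y2(2)[of n] by (simp add: ennreal_leI)
  qed
  also have "\<dots> = ennreal B" by (simp add: Liminf_const)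
  finally have V2n: "(\<integral>\<^sup>+ x. ennreal ((V x)\<^sup>2) \<partial>M) \<le> ennreal B" .
  have V2: "integrable M (\<lambda>x. (V x)\<^sup>2)"
    by (rule integrableI_nonneg) (use V2n in \<open>auto intro: le_less_trans\<close>)
  then have V2B: "(LINT x|M. (V x)\<^sup>2) \<le> B"
    using V2n B0 nn_integral_eq_integral[OF V2] by (simp add: ennreal_le_iff)
  show Vi: "integrable M V"
    by (rule Bochner_Integration.integrable_bound[of M "\<lambda>x. 1 + (V x)\<^sup>2"]) (use V2 le1 in auto)
  have Yi: "integrable M (Y n)" for n
    by (rule Bochner_Integration.integrable_bound[of M "\<lambda>x. 1 + (Y n x)\<^sup>2"]) (use Y2 le1 in auto)
  have "(\<lambda>n. (LINT x|M. Y n x) - (LINT x|M. V x)) \<longlonglongrightarrow> 0"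
  proof (rule metric_LIMSEQ_I)
    fix e :: real assume e: "e > 0"
    \<comment> \<open>Above the level \<open>T\<close>, \<open>|Y - V|\<close> is at most \<open>|Y - V|\<^sup>2 / T\<close>, whose integral is at most \<open>4 B / T \<le> e / 2\<close>.\<close>
    define T where "T = 8 * (B + 1) / e"
    have T: "T > 0" using e B0 by (simp add: T_def)
    have "(\<lambda>n. LINT x|M. min \<bar>Y n x - V x\<bar> T) \<longlonglongrightarrow> (LINT x|M. 0)"
    proof (rule integral_dominated_convergence[where w = "\<lambda>_. T"])
      show "AE x in M. (\<lambda>n. min \<bar>Y n x - V x\<bar> T) \<longlonglongrightarrow> 0"
        using lim
      proof eventually_elim
        case (elim x)
        have "(\<lambda>n. min \<bar>Y n x - V x\<bar> T) \<longlonglongrightarrow> min \<bar>V x - V x\<bar> T" by (intro tendsto_intros elim)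
        then show ?case using T by simp
      qed
    qed (use T in auto)
    then have "(\<lambda>n. LINT x|M. min \<bar>Y n x - V x\<bar> T) \<longlonglongrightarrow> 0" by simp
    then have "\<forall>\<^sub>F n in sequentially. (LINT x|M. min \<bar>Y n x - V x\<bar> T) < e/2"
      by (rule order_tendstoD) (use e in simp)
    then obtain N where N: "\<And>n. n \<ge> N \<Longrightarrow> (LINT x|M. min \<bar>Y n x - V x\<bar> T) < e/2"
      unfolding eventually_sequentially by auto
    have "dist ((LINT x|M. Y n x) - (LINT x|M. V x)) 0 < e" if "n \<ge> N" for n
    proof -
      have mi: "integrable M (\<lambda>x. min \<bar>Y n x - V x\<bar> T)" using Yi Vi by (intro integrable_min integrable_abs) auto
      have ti: "integrable M (\<lambda>x. 2 / T * ((Y n x)\<^sup>2 + (V x)\<^sup>2))" using Y2 V2 by (intro integrable_mult_right) auto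
      have "\<bar>(LINT x|M. Y n x) - (LINT x|M. V x)\<bar> = \<bar>LINT x|M. Y n x - V x\<bar>" using Yi Vi by simp
      also have "\<dots> \<le> (LINT x|M. \<bar>Y n x - V x\<bar>)" by (rule integral_abs_bound)
      also have "\<dots> \<le> (LINT x|M. min \<bar>Y n x - V x\<bar> T + 2 / T * ((Y n x)\<^sup>2 + (V x)\<^sup>2))"
      proof (rule integral_mono)
        show "integrable M (\<lambda>x. \<bar>Y n x - V x\<bar>)" using Yi Vi by auto
        show "integrable M (\<lambda>x. min \<bar>Y n x - V x\<bar> T + 2 / T * ((Y n x)\<^sup>2 + (V x)\<^sup>2))" using mi ti by simp
        fix x
        show "\<bar>Y n x - V x\<bar> \<le> min \<bar>Y n x - V x\<bar> T + 2 / T * ((Y n x)\<^sup>2 + (V x)\<^sup>2)"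
        proof (cases "\<bar>Y n x - V x\<bar> \<le> T")
          case False
          have "T * \<bar>Y n x - V x\<bar> \<le> \<bar>Y n x - V x\<bar> * \<bar>Y n x - V x\<bar>" using False by (intro mult_right_mono) auto
          also have "\<dots> = (Y n x - V x)\<^sup>2" by (simp add: power2_eq_square)
          also have "\<dots> \<le> 2 * ((Y n x)\<^sup>2 + (V x)\<^sup>2)"
            using zero_le_power2[of "Y n x + V x"] by (simp add: power2_eq_square algebra_simps)
          finally have "\<bar>Y n x - V x\<bar> \<le> 2 / T * ((Y n x)\<^sup>2 + (V x)\<^sup>2)" using T by (simp add: field_simps)
          then show ?thesis using T by simp
        qed (use T in auto)
      qed
      also have "\<dots> = (LINT x|M. min \<bar>Y n x - V x\<bar> T) + 2 / T * ((LINT x|M. (Y n x)\<^sup>2) + (LINT x|M. (V x)\<^sup>2))"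
        using mi Y2 V2 by simp
      also have "2 / T * ((LINT x|M. (Y n x)\<^sup>2) + (LINT x|M. (V x)\<^sup>2)) \<le> 2 / T * (B + B)"
        using T Y2 V2B by (intro mult_left_mono add_mono) auto
      also have "2 / T * (B + B) \<le> e / 2" using e B0 by (simp add: T_def field_simps)
      finally show ?thesis using N[OF that] by simp
    qed
    then show "\<exists>N. \<forall>n\<ge>N. dist ((LINT x|M. Y n x) - (LINT x|M. V x)) 0 < e" by blast
  qed
  then show "(\<lambda>n. LINT x|M. Y n x) \<longlonglongrightarrow> (LINT x|M. V x)" by (rule LIM_zero_cancel)
qed

text \<open>The square of \<open>log\<^sup>+ |f|\<close> is at most \<open>4 |f| \<le> 8 Re f\<close>, and \<open>Re f\<close> is harmonic; hence \<open>log\<^sup>+ |f|\<close> is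
  bounded in square mean on circles.\<close>

lemma sectorial_in_Smirnov:
  assumes f: "f holomorphic_on unit_disk" and sec: "\<And>z. z \<in> unit_disk \<Longrightarrow> cmod (f z) \<le> 2 * Re (f z)"
  shows "f \<in> Smirnov"
proof -
  have H: "has_majorant f (\<lambda>z. 2 * f z)"
    unfolding has_majorant_def
  proof (intro conjI ballI)
    show "(\<lambda>z. 2 * f z) holomorphic_on unit_disk" using f by (intro holomorphic_intros)
    fix z :: complex assume "z \<in> unit_disk"
    then show "log_plus (cmod (f z)) \<le> Re (2 * f z)"
      using order_trans[OF log_plus_le_self[OF norm_ge_zero] sec] by simp
  qed
  have key: "integrable circ (boundary_log f)" "(\<lambda>n. LINT \<theta>|circ. dilated_log f (\<rho> n) \<theta>) \<longlonglongrightarrow> (LINT \<theta>|circ. boundary_log f \<theta>)"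
    if \<rho>: "\<And>n. 0 < \<rho> n" "\<And>n. \<rho> n < 1" "\<rho> \<longlonglongrightarrow> 1" for \<rho>
  proof -
    have c: "continuous_on {0..2*pi} (dilated_log f (\<rho> n))" for n by (rule dilated_log_continuous[OF f \<rho>(1,2)])
    have i2: "integrable circ (\<lambda>\<theta>. (dilated_log f (\<rho> n) \<theta>)\<^sup>2)" for n
      by (intro circ_continuous_integrable continuous_intros c)
    have b2: "(LINT \<theta>|circ. (dilated_log f (\<rho> n) \<theta>)\<^sup>2) \<le> 16 * pi * Re (f 0)" for n
    proof -
      have "(LINT \<theta>|circ. (dilated_log f (\<rho> n) \<theta>)\<^sup>2) \<le> (LINT \<theta>|circ. 8 * Re (f (of_real (\<rho> n) * cis \<theta>)))"
      proof (rule integral_mono[OF i2])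
        show "integrable circ (\<lambda>\<theta>. 8 * Re (f (of_real (\<rho> n) * cis \<theta>)))"
          by (intro circ_continuous_integrable continuous_intros dilated_circle_continuous[OF f \<rho>(1,2)])
        fix \<theta>
        show "(dilated_log f (\<rho> n) \<theta>)\<^sup>2 \<le> 8 * Re (f (of_real (\<rho> n) * cis \<theta>))"
          using log_plus_square_le[of "cmod (f (of_real (\<rho> n) * cis \<theta>))"] sec[of "of_real (\<rho> n) * cis \<theta>"] \<rho>(1)[of n] \<rho>(2)[of n]
          by (simp add: norm_mult)
      qed
      also have "\<dots> = 16 * pi * Re (f 0)" using Re_mean_value[OF f \<rho>(1,2), of n] by simp
      finally show ?thesis .
    qed
    note L = L1_convergence_of_L2_bounded[OF finite_measure_circ circ_continuous_measurable[OF c]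
        boundary_log_measurable[OF f H] i2 b2 dilated_log_AE_tendsto[OF f H \<rho>]]
    show "integrable circ (boundary_log f)" "(\<lambda>n. LINT \<theta>|circ. dilated_log f (\<rho> n) \<theta>) \<longlonglongrightarrow> (LINT \<theta>|circ. boundary_log f \<theta>)"
      by (rule L)+
  qed
  show ?thesis
    by (rule SmirnovI[OF f key(1)[OF radius_pos radius_less radius_tendsto]]) (rule key(2))
qed

section \<open>Nontangentially dense sets are sampling, and sampling sets are determining\<close>

text \<open>The measure \<open>2 pi\<close> is not \<open>0\<close>, so the parameter set of \<open>NT \<Lambda>\<close> is measurable and has full measure.\<close>

lemma full_NT_AE:
  assumes "arc_length (NT \<Lambda>) = 2 * pi"
  shows "AE \<theta> in circ. cis \<theta> \<in> NT \<Lambda>"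
proof (rule AE_circI)
  let ?A = "{\<theta> \<in> {0..<2*pi}. cis \<theta> \<in> NT \<Lambda>}"
  have m: "measure lebesgue ?A = 2*pi" using assms by (simp add: arc_length_def)
  then have A: "?A \<in> sets lebesgue" using measure_notin_sets[of ?A lebesgue] by (metis pi_neq_zero mult_eq_0_iff zero_neq_numeral)
  have AL: "?A \<in> lmeasurable" by (rule fmeasurableI2[of "{0..2*pi}"]) (use A in auto)
  have "measure lebesgue ({0..2*pi} - ?A) = measure lebesgue {0..2*pi} - measure lebesgue ?A"
    by (rule measurable_measure_Diff) (use A in auto)
  also have "\<dots> = 0" using m by simp
  finally have "negligible ({0..2*pi} - ?A)"
    unfolding negligible_iff_measure using AL by (auto intro: fmeasurable_Diff)
  moreover have "{\<theta> \<in> {0..2*pi}. \<not> cis \<theta> \<in> NT \<Lambda>} \<subseteq> {0..2*pi} - ?A" by auto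
  ultimately show "negligible {\<theta> \<in> {0..2*pi}. \<not> cis \<theta> \<in> NT \<Lambda>}" by (rule negligible_subset)
qed

text \<open>The function \<open>f exp (-H)\<close>, where \<open>Re H = h\<close>, is bounded by \<open>1\<close> on \<open>\<Lambda>\<close>. Almost every boundary point
  is a nontangential limit of points of \<open>\<Lambda>\<close>, so its boundary values are bounded by \<open>1\<close>, and the
  maximum principle for the Smirnov class applies.\<close>

theorem full_NT_imp_strongly_sampling:
  assumes \<Lambda>: "\<Lambda> \<subseteq> unit_disk" and NT: "arc_length (NT \<Lambda>) = 2 * pi"
  shows "strongly_sampling_Smirnov \<Lambda>"
  unfolding strongly_sampling_Smirnov_def
proof (intro ballI impI)
  fix f h z assume f: "f \<in> Smirnov" and h: "h \<in> Har_plus" and le: "\<forall>z\<in>\<Lambda>. log_plus (cmod (f z)) \<le> h z"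
    and z: "z \<in> unit_disk"
  obtain H where H: "H holomorphic_on unit_disk" "\<And>z. z \<in> unit_disk \<Longrightarrow> Re (H z) = h z"
    using Har_plus_Re_holomorphic[OF h] by metis
  have h0: "0 \<le> h z" if "z \<in> unit_disk" for z using h that by (simp add: Har_plus_def)
  have hf: "f holomorphic_on unit_disk" using f by (simp add: Smirnov_def Nevanlinna_def)
  \<comment> \<open>Dividing by \<open>exp H\<close> turns the harmonic bound into the constant bound \<open>1\<close>.\<close>
  let ?g = "\<lambda>z. f z * exp (- H z)"
  have ng: "cmod (?g z) = cmod (f z) * exp (- h z)" if "z \<in> unit_disk" for z using H(2)[OF that] by (simp add: norm_mult)
  have le_iff: "cmod (?g w) \<le> 1 \<longleftrightarrow> log_plus (cmod (f w)) \<le> h w" if w: "w \<in> unit_disk" for w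
    unfolding ng[OF w] log_plus_le_iff[OF h0[OF w]] by (simp add: exp_minus field_simps)
  have "cmod (?g z) \<le> 1"
  proof (rule Smirnov_maximum_principle[OF f _ _ _ z])
    show "?g holomorphic_on unit_disk" using hf H by (intro holomorphic_intros)
    show "cmod (?g w) \<le> cmod (f w)" if "w \<in> unit_disk" for w
      unfolding ng[OF that] using h0[OF that] by (simp add: mult_left_le)
    show "AE \<theta> in circ. \<forall>l. has_nontangential_limit ?g (cis \<theta>) l \<longrightarrow> cmod l \<le> 1"
      using full_NT_AE[OF NT]
    proof eventually_elim
      case (elim \<theta>)
      then obtain A s where A: "A > 1" "\<And>n::nat. s n \<in> \<Lambda> \<inter> Stolz A (cis \<theta>)" "s \<longlonglongrightarrow> cis \<theta>"
        by (auto simp: NT_def)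
      show ?case
      proof (intro allI impI)
        fix l assume "has_nontangential_limit ?g (cis \<theta>) l"
        then have "(\<lambda>n. ?g (s n)) \<longlonglongrightarrow> l" using A by (intro nt_limit_sequence[of ?g "cis \<theta>" l A s]) auto
        then have "(\<lambda>n. cmod (?g (s n))) \<longlonglongrightarrow> cmod l" by (rule tendsto_norm)
        moreover have "cmod (?g (s n)) \<le> 1" for n using le_iff[of "s n"] A(2)[of n] \<Lambda> le by auto
        ultimately show "cmod l \<le> 1" by (intro LIMSEQ_le_const2[of "\<lambda>n. cmod (?g (s n))"]) auto
      qed
    qed
  qed
  then show "log_plus (cmod (f z)) \<le> h z" using le_iff[OF z] by simp
qed

lemma bdd_below_majorants:
  "bdd_below {h 0 | h. h \<in> Har_plus \<and> (\<forall>z\<in>\<Lambda>. ln (1 + cmod (f z)) \<le> h z)}"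
  by (rule bdd_belowI[of _ 0]) (auto simp: Har_plus_def)

text \<open>A majorant of \<open>log (1 + |f|)\<close> on \<open>\<Lambda>\<close> is a majorant of \<open>log\<^sup>+ |f|\<close> on the disc, hence becomes a
  majorant of \<open>log (1 + |f|)\<close> there after adding \<open>log 2\<close>.\<close>

theorem strongly_sampling_imp_sampling:
  assumes \<Lambda>: "\<Lambda> \<subseteq> unit_disk" and S: "strongly_sampling_Smirnov \<Lambda>"
  shows "sampling_Smirnov \<Lambda>"
  unfolding sampling_Smirnov_def
proof (intro exI[of _ "ln 2"] conjI ballI)
  fix f assume f: "f \<in> Smirnov"
  let ?S = "\<lambda>\<Lambda>. {h 0 | h. h \<in> Har_plus \<and> (\<forall>z\<in>\<Lambda>. ln (1 + cmod (f z)) \<le> h z)}"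
  have sub: "?S unit_disk \<subseteq> ?S \<Lambda>" using \<Lambda> by blast
  have shift: "x + ln 2 \<in> ?S unit_disk" if x: "x \<in> ?S \<Lambda>" for x
  proof -
    obtain h where h: "h \<in> Har_plus" "\<forall>z\<in>\<Lambda>. ln (1 + cmod (f z)) \<le> h z" "x = h 0" using x by blast
    have "\<forall>z\<in>\<Lambda>. log_plus (cmod (f z)) \<le> h z" using h(2) log_plus_le_ln_1[OF norm_ge_zero] order_trans by blast
    then have "log_plus (cmod (f z)) \<le> h z" if "z \<in> unit_disk" for z
      using S f h(1) that unfolding strongly_sampling_Smirnov_def by blast
    then have "\<forall>z\<in>unit_disk. ln (1 + cmod (f z)) \<le> h z + ln 2"
      using ln_1_le_log_plus[OF norm_ge_zero] by (smt (verit))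
    then show ?thesis using Har_plus_add_const[OF h(1), of "ln 2"] h(3) by auto
  qed
  show "Nev_size f \<le> Nev_size_on f \<Lambda> + ln 2"
    \<comment> \<open>Without majorants both infima are taken over the empty set and agree.\<close>
  proof (cases "?S \<Lambda> = {}")
    case True
    then have "?S unit_disk = ?S \<Lambda>" using sub by blast
    then show ?thesis unfolding Nev_size_def Nev_size_on_def by simp
  next
    case False
    have "Inf (?S unit_disk) - ln 2 \<le> Inf (?S \<Lambda>)"
    proof (rule cInf_greatest[OF False])
      fix x assume "x \<in> ?S \<Lambda>"
      then have "Inf (?S unit_disk) \<le> x + ln 2" by (intro cInf_lower shift bdd_below_majorants)
      then show "Inf (?S unit_disk) - ln 2 \<le> x" by simp
    qed
    then show ?thesis unfolding Nev_size_def Nev_size_on_def by simp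
  qed
qed simp

text \<open>Suppose \<open>|f| \<le> M\<close> on \<open>\<Lambda>\<close> but \<open>|f w| > M\<close>. The powers \<open>(f / M)\<^sup>n\<close> are bounded by \<open>1\<close> on \<open>\<Lambda>\<close>, while a
  majorant of \<open>log (1 + |f / M|\<^sup>n)\<close> on the disc is at least \<open>n log (|f w| / M)\<close> at \<open>w\<close>, and by
  Harnack's inequality its value at \<open>0\<close> grows linearly in \<open>n\<close> as well.\<close>

theorem sampling_imp_determination:
  assumes \<Lambda>: "\<Lambda> \<subseteq> unit_disk" and S: "sampling_Smirnov \<Lambda>"
  shows "determination_Smirnov \<Lambda>"
  unfolding determination_Smirnov_def
proof (intro ballI impI, rule ccontr)
  fix f assume f: "f \<in> Smirnov" and bd: "bounded (f ` \<Lambda>)" and ub: "\<not> bounded (f ` unit_disk)"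
  obtain C where C: "\<And>f. f \<in> Smirnov \<Longrightarrow> Nev_size f \<le> Nev_size_on f \<Lambda> + C"
    using S by (auto simp: sampling_Smirnov_def)
  have hf: "f holomorphic_on unit_disk" using f by (simp add: Smirnov_def Nevanlinna_def)
  obtain M0 where M0: "\<And>z. z \<in> \<Lambda> \<Longrightarrow> cmod (f z) \<le> M0" using bd by (auto simp: bounded_iff)
  define M where "M = max 1 M0"
  have M: "1 \<le> M" "\<And>z. z \<in> \<Lambda> \<Longrightarrow> cmod (f z) \<le> M" using M0 by (auto simp: M_def intro: max.coboundedI2)
  obtain w where w: "w \<in> unit_disk" "M < cmod (f w)" using ub by (fastforce simp: bounded_iff not_le)
  define a where "a = ln (cmod (f w) / M)"
  have "1 < cmod (f w) / M" using w M by (simp add: less_divide_eq)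
  note ratio = this
  have a: "0 < a" unfolding a_def by (rule ln_gt_zero[OF ratio])
  define K where "K = (1 + cmod w) / (1 - cmod w)"
  have K: "0 < K" using w by (auto simp: K_def intro!: divide_pos_pos add_pos_nonneg)
  define F where "F n z = (f z / of_real M) ^ n" for n z
  have nF: "cmod (F n z) = (cmod (f z) / M) ^ n" for n z using M by (simp add: F_def norm_power norm_divide)
  have lF: "log_plus (cmod (F n z)) \<le> real n * log_plus (cmod (f z))" for n z
  proof -
    have "cmod (f z) / M \<le> cmod (f z)" using M by (simp add: divide_le_eq mult_left_le_one_le mult_right_le_one_le mult_le_cancel_left1)
    then show ?thesis unfolding nF using M by (subst log_plus_power) (auto intro!: mult_left_mono log_plus_mono)
  qed
  have hF: "F n holomorphic_on unit_disk" for n unfolding F_def using hf M by (intro holomorphic_intros) auto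
  have bound: "real n * a / K \<le> ln 2 + C" for n
  proof -
    obtain H where Fn: "F n \<in> Smirnov" and H: "has_majorant (F n) (\<lambda>z. of_real (real n) * H z)"
      using Smirnov_dominated[OF f hF[of n] _ lF] by (metis of_nat_0_le_iff)
    let ?S = "\<lambda>\<Lambda>. {h 0 | h. h \<in> Har_plus \<and> (\<forall>z\<in>\<Lambda>. ln (1 + cmod (F n z)) \<le> h z)}"
    have "Inf (?S \<Lambda>) \<le> ln 2"
    proof (rule cInf_lower[OF _ bdd_below_majorants])
      have "cmod (F n z) \<le> 1" if "z \<in> \<Lambda>" for z unfolding nF using M that by (intro power_le_one) auto
      then have "ln (1 + cmod (F n z)) \<le> ln 2" if "z \<in> \<Lambda>" for z
        using that by (subst ln_le_cancel_iff) (auto intro: add_pos_nonneg)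
      then show "ln 2 \<in> ?S \<Lambda>" using Har_plus_const[of "ln 2"] by auto
    qed
    moreover have "real n * a / K \<le> Inf (?S unit_disk)"
    proof (rule cInf_greatest)
      have "(\<lambda>z. Re (of_real (real n) * H z) + ln 2) \<in> Har_plus"
        by (intro Har_plus_add_const Re_holomorphic_Har_plus has_majorant_nonneg[OF H])
          (use H in \<open>auto simp: has_majorant_def\<close>)
      moreover have "ln (1 + cmod (F n z)) \<le> Re (of_real (real n) * H z) + ln 2" if "z \<in> unit_disk" for z
        using H that ln_1_le_log_plus[of "cmod (F n z)"] unfolding has_majorant_def by fastforce
      ultimately show "?S unit_disk \<noteq> {}" by blast
      fix x assume "x \<in> ?S unit_disk"
      then obtain h where h: "h \<in> Har_plus" "\<forall>z\<in>unit_disk. ln (1 + cmod (F n z)) \<le> h z" "x = h 0" by blast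
      have q: "0 < cmod (f w) / M" using ratio by linarith
      have "real n * a = ln (cmod (F n w))" unfolding nF a_def using q by (simp add: ln_realpow)
      also have "\<dots> \<le> ln (1 + cmod (F n w))" unfolding nF using q by (subst ln_le_cancel_iff) (auto intro: add_pos_pos)
      also have "\<dots> \<le> h w" using h w by blast
      also have "\<dots> \<le> K * h 0" unfolding K_def by (rule Har_plus_harnack[OF h(1) w(1)])
      finally show "real n * a / K \<le> x" using K h(3) by (simp add: field_simps)
    qed
    ultimately show ?thesis using C[OF Fn] unfolding Nev_size_def Nev_size_on_def by linarith
  qed
  obtain n :: nat where "(ln 2 + C) / (a / K) < real n" using reals_Archimedean2 by blast
  then have "ln 2 + C < real n * (a / K)" using a K by (subst (asm) pos_divide_less_eq) auto
  then show False using bound[of n] by simp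
qed

section \<open>Harmonic measure and determining sets\<close>

text \<open>For each boundary point outside \<open>NT \<Lambda>\<close> the points of \<open>\<Lambda>\<close> near the circle avoid a truncated Stolz
  angle. Making the truncation uniform exhausts these points by countably many closed sets, one of
  which is not negligible.\<close>

lemma not_full_NT_compact:
  assumes \<Lambda>: "\<Lambda> \<subseteq> unit_disk" and N: "arc_length (NT \<Lambda>) \<noteq> 2 * pi"
  obtains K r0 c where "compact K" "K \<subseteq> {0..2*pi}" "\<not> negligible K" "0 \<le> r0" "r0 < 1"
    "0 \<le> c" "c \<le> pi" "K \<inter> {c<..<c + pi} = {}"
    "\<And>l \<theta>. l \<in> \<Lambda> \<Longrightarrow> r0 < cmod l \<Longrightarrow> \<theta> \<in> K \<Longrightarrow> 2 * (1 - cmod l) \<le> cmod (l - cis \<theta>)"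
proof -
  define E where "E n = {\<theta>. \<forall>l\<in>\<Lambda>. 1 - 1 / (real n + 1) < cmod l \<longrightarrow> 2 * (1 - cmod l) \<le> cmod (l - cis \<theta>)}" for n :: nat
  have cE: "closed (E n)" for n
  proof -
    have "E n = (\<Inter>l\<in>{l\<in>\<Lambda>. 1 - 1 / (real n + 1) < cmod l}. {\<theta>. 2 * (1 - cmod l) \<le> cmod (l - cis \<theta>)})"
      unfolding E_def by auto
    also have "closed \<dots>" by (intro closed_INT ballI closed_Collect_le continuous_intros)
    finally show ?thesis .
  qed
  \<comment> \<open>Outside all the \<open>E n\<close> there are points of \<open>\<Lambda>\<close> approaching \<open>cis \<theta>\<close> in the Stolz angle of aperture \<open>2\<close>.\<close>
  have "\<exists>n. \<not> negligible (E n \<inter> {0..2*pi})"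
  proof (rule ccontr)
    assume "\<not> ?thesis"
    then have "negligible (\<Union>n. E n \<inter> {0..2*pi})" by (intro negligible_Union_nat) auto
    moreover let ?A = "{\<theta> \<in> {0..<2*pi}. cis \<theta> \<in> NT \<Lambda>}"
    have "{0..<2*pi} - ?A \<subseteq> (\<Union>n. E n \<inter> {0..2*pi})"
    proof (rule subsetI, rule ccontr)
      fix \<theta> assume \<theta>: "\<theta> \<in> {0..<2*pi} - ?A" and "\<theta> \<notin> (\<Union>n. E n \<inter> {0..2*pi})"
      then have "\<forall>n. \<exists>l\<in>\<Lambda>. 1 - 1 / (real n + 1) < cmod l \<and> cmod (l - cis \<theta>) < 2 * (1 - cmod l)"
        unfolding E_def by (auto simp: not_le)
      then obtain s where s: "\<And>n. s n \<in> \<Lambda>" "\<And>n. 1 - 1 / (real n + 1) < cmod (s n)"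
         "\<And>n. cmod (s n - cis \<theta>) < 2 * (1 - cmod (s n))" by metis
      have "(\<lambda>n. s n - cis \<theta>) \<longlonglongrightarrow> 0"
      proof (rule Lim_null_comparison)
        show "\<forall>\<^sub>F n in sequentially. norm (s n - cis \<theta>) \<le> 2 * (1 / real (n + 1))"
        proof (intro always_eventually allI)
          fix n show "norm (s n - cis \<theta>) \<le> 2 * (1 / real (n + 1))" using s(2)[of n] s(3)[of n] by (simp add: add.commute)
        qed
        have "(\<lambda>n. 1 / real (n + 1)) \<longlonglongrightarrow> 0" by (rule LIMSEQ_ignore_initial_segment[OF lim_1_over_n])
        then show "(\<lambda>n. 2 * (1 / real (n + 1))) \<longlonglongrightarrow> 0" by (rule tendsto_mult_right_zero)
      qed
      then have "s \<longlonglongrightarrow> cis \<theta>" by (rule LIM_zero_cancel)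
      moreover have "s n \<in> \<Lambda> \<inter> Stolz 2 (cis \<theta>)" for n
        using s(1)[of n] s(3)[of n] \<Lambda> by (auto simp: Stolz_def)
      ultimately have "cis \<theta> \<in> NT \<Lambda>" unfolding NT_def by (auto intro!: exI[of _ 2] exI[of _ s])
      then show False using \<theta> by auto
    qed
    ultimately have "negligible ({0..<2*pi} - ?A)" by (rule negligible_subset)
    then have n0: "{0..<2*pi} - ?A \<in> null_sets lebesgue" by (simp add: negligible_iff_null_sets)
    have "?A = {0..<2*pi} - ({0..<2*pi} - ?A)" by auto
    then have "measure lebesgue ?A = measure lebesgue ({0..<2*pi} - ({0..<2*pi} - ?A))" by simp
    also have "\<dots> = measure lebesgue {0..<2*pi}" by (rule measure_Diff_null_set[OF _ n0]) auto
    also have "\<dots> = 2*pi" by simp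
    finally show False using N by (simp add: arc_length_def)
  qed
  then obtain n where n: "\<not> negligible (E n \<inter> {0..2*pi})" by blast
  \<comment> \<open>Keeping only a half circle leaves an arc free of \<open>K\<close>.\<close>
  have "E n \<inter> {0..2*pi} \<subseteq> (E n \<inter> {0..pi}) \<union> (E n \<inter> {pi..2*pi})" by auto
  then have or: "\<not> negligible (E n \<inter> {0..pi}) \<or> \<not> negligible (E n \<inter> {pi..2*pi})"
    using n negligible_subset negligible_Un by blast
  have r: "0 \<le> 1 - 1 / (real n + 1)" "1 - 1 / (real n + 1) < 1" by (auto simp: field_simps)
  have p: "2 - 2 * cmod l \<le> cmod (l - cis \<theta>)" if "l \<in> \<Lambda>" "1 - 1 / (real n + 1) < cmod l" "\<theta> \<in> E n" for l \<theta>
    using that by (auto simp: E_def)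
  from or show ?thesis
  proof
    assume "\<not> negligible (E n \<inter> {0..pi})"
    then show ?thesis
      by (intro that[of "E n \<inter> {0..pi}" "1 - 1 / (real n + 1)" pi] r closed_Int_compact cE) (auto intro: p)
  next
    assume "\<not> negligible (E n \<inter> {pi..2*pi})"
    then show ?thesis
      by (intro that[of "E n \<inter> {pi..2*pi}" "1 - 1 / (real n + 1)" 0] r closed_Int_compact cE) (auto intro: p)
  qed
qed

definition harmonic_measure :: "real set \<Rightarrow> complex \<Rightarrow> real" where
  "harmonic_measure K z = 1 / (2*pi) * (LINT t|circ. poisson z t * indicator K t)"

lemma circ_indicator_integrable:
  assumes "K \<in> sets lebesgue" shows "integrable circ (indicator K :: real \<Rightarrow> real)"
proof -
  interpret finite_measure circ by (rule finite_measure_circ)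
  have "indicator K \<in> borel_measurable circ"
    by (rule measurable_restrict_space1) (use assms in measurable)
  then show ?thesis by (intro integrable_const_bound[of _ 1]) auto
qed

text \<open>Of the total Poisson mass \<open>2 pi\<close>, at least \<open>m (q - p)\<close> sits on an arc that misses \<open>K\<close>.\<close>

lemma harmonic_measure_le_gap:
  assumes K: "K \<in> sets lebesgue" and z: "cmod z < 1" and pq: "0 \<le> p" "p \<le> q" "q \<le> 2*pi"
    and gap: "K \<inter> {p<..<q} = {}" and m: "\<And>t. t \<in> {p<..<q} \<Longrightarrow> m \<le> poisson z t"
  shows "harmonic_measure K z \<le> 1 - m * (q - p) / (2*pi)"
proof -
  have i: "integrable circ (\<lambda>t. poisson z t * indicator K t)"
    by (rule integrable_poisson[OF z circ_indicator_integrable[OF K]])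
  have ip: "integrable circ (poisson z)" by (intro circ_continuous_integrable continuous_on_poisson z)
  have iJ: "integrable circ (\<lambda>t. m * indicator {p<..<q} t)" by (intro integrable_mult_right circ_indicator_integrable) auto
  have "(LINT t|circ. poisson z t * indicator K t) \<le> (LINT t|circ. poisson z t - m * indicator {p<..<q} t)"
  proof (rule integral_mono[OF i])
    show "integrable circ (\<lambda>t. poisson z t - m * indicator {p<..<q} t)" using ip iJ by simp
    show "poisson z t * indicator K t \<le> poisson z t - m * indicator {p<..<q} t" for t
      using gap m[of t] poisson_nonneg[OF z, of t] by (cases "t \<in> K"; cases "t \<in> {p<..<q}") auto
  qed
  also have "\<dots> = 2*pi - m * (LINT t|circ. indicator {p<..<q} t)"
    using ip iJ by (subst Bochner_Integration.integral_diff) (auto simp: poisson_mass[OF z])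
  also have "(LINT t|circ. indicator {p<..<q} t) = q - p"
  proof -
    have "(LINT t|circ. indicator {p<..<q} t) = measure circ ({p<..<q} \<inter> space circ)"
      by (rule Bochner_Integration.integral_indicator)
    also have "{p<..<q} \<inter> space circ = {p<..<q}" using pq by auto
    also have "measure circ {p<..<q} = q - p" using pq by (subst measure_restrict_space) auto
    finally show ?thesis .
  qed
  finally show ?thesis unfolding harmonic_measure_def by (simp add: field_simps)
qed

text \<open>If \<open>l\<close> lies outside the Stolz angles of aperture \<open>2\<close> at the points of \<open>K\<close>, then \<open>K\<close> misses the arc of
  half-length \<open>1 - |l|\<close> centred at the radial projection of \<open>l\<close>, and this arc carries a fixed share of
  the Poisson mass.\<close>

lemma harmonic_measure_le_off_tents:
  assumes K: "K \<in> sets lebesgue" and l: "cmod l < 1" "l \<noteq> 0"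
    and off: "\<And>\<theta>. \<theta> \<in> K \<Longrightarrow> 2 * (1 - cmod l) \<le> cmod (l - cis \<theta>)"
  shows "harmonic_measure K l \<le> 1 - 1 / (8*pi)"
proof -
  define \<delta> where "\<delta> = 1 - cmod l"
  define \<alpha> where "\<alpha> = Arg2pi l"
  have \<delta>: "0 < \<delta>" "\<delta> < 1" using l by (auto simp: \<delta>_def)
  have \<alpha>: "0 \<le> \<alpha>" "\<alpha> < 2*pi" "l = of_real (cmod l) * cis \<alpha>"
    using Arg2pi[of l] unfolding \<alpha>_def cis_conv_exp is_Arg_def by auto
  have near: "cmod (l - cis t) < 2 * \<delta>" if "\<bar>\<alpha> - t\<bar> < \<delta>" for t
  proof -
    have "cmod (l - cis \<alpha>) = \<delta>" by (subst \<alpha>(3), subst cmod_radial_diff) (use l in \<open>simp add: \<delta>_def\<close>)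
    moreover have "cmod (l - cis t) \<le> cmod (l - cis \<alpha>) + cmod (cis \<alpha> - cis t)"
      by (rule order_trans[OF _ norm_triangle_ineq]) simp
    ultimately show ?thesis using chord_le[of \<alpha> t] that by simp
  qed
  have P: "1 / (4 * \<delta>) \<le> poisson l t" if "\<bar>\<alpha> - t\<bar> < \<delta>" for t
  proof -
    have "(cmod (cis t - l))\<^sup>2 \<le> (2 * \<delta>)\<^sup>2" using near[OF that] by (intro power_mono) (auto simp: norm_minus_commute)
    moreover have "\<delta> \<le> 1 - (cmod l)\<^sup>2" unfolding one_minus_square \<delta>_def[symmetric] using \<delta> by (simp add: mult_le_cancel_left1)
    moreover have "0 < (cmod (cis t - l))\<^sup>2" using cis_diff_nonzero[OF l(1)] by simp
    ultimately have "\<delta> / (2 * \<delta>)\<^sup>2 \<le> poisson l t" unfolding poisson_def using \<delta> by (intro frac_le) auto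
    then show ?thesis using \<delta> by (simp add: power2_eq_square)
  qed
  have notK: "t \<notin> K" if "\<bar>\<alpha> - t\<bar> < \<delta>" for t using near[OF that] off[of t] unfolding \<delta>_def by force
  \<comment> \<open>One of the two half arcs at \<open>\<alpha>\<close> of length \<open>\<delta> < 1\<close> lies in the parameter interval.\<close>
  have "\<exists>p q. 0 \<le> p \<and> q = p + \<delta> \<and> q \<le> 2*pi \<and> (\<forall>t\<in>{p<..<q}. \<bar>\<alpha> - t\<bar> < \<delta>)"
  proof (cases "\<alpha> \<le> pi")
    case True
    then show ?thesis using \<alpha> \<delta> pi_ge_two by (intro exI[of _ \<alpha>] exI[of _ "\<alpha> + \<delta>"]) auto
  next
    case False
    then show ?thesis using \<alpha> \<delta> pi_ge_two by (intro exI[of _ "\<alpha> - \<delta>"] exI[of _ \<alpha>]) auto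
  qed
  then obtain p where p: "0 \<le> p" "p + \<delta> \<le> 2*pi" "\<And>t. t \<in> {p<..<p + \<delta>} \<Longrightarrow> \<bar>\<alpha> - t\<bar> < \<delta>" by blast
  have "harmonic_measure K l \<le> 1 - 1 / (4 * \<delta>) * (p + \<delta> - p) / (2*pi)"
    by (rule harmonic_measure_le_gap[OF K l(1)]) (use p \<delta> P notK in auto)
  then show ?thesis using \<delta> by simp
qed

lemma circle_neighbourhood_measurable:
  "{t \<in> {0..2*pi}. infdist (cis t) S < d} \<in> sets lebesgue"
proof -
  have "open {t. infdist (cis t) S < d}" by (intro open_Collect_less continuous_intros)
  then have "{0..2*pi} \<inter> {t. infdist (cis t) S < d} \<in> sets lebesgue" by auto
  moreover have "{t \<in> {0..2*pi}. infdist (cis t) S < d} = {0..2*pi} \<inter> {t. infdist (cis t) S < d}" by auto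
  ultimately show ?thesis by simp
qed

text \<open>The Poisson kernel is symmetric, so integrating the harmonic measure of \<open>K\<close> over \<open>Od\<close> at radius
  \<open>r\<close> is the same as integrating that of \<open>Od\<close> over \<open>K\<close>. The former is at most \<open>2 pi s |Od|\<close>; the latter
  tends to \<open>2 pi |K|\<close> as \<open>r\<close> tends to \<open>1\<close>, because \<open>Od\<close> is a neighbourhood of \<open>K\<close>.\<close>

lemma measure_le_of_harmonic_measure_le:
  assumes K: "compact K" "K \<subseteq> {0..2*pi}" and s: "\<And>z. z \<in> unit_disk \<Longrightarrow> harmonic_measure K z \<le> s"
    and d: "0 < d" and Od: "Od = {t \<in> {0..2*pi}. infdist (cis t) (cis ` K) < d}"
  shows "measure circ K \<le> s * measure circ Od"
proof -
  interpret finite_measure circ by (rule finite_measure_circ)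
  interpret pair_sigma_finite circ circ ..
  have idm: "(\<lambda>x. x) \<in> borel_measurable circ" by (intro circ_continuous_measurable continuous_intros)
  have "closed K" using K compact_imp_closed by blast
  then have Km: "K \<in> sets lebesgue" by auto
  then have Kc[measurable]: "K \<in> sets circ" using K by (auto simp: sets_restrict_space_iff)
  have Om: "Od \<in> sets lebesgue" unfolding Od by (rule circle_neighbourhood_measurable)
  then have Oc[measurable]: "Od \<in> sets circ" unfolding Od by (auto simp: sets_restrict_space_iff)
  \<comment> \<open>Both sides of Fubini's theorem for the Poisson kernel on \<open>Od \<times> K\<close> at radius \<open>r\<close>.\<close>
  have step: "measure circ K * (1 - 8 * (1 - r) / d\<^sup>2) \<le> s * measure circ Od" if r: "0 < r" "r < 1" "1 - r \<le> d/2" for r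
  proof -
    define k where "k \<theta> t = indicator Od \<theta> * indicator K t * poisson (of_real r * cis \<theta>) t" for \<theta> t
    have zr: "cmod (of_real r * cis \<theta>) < 1" for \<theta> using r by (simp add: norm_mult)
    have fstm[measurable]: "(\<lambda>x. fst x) \<in> borel_measurable (circ \<Otimes>\<^sub>M circ)" by (rule measurable_compose[OF measurable_fst idm])
    have sndm[measurable]: "(\<lambda>x. snd x) \<in> borel_measurable (circ \<Otimes>\<^sub>M circ)" by (rule measurable_compose[OF measurable_snd idm])
    have cism[measurable]: "cis \<in> borel_measurable borel" by (intro borel_measurable_continuous_onI continuous_intros)
    have km: "(\<lambda>x. k (fst x) (snd x)) \<in> borel_measurable (circ \<Otimes>\<^sub>M circ)"
      unfolding k_def poisson_def by measurable
    have kint: "integrable (circ \<Otimes>\<^sub>M circ) (case_prod k)"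
    proof -
      interpret P: finite_measure "circ \<Otimes>\<^sub>M circ" by (rule finite_measure_pair_measure) unfold_locales
      have "\<bar>k a b\<bar> \<le> (1 + r) / (1 - r)" for a b
      proof -
        have "poisson (of_real r * cis a) b \<le> (1 + r) / (1 - r)" using poisson_le[OF zr, of a b] r by (simp add: norm_mult)
        moreover have "0 \<le> (1 + r) / (1 - r)" using r by simp
        ultimately show ?thesis using poisson_nonneg[OF zr, of a b] unfolding k_def indicator_def by auto
      qed
      then show ?thesis using km by (intro P.integrable_const_bound[of _ "(1 + r) / (1 - r)"]) (auto simp: case_prod_beta')
    qed
    have fub: "(LINT t|circ. LINT \<theta>|circ. k \<theta> t) = (LINT \<theta>|circ. LINT t|circ. k \<theta> t)"
      by (rule Fubini_integral[OF kint])
    have iO: "integrable circ (indicator Od :: real \<Rightarrow> real)" and iK: "integrable circ (indicator K :: real \<Rightarrow> real)"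
      by (intro circ_indicator_integrable Om Km)+
    have "(LINT \<theta>|circ. LINT t|circ. k \<theta> t) \<le> (LINT \<theta>|circ. 2*pi * s * indicator Od \<theta>)"
    proof (rule integral_mono)
      show "integrable circ (\<lambda>\<theta>. LINT t|circ. k \<theta> t)" using integrable_fst'[OF kint] by simp
      show "integrable circ (\<lambda>\<theta>. 2*pi * s * indicator Od \<theta>)" using iO by (rule integrable_mult_right)
      fix \<theta>
      have "(LINT t|circ. k \<theta> t) = indicator Od \<theta> * (LINT t|circ. poisson (of_real r * cis \<theta>) t * indicator K t)"
      proof -
        have "k \<theta> = (\<lambda>t. indicator Od \<theta> * (poisson (of_real r * cis \<theta>) t * indicator K t))"
          unfolding k_def by (intro ext) simp
        then show ?thesis by simp
      qed
      moreover have "(LINT t|circ. poisson (of_real r * cis \<theta>) t * indicator K t) \<le> 2*pi * s"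
        using s[of "of_real r * cis \<theta>"] zr[of \<theta>] unfolding harmonic_measure_def by (simp add: field_simps)
      ultimately show "(LINT t|circ. k \<theta> t) \<le> 2*pi * s * indicator Od \<theta>"
        by (simp add: mult.commute[of "2 * pi * s"] mult_left_mono)
    qed
    also have "\<dots> = 2*pi * s * measure circ (Od \<inter> {0..2*pi})" by simp
    also have "Od \<inter> {0..2*pi} = Od" unfolding Od by auto
    finally have up: "(LINT \<theta>|circ. LINT t|circ. k \<theta> t) \<le> 2*pi * s * measure circ Od" .
    define m where "m = 8 * (1 - r) / d\<^sup>2"
    have "K \<inter> {0..2*pi} = K" using K by auto
    then have "2*pi * (1 - m) * measure circ K = (LINT t|circ. 2*pi * (1 - m) * indicator K t)" by simp
    also have "\<dots> \<le> (LINT t|circ. LINT \<theta>|circ. k \<theta> t)"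
    proof (rule integral_mono)
      show "integrable circ (\<lambda>t. LINT \<theta>|circ. k \<theta> t)" by (rule integrable_snd[OF kint])
      show "integrable circ (\<lambda>t. 2*pi * (1 - m) * indicator K t)" using iK by (rule integrable_mult_right)
      fix t
      show "2*pi * (1 - m) * indicator K t \<le> (LINT \<theta>|circ. k \<theta> t)"
      proof (cases "t \<in> K")
        case True
        let ?z = "of_real r * cis t"
        have ip: "integrable circ (poisson ?z)" by (intro circ_continuous_integrable continuous_on_poisson zr)
        have "(LINT \<theta>|circ. k \<theta> t) = (LINT \<theta>|circ. poisson ?z \<theta> * indicator Od \<theta>)"
        proof -
          have "(\<lambda>\<theta>. k \<theta> t) = (\<lambda>\<theta>. poisson ?z \<theta> * indicator Od \<theta>)"
            unfolding k_def using True by (intro ext) (subst poisson_symmetric, simp)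
          then show ?thesis by simp
        qed
        also have "\<dots> \<ge> (LINT \<theta>|circ. poisson ?z \<theta> - m)"
        proof (rule integral_mono)
          show "integrable circ (\<lambda>\<theta>. poisson ?z \<theta> - m)" using ip by simp
          show "integrable circ (\<lambda>\<theta>. poisson ?z \<theta> * indicator Od \<theta>)" by (rule integrable_poisson[OF zr iO])
          fix \<theta> assume \<theta>: "\<theta> \<in> space circ"
          have m0: "0 \<le> m" using r d by (simp add: m_def)
          show "poisson ?z \<theta> - m \<le> poisson ?z \<theta> * indicator Od \<theta>"
          proof (cases "\<theta> \<in> Od")
            case False
            then have "d \<le> infdist (cis \<theta>) (cis ` K)" using \<theta> unfolding Od by auto
            also have "\<dots> \<le> cmod (cis \<theta> - cis t)" using True infdist_le[of "cis t" "cis ` K" "cis \<theta>"] by (simp add: dist_norm)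
            finally have "poisson ?z \<theta> \<le> m" unfolding m_def using r d by (intro poisson_le_away) auto
            then show ?thesis using False by simp
          qed (use m0 in simp)
        qed
        moreover have "(LINT \<theta>|circ. poisson ?z \<theta> - m) = 2*pi - 2*pi * m"
          using ip by (subst Bochner_Integration.integral_diff) (auto simp: poisson_mass[OF zr] measure_circ[simplified])
        ultimately show ?thesis using True by (simp add: algebra_simps)
      qed (simp add: k_def)
    qed
    finally have "2*pi * (1 - m) * measure circ K \<le> 2*pi * s * measure circ Od" using fub up by linarith
    then have "2*pi * ((1 - m) * measure circ K) \<le> 2*pi * (s * measure circ Od)" by (simp only: mult.assoc)
    then have "(1 - m) * measure circ K \<le> s * measure circ Od" by (subst (asm) mult_le_cancel_left_pos) auto
    then show ?thesis unfolding m_def by (simp only: mult.commute[of "measure circ K"])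
  qed
  have "(\<lambda>n. measure circ K * (1 - 8 * (1 - radius n) / d\<^sup>2)) \<longlonglongrightarrow> measure circ K * (1 - 8 * (1 - 1) / d\<^sup>2)"
    using d by (intro tendsto_intros radius_tendsto) auto
  moreover have "\<forall>\<^sub>F n in sequentially. measure circ K * (1 - 8 * (1 - radius n) / d\<^sup>2) \<le> s * measure circ Od"
  proof -
    have "\<forall>\<^sub>F n in sequentially. 1 - d/2 < radius n" by (rule order_tendstoD[OF radius_tendsto]) (use d in simp)
    then show ?thesis by eventually_elim (rule step[OF radius_pos radius_less], simp)
  qed
  ultimately have "measure circ K * (1 - 8 * (1 - 1) / d\<^sup>2) \<le> s * measure circ Od"
    by (rule tendsto_upperbound) simp
  then show ?thesis by simp
qed

text \<open>Otherwise \<open>|K| \<le> s |U|\<close> for every circle neighbourhood \<open>U\<close> of \<open>K\<close> by the previous lemma, hence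
  \<open>|K| \<le> s |K|\<close> with \<open>s < 1\<close>, although \<open>|K| > 0\<close>.\<close>

lemma harmonic_measure_gets_near_one:
  assumes K: "compact K" "K \<subseteq> {0..2*pi}" "\<not> negligible K" and s: "s < 1"
  shows "\<exists>z\<in>unit_disk. s < harmonic_measure K z"
proof (rule ccontr)
  assume "\<not> ?thesis"
  then have "harmonic_measure K z \<le> max s 0" if "z \<in> unit_disk" for z
    using that by (metis le_max_iff_disj not_le)
  note key = measure_le_of_harmonic_measure_le[OF K(1,2) this _ refl]
  interpret finite_measure circ by (rule finite_measure_circ)
  have "closed K" using K compact_imp_closed by blast
  then have Km: "K \<in> sets lebesgue" by auto
  then have Kc: "K \<in> sets circ" using K by (auto simp: sets_restrict_space_iff)
  define Od where "Od n = {t \<in> {0..2*pi}. infdist (cis t) (cis ` K) < 1 / (real n + 1)}" for n :: nat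
  have Oc: "Od n \<in> sets circ" for n
  proof -
    have "Od n \<in> sets lebesgue" unfolding Od_def by (rule circle_neighbourhood_measurable)
    moreover have "Od n \<subseteq> {0..2*pi}" unfolding Od_def by auto
    ultimately show ?thesis by (simp add: sets_restrict_space_iff)
  qed
  have "K \<noteq> {}" using K by auto
  have dec: "decseq Od"
    unfolding decseq_def
  proof (intro allI impI subsetI)
    fix m n :: nat and t assume mn: "m \<le> n" and "t \<in> Od n"
    moreover have "1 / (real n + 1) \<le> 1 / (real m + 1)" using mn by (intro frac_le) auto
    ultimately show "t \<in> Od m" unfolding Od_def by auto
  qed
  have "(\<lambda>n. measure circ (Od n)) \<longlonglongrightarrow> measure circ (\<Inter>n. Od n)"
    by (rule finite_Lim_measure_decseq) (use Oc dec in auto)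
  then have "(\<lambda>n. max s 0 * measure circ (Od n)) \<longlonglongrightarrow> max s 0 * measure circ (\<Inter>n. Od n)" by (intro tendsto_intros)
  moreover have "measure circ K \<le> max s 0 * measure circ (Od n)" for n unfolding Od_def by (rule key) (assumption, intro divide_pos_pos add_nonneg_pos, simp_all)
  ultimately have le: "measure circ K \<le> max s 0 * measure circ (\<Inter>n. Od n)" by (intro LIMSEQ_le_const) auto
  \<comment> \<open>\<open>cis\<close> identifies the two ends of the parameter interval and is injective otherwise.\<close>
  have "(\<Inter>n. Od n) \<subseteq> K \<union> {0, 2*pi}"
  proof
    fix t assume t: "t \<in> (\<Inter>n. Od n)"
    then have t01: "0 \<le> t" "t \<le> 2*pi" and small: "infdist (cis t) (cis ` K) < 1 / (real n + 1)" for n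
      unfolding Od_def by auto
    have "infdist (cis t) (cis ` K) = 0"
    proof (rule ccontr)
      assume "\<not> ?thesis"
      then have "0 < infdist (cis t) (cis ` K)" using infdist_nonneg[of "cis t"] by (simp add: less_le)
      then obtain n :: nat where "1 / real (Suc n) < infdist (cis t) (cis ` K)" using nat_approx_posE by blast
      then show False using small[of n] by (simp add: add.commute)
    qed
    moreover have "closed (cis ` K)" by (intro compact_imp_closed compact_continuous_image continuous_intros K)
    ultimately have "cis t \<in> cis ` K" using in_closed_iff_infdist_zero \<open>K \<noteq> {}\<close> by blast
    then obtain k where k: "k \<in> K" "cis t = cis k" by blast
    then have "sin t = sin k \<and> cos t = cos k" by (metis cis.sel)
    then obtain n :: int where n: "t = k + 2 * pi * n" unfolding sin_cos_eq_iff by blast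
    have k01: "0 \<le> k" "k \<le> 2*pi" using k K by auto
    have "2 * pi * n \<le> 2 * pi * 1" "2 * pi * (-1) \<le> 2 * pi * n" using n t01 k01 by linarith+
    moreover have "0 < 2 * pi" by simp
    ultimately have "real_of_int n \<le> 1" "-1 \<le> real_of_int n"
      by (simp_all only: mult_le_cancel_left_pos)
    then have "-1 \<le> n" "n \<le> 1" by linarith+
    then consider "n = 0" | "n = 1" | "n = -1" by linarith
    then show "t \<in> K \<union> {0, 2*pi}"
    proof cases
      case 1 then show ?thesis using n k by simp
    next
      case 2 then have "t = k + 2*pi" using n by simp
      then show ?thesis using t01 k01 by auto
    next
      case 3 then have "t = k - 2*pi" using n by simp
      then show ?thesis using t01 k01 by auto
    qed
  qed
  moreover have N: "{0, 2*pi} \<in> null_sets circ" by (subst null_sets_restrict_space) (auto intro: negligible_imp_sets simp flip: negligible_iff_null_sets)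
  ultimately have "measure circ (\<Inter>n. Od n) \<le> measure circ K"
    using finite_measure_mono[of "\<Inter>n. Od n" "K \<union> {0, 2*pi}"] Kc
    unfolding measure_Un_null_set[OF Kc N] by (simp only: sets.Un[OF Kc null_setsD2[OF N]])
  then have "measure circ K \<le> max s 0 * measure circ K" using le by (meson max.cobounded2 mult_left_mono order_trans)
  moreover have "0 < measure circ K"
  proof -
    have "measure circ K = measure lebesgue K" using K Km by (subst measure_restrict_space) auto
    moreover have "K \<in> lmeasurable" using K(1) lmeasurable_compact by blast
    ultimately show ?thesis using K(3) negligible_iff_measure[of K] by (metis zero_less_measure_iff)
  qed
  ultimately show False using s by (simp add: max_def split: if_splits)
qed

text \<open>If \<open>NT \<Lambda>\<close> misses a set of positive measure, there is a \<open>K\<close> of positive measure whose harmonic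
  measure is at most \<open>1 - e\<close> on \<open>\<Lambda>\<close> and gets arbitrarily close to \<open>1\<close> on the disc. Let it be \<open>Re G\<close> and
  \<open>w = exp (G - 1)\<close>. Then \<open>|w| \<le> exp (-e)\<close> on \<open>\<Lambda>\<close>, while \<open>w\<close> has a cluster value \<open>a\<close> with \<open>|a| = 1\<close>. The
  square root of \<open>1 / (1 - cnj a w)\<close> is in the Smirnov class, bounded on \<open>\<Lambda>\<close> and unbounded.\<close>

theorem determination_imp_full_NT:
  assumes \<Lambda>: "\<Lambda> \<subseteq> unit_disk" and D: "determination_Smirnov \<Lambda>"
  shows "arc_length (NT \<Lambda>) = 2 * pi"
proof (rule ccontr)
  assume "arc_length (NT \<Lambda>) \<noteq> 2 * pi"
  then obtain K r0 c where K: "compact K" "K \<subseteq> {0..2*pi}" "\<not> negligible K" and r0: "0 \<le> r0" "r0 < 1"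
    and c: "0 \<le> c" "c \<le> pi" "K \<inter> {c<..<c + pi} = {}"
    and off: "\<And>l \<theta>. l \<in> \<Lambda> \<Longrightarrow> r0 < cmod l \<Longrightarrow> \<theta> \<in> K \<Longrightarrow> 2 * (1 - cmod l) \<le> cmod (l - cis \<theta>)"
    using not_full_NT_compact[OF \<Lambda>] by metis
  have "closed K" using K compact_imp_closed by blast
  then have Km: "K \<in> sets lebesgue" by auto
  have iK: "integrable circ (indicator K :: real \<Rightarrow> real)" by (rule circ_indicator_integrable[OF Km])
  define G where "G = herglotz (indicator K)"
  have hG: "G holomorphic_on unit_disk" unfolding G_def by (rule herglotz_holomorphic[OF iK])
  have ReG: "Re (G z) = harmonic_measure K z" if "z \<in> unit_disk" for z
    unfolding G_def harmonic_measure_def using that by (intro Re_herglotz[OF iK]) auto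
  have half: "harmonic_measure K z \<le> 1 - (1 - cmod z) / (1 + cmod z) / 2" if "z \<in> unit_disk" for z
  proof -
    have "harmonic_measure K z \<le> 1 - (1 - cmod z) / (1 + cmod z) * (c + pi - c) / (2*pi)"
      by (rule harmonic_measure_le_gap[OF Km]) (use that c poisson_ge[of z] in auto)
    then show ?thesis by simp
  qed
  \<comment> \<open>\<open>w\<close> maps the disc into itself, because the harmonic measure is below \<open>1\<close>.\<close>
  define w where "w z = exp (G z - 1)" for z
  have hw: "w holomorphic_on unit_disk" unfolding w_def using hG by (intro holomorphic_intros)
  have nw: "cmod (w z) = exp (harmonic_measure K z - 1)" if "z \<in> unit_disk" for z using ReG[OF that] by (simp add: w_def)
  have w1: "cmod (w z) < 1" if "z \<in> unit_disk" for z
  proof -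
    have "0 < (1 - cmod z) / (1 + cmod z) / 2" using that by (auto intro!: divide_pos_pos add_pos_nonneg)
    then show ?thesis unfolding nw[OF that] using half[OF that] by simp
  qed
  define e where "e = min ((1 - r0) / (1 + r0) / 2) (1 / (8*pi))"
  have e: "0 < e" using r0 by (auto simp: e_def)
  have w\<Lambda>: "cmod (w l) \<le> exp (- e)" if l: "l \<in> \<Lambda>" for l
  proof -
    have ld: "l \<in> unit_disk" "cmod l < 1" using l \<Lambda> by auto
    have "harmonic_measure K l \<le> 1 - e"
    proof (cases "r0 < cmod l")
      case True
      then have "harmonic_measure K l \<le> 1 - 1 / (8*pi)"
        using r0 ld off[OF l True] by (intro harmonic_measure_le_off_tents[OF Km]) auto
      then show ?thesis by (simp add: e_def min_def split: if_splits)
    next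
      case False
      then have "(1 - r0) / (1 + r0) \<le> (1 - cmod l) / (1 + cmod l)" using r0 ld norm_ge_zero[of l] by (intro frac_le) linarith+
      then have "(1 - r0) / (1 + r0) / 2 \<le> (1 - cmod l) / (1 + cmod l) / 2" by (rule divide_right_mono) simp
      then have "e \<le> (1 - cmod l) / (1 + cmod l) / 2" unfolding e_def by (rule min.coboundedI1)
      then show ?thesis by (rule order_trans[OF half[OF ld(1)] diff_left_mono])
    qed
    then show ?thesis unfolding nw[OF ld(1)] by simp
  qed
  \<comment> \<open>The harmonic measure gets arbitrarily close to \<open>1\<close>, so compactness yields a cluster value of \<open>w\<close> of modulus \<open>1\<close>.\<close>
  have "\<exists>z\<in>unit_disk. 1 - 1 / (real n + 1) < harmonic_measure K z" for n :: nat
    by (rule harmonic_measure_gets_near_one[OF K]) (simp add: add_nonneg_pos)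
  then obtain x where x: "\<And>n. x n \<in> unit_disk" "\<And>n::nat. 1 - 1 / (real n + 1) < harmonic_measure K (x n)" by metis
  have "w (x n) \<in> cball 0 1" for n using w1[OF x(1)] by (simp add: less_imp_le)
  then obtain a k where k: "strict_mono (k :: nat \<Rightarrow> nat)" and a: "(\<lambda>n. w (x (k n))) \<longlonglongrightarrow> a"
    using compact_cball[of "0::complex" 1] unfolding compact_def o_def by meson
  have "(\<lambda>n. harmonic_measure K (x n)) \<longlonglongrightarrow> 1"
  proof (rule tendsto_sandwich[of "\<lambda>n. 1 - 1 / real (n + 1)" _ _ "\<lambda>_. 1"])
    have "(\<lambda>n. 1 / real (n + 1)) \<longlonglongrightarrow> 0" by (rule LIMSEQ_ignore_initial_segment[OF lim_1_over_n])
    then have "(\<lambda>n. 1 - 1 / real (n + 1)) \<longlonglongrightarrow> 1 - 0" by (intro tendsto_intros)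
    then show "(\<lambda>n. 1 - 1 / real (n + 1)) \<longlonglongrightarrow> 1" by simp
    show "\<forall>\<^sub>F n in sequentially. 1 - 1 / real (n + 1) \<le> harmonic_measure K (x n)"
      by (intro always_eventually allI less_imp_le) (use x(2) in \<open>simp add: add.commute\<close>)
    show "\<forall>\<^sub>F n in sequentially. harmonic_measure K (x n) \<le> 1"
    proof (intro always_eventually allI)
      fix n show "harmonic_measure K (x n) \<le> 1" using w1[OF x(1), of n] nw[OF x(1), of n] by simp
    qed
  qed simp
  then have "(\<lambda>n. exp (harmonic_measure K (x n) - 1)) \<longlonglongrightarrow> exp (1 - 1)" by (intro tendsto_intros)
  then have "(\<lambda>n. cmod (w (x n))) \<longlonglongrightarrow> 1" using nw[OF x(1)] by simp
  then have "(\<lambda>n. cmod (w (x (k n)))) \<longlonglongrightarrow> 1" using LIMSEQ_subseq_LIMSEQ[OF _ k] by (simp add: o_def)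
  then have a1: "cmod a = 1" using tendsto_norm[OF a] LIMSEQ_unique by blast
  \<comment> \<open>The square root turns the half plane containing \<open>1 / q\<close> into a sector; \<open>f\<close> blows up where \<open>w\<close> approaches \<open>a\<close>.\<close>
  define q where "q z = 1 - cnj a * w z" for z
  define f where "f z = csqrt (1 / q z)" for z
  have Req: "0 < Re (q z)" if "z \<in> unit_disk" for z
  proof -
    have "Re (cnj a * w z) \<le> cmod (cnj a * w z)" by (rule complex_Re_le_cmod)
    also have "\<dots> < 1" using w1[OF that] a1 by (simp add: norm_mult)
    finally show ?thesis by (simp add: q_def)
  qed
  have Reiq: "0 < Re (1 / q z)" if "z \<in> unit_disk" for z
    using Req[OF that] by (auto simp: Re_divide intro!: divide_pos_pos add_pos_nonneg)
  have qnz: "q z \<noteq> 0" if "z \<in> unit_disk" for z using Req[OF that] by auto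
  have hq: "q holomorphic_on unit_disk" unfolding q_def using hw by (intro holomorphic_intros)
  have hf: "f holomorphic_on unit_disk"
    unfolding f_def
  proof (rule holomorphic_on_csqrt')
    show "(\<lambda>z. 1 / q z) holomorphic_on unit_disk" using hq qnz by (intro holomorphic_intros)
    show "1 / q z \<notin> \<real>\<^sub>\<le>\<^sub>0" if "z \<in> unit_disk" for z using Reiq[OF that] by (auto simp: complex_nonpos_Reals_iff)
  qed
  have f2: "(f z)\<^sup>2 = 1 / q z" for z by (simp add: f_def)
  have nf: "(cmod (f z))\<^sup>2 = 1 / cmod (q z)" for z
    using arg_cong[OF f2, of cmod] by (simp add: norm_power norm_divide)
  have "f \<in> Smirnov"
  proof (rule sectorial_in_Smirnov[OF hf])
    fix z :: complex assume z: "z \<in> unit_disk"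
    have "0 < (Re (f z))\<^sup>2 - (Im (f z))\<^sup>2" using Reiq[OF z] unfolding f2[symmetric] by (simp add: power2_eq_square)
    moreover have "0 \<le> (Re (f z))\<^sup>2" by simp
    ultimately have "(cmod (f z))\<^sup>2 \<le> 4 * (Re (f z))\<^sup>2" unfolding cmod_power2 by linarith
    then have "(cmod (f z))\<^sup>2 \<le> (2 * Re (f z))\<^sup>2" by (simp add: power_mult_distrib)
    moreover have "0 \<le> Re (f z)" unfolding f_def by (rule Re_csqrt)
    then have "0 \<le> 2 * Re (f z)" by simp
    ultimately show "cmod (f z) \<le> 2 * Re (f z)" by (rule power2_le_imp_le)
  qed
  moreover have "bounded (f ` \<Lambda>)"
  proof -
    have "cmod (f l) \<le> sqrt (1 / (1 - exp (- e)))" if l: "l \<in> \<Lambda>" for l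
    proof -
      have "1 - cmod (cnj a * w l) \<le> cmod (q l)" unfolding q_def by (metis norm_one norm_triangle_ineq2)
      then have "1 - exp (- e) \<le> cmod (q l)" using w\<Lambda>[OF l] a1 by (simp add: norm_mult)
      then have "1 / cmod (q l) \<le> 1 / (1 - exp (- e))" using e by (intro divide_left_mono mult_pos_pos) auto
      then show ?thesis unfolding nf[symmetric] by (rule real_le_rsqrt)
    qed
    then show ?thesis unfolding bounded_iff by blast
  qed
  ultimately have "bounded (f ` unit_disk)" using D by (simp add: determination_Smirnov_def)
  then obtain B where B: "0 < B" "\<And>z. z \<in> unit_disk \<Longrightarrow> cmod (f z) \<le> B" unfolding bounded_pos by auto
  have "(\<lambda>n. q (x (k n))) \<longlonglongrightarrow> 1 - cnj a * a" unfolding q_def by (intro tendsto_intros a)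
  then have "(\<lambda>n. cmod (q (x (k n)))) \<longlonglongrightarrow> 0"
    using a1 complex_norm_square[of a] tendsto_norm by (fastforce simp: mult.commute)
  then have "\<forall>\<^sub>F n in sequentially. cmod (q (x (k n))) < 1 / B\<^sup>2" by (rule order_tendstoD) (use B in simp)
  then obtain n where n: "cmod (q (x (k n))) < 1 / B\<^sup>2" unfolding eventually_sequentially by blast
  have "q (x (k n)) \<noteq> 0" by (rule qnz[OF x(1)])
  then have "B\<^sup>2 < 1 / cmod (q (x (k n)))" using n B by (simp add: field_simps)
  also have "\<dots> = (cmod (f (x (k n))))\<^sup>2" by (rule nf[symmetric])
  also have "\<dots> \<le> B\<^sup>2" using B(2)[OF x(1)] by (intro power_mono) auto
  finally show False by simp
qed

theorem theorem2p3:
  fixes \<Lambda> :: "complex set"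
  assumes "\<Lambda> \<subseteq> unit_disk"
  shows "(sampling_Smirnov \<Lambda> \<longleftrightarrow> determination_Smirnov \<Lambda>) \<and>
         (determination_Smirnov \<Lambda> \<longleftrightarrow> strongly_sampling_Smirnov \<Lambda>) \<and>
         (strongly_sampling_Smirnov \<Lambda> \<longleftrightarrow> arc_length (NT \<Lambda>) = 2 * pi)"
  using sampling_imp_determination[OF assms] determination_imp_full_NT[OF assms]
    full_NT_imp_strongly_sampling[OF assms] strongly_sampling_imp_sampling[OF assms] by blast

end
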